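(* Let $n>1$ be an odd integer, let $K$ be a field, and let $I=I_{n-2}(C_n)\subset K[x_1,\ldots,x_n]$ be the $(n-2)$-path ideal of the $n$-cycle. Then the Cohen–Macaulay type of the Rees algebra $R(I)$ is $2$.
   Context: $I_{n-2}(C_n)$ is the ideal of $S=K[x_1,\ldots,x_n]$ generated by the monomials $u_j=x_jx_{j+1}\cdots x_{j+n-3}$, $j=1,\ldots,n$, with indices modulo $n$. The Rees algebra is $R(I)=S[u_1s,\ldots,u_ns]\subset S[s]$ with $s$ a new variable, regarded as a standard graded $K$-algebra with each $x_i$ and each $u_js$ of degree $1$; it is Cohen–Macaulay. The Cohen–Macaulay type of a Cohen–Macaulay standard graded $K$-algebra is the minimal number of generators of its graded canonical module. *)

theory Defs
  imports
    "HOL-Library.Poly_Mapping"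
    "HOL-Library.Extended_Nat"
    "HOL-Computational_Algebra.Polynomial"
    "HOL-Algebra.Ideal"
    "HOL-Algebra.Generated_Rings"
    "Jordan_Normal_Form.Matrix"
begin

text \<open>
  Monomials are exponent vectors of type \<open>nat \<Rightarrow>\<^sub>0 nat\<close>; the product of
  \<open>'k mpoly\<close> is the convolution product of the library. The ring
  \<open>K[z_0,...,z_{N-1}]\<close> is the subset \<open>mpolys N\<close>.
\<close>

type_synonym 'k mpoly = "(nat \<Rightarrow>\<^sub>0 nat) \<Rightarrow>\<^sub>0 'k"

definition mpolys :: "nat \<Rightarrow> ('k::comm_ring_1) mpoly set" where
  "mpolys N = {p. \<forall>m \<in> Poly_Mapping.keys p. Poly_Mapping.keys m \<subseteq> {..<N}}"

definition const :: "'k::comm_ring_1 \<Rightarrow> 'k mpoly" where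
  "const c = Poly_Mapping.single 0 c"

definition var :: "nat \<Rightarrow> ('k::comm_ring_1) mpoly" where
  "var i = Poly_Mapping.single (Poly_Mapping.single i 1) 1"

definition monomial_degree :: "(nat \<Rightarrow>\<^sub>0 nat) \<Rightarrow> nat" where
  "monomial_degree m = (\<Sum>i \<in> Poly_Mapping.keys m. Poly_Mapping.lookup m i)"

text \<open>
  Zero is homogeneous of every degree, and it is the only element that is homogeneous of
  negative degree.
\<close>

definition homogeneous :: "int \<Rightarrow> ('k::comm_ring_1) mpoly \<Rightarrow> bool" where
  "homogeneous e p \<longleftrightarrow> (\<forall>m \<in> Poly_Mapping.keys p. int (monomial_degree m) = e)"

text \<open>
  Evaluation of a polynomial at \<open>g_0, g_1, ...\<close> in a \<open>K\<close>-algebra with structure map \<open>\<iota>\<close>.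
\<close>

definition evaluate ::
  "('k::comm_ring_1 \<Rightarrow> 'r::comm_ring_1) \<Rightarrow> (nat \<Rightarrow> 'r) \<Rightarrow> 'k mpoly \<Rightarrow> 'r" where
  "evaluate \<iota> g p = (\<Sum>m \<in> Poly_Mapping.keys p.
      \<iota> (Poly_Mapping.lookup p m) * (\<Prod>i \<in> Poly_Mapping.keys m. g i ^ Poly_Mapping.lookup m i))"

definition relation_ideal ::
  "('k::comm_ring_1 \<Rightarrow> 'r::comm_ring_1) \<Rightarrow> 'r list \<Rightarrow> 'k mpoly set" where
  "relation_ideal \<iota> gs = {p \<in> mpolys (length gs). evaluate \<iota> ((!) gs) p = 0}"

definition ring_on :: "'r::comm_ring_1 set \<Rightarrow> 'r ring" where
  "ring_on R = \<lparr>carrier = R, monoid.mult = (*), one = 1, zero = 0, add = (+)\<rparr>"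

definition krull_dim :: "('r, 'm) ring_scheme \<Rightarrow> enat" where
  "krull_dim A = Sup {enat l | l. \<exists>p :: nat \<Rightarrow> 'r set.
      (\<forall>i \<le> l. primeideal (p i) A) \<and> (\<forall>i < l. p i \<subset> p (Suc i))}"

definition poly_vecs :: "nat \<Rightarrow> nat \<Rightarrow> ('k::comm_ring_1) mpoly vec set" where
  "poly_vecs N r = {v \<in> carrier_vec r. \<forall>i < r. v $ i \<in> mpolys N}"

definition poly_mats :: "nat \<Rightarrow> nat \<Rightarrow> nat \<Rightarrow> ('k::comm_ring_1) mpoly mat set" where
  "poly_mats N r s = {A \<in> carrier_mat r s. \<forall>i < r. \<forall>j < s. A $$ (i, j) \<in> mpolys N}"

text \<open>
  A graded free resolution of \<open>P/J\<close>, where \<open>P = K[z_0,...,z_{N-1}]\<close> is standard graded: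
  the \<open>i\<close>-th module is \<open>F_i = P(-a i 0) \<oplus> ... \<oplus> P(-a i (b i - 1))\<close>, with \<open>F_0 = P\<close>, and
  \<open>D i\<close> is the matrix of the differential \<open>F_{i+1} \<rightarrow> F_i\<close>, acting on column vectors. The
  augmentation is \<open>P \<rightarrow> P/J\<close>. No minimality is required, and ranks may be zero.
  Over a field, such a resolution exists exactly when \<open>J\<close> is a homogeneous ideal.
\<close>

definition graded_free_resolution ::
  "nat \<Rightarrow> ('k::comm_ring_1) mpoly set \<Rightarrow> (nat \<Rightarrow> nat) \<Rightarrow> (nat \<Rightarrow> nat \<Rightarrow> int) \<Rightarrow>
    (nat \<Rightarrow> 'k mpoly mat) \<Rightarrow> bool" where
  "graded_free_resolution N J b a D \<longleftrightarrow>
     b 0 = 1 \<and> a 0 0 = 0 \<and>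
     (\<forall>i. D i \<in> poly_mats N (b i) (b (Suc i))) \<and>
     (\<forall>i. \<forall>j < b i. \<forall>k < b (Suc i). homogeneous (a (Suc i) k - a i j) (D i $$ (j, k))) \<and>
     {(D 0 *\<^sub>v v) $ 0 | v. v \<in> poly_vecs N (b 1)} = J \<and>
     (\<forall>i. {v \<in> poly_vecs N (b (Suc i)). D i *\<^sub>v v = 0\<^sub>v (b i)}
          = {D (Suc i) *\<^sub>v w | w. w \<in> poly_vecs N (b (Suc (Suc i)))})"

text \<open>
  Dualizing the resolution into \<open>P\<close> transposes the matrices, so the module
  \<open>Ext^c_P(P/J, P)\<close> is \<open>ext_cocycles N b D c\<close> modulo \<open>ext_coboundaries N b D c\<close>.
\<close>

definition ext_cocycles ::
  "nat \<Rightarrow> (nat \<Rightarrow> nat) \<Rightarrow> (nat \<Rightarrow> ('k::comm_ring_1) mpoly mat) \<Rightarrow> nat \<Rightarrow> 'k mpoly vec set" where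
  "ext_cocycles N b D c =
     {v \<in> poly_vecs N (b c). transpose_mat (D c) *\<^sub>v v = 0\<^sub>v (b (Suc c))}"

definition ext_coboundaries ::
  "nat \<Rightarrow> (nat \<Rightarrow> nat) \<Rightarrow> (nat \<Rightarrow> ('k::comm_ring_1) mpoly mat) \<Rightarrow> nat \<Rightarrow> 'k mpoly vec set" where
  "ext_coboundaries N b D c =
     (case c of 0 \<Rightarrow> {0\<^sub>v (b 0)}
        | Suc c' \<Rightarrow> {transpose_mat (D c') *\<^sub>v w | w. w \<in> poly_vecs N (b c')})"

text \<open>
  The least number of generators of the module \<open>Z/B\<close>, for submodules \<open>B \<subseteq> Z\<close> of \<open>P^r\<close>.
  The columns of the matrix \<open>G\<close> represent the generators.
\<close>

definition min_generators ::
  "nat \<Rightarrow> nat \<Rightarrow> ('k::comm_ring_1) mpoly vec set \<Rightarrow> 'k mpoly vec set \<Rightarrow> nat" where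
  "min_generators N r Z B = (LEAST t. \<exists>G \<in> poly_mats N r t.
      (\<forall>j < t. col G j \<in> Z) \<and>
      (\<forall>z \<in> Z. \<exists>w \<in> poly_vecs N t. \<exists>y \<in> B. z = G *\<^sub>v w + y))"

text \<open>
  Let \<open>R\<close> be the standard graded \<open>K\<close>-algebra generated by the elements of \<open>gs\<close>, placed in
  degree 1, and let \<open>N\<close> be their number. Then \<open>R = P/J\<close> with \<open>J\<close> the ideal of relations,
  and for \<open>d = dim R\<close> the graded canonical module of \<open>R\<close> is
  \<open>\<omega>_R = Ext^{N-d}_P(R, P(-N))\<close>. The twist by \<open>-N\<close> shifts the grading only and plays no
  role for the number of generators; \<open>J\<close> annihilates \<open>\<omega>_R\<close>, so generators over \<open>P\<close> and
  over \<open>R\<close> are the same. The module does not depend, up to isomorphism, on the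
  chosen resolution. The predicate is meant for Cohen--Macaulay \<open>R\<close>.
\<close>

definition has_cm_type ::
  "('k::comm_ring_1 \<Rightarrow> 'r::comm_ring_1) \<Rightarrow> 'r set \<Rightarrow> 'r list \<Rightarrow> nat \<Rightarrow> bool" where
  "has_cm_type \<iota> R gs t \<longleftrightarrow>
     (let N = length gs in
      R = evaluate \<iota> ((!) gs) ` mpolys N \<and>
      (\<exists>d b a D. d \<le> N \<and> krull_dim (ring_on R) = enat d \<and>
         graded_free_resolution N (relation_ideal \<iota> gs) b a D \<and>
         min_generators N (b (N - d)) (ext_cocycles N b D (N - d)) (ext_coboundaries N b D (N - d)) = t))"

text \<open>The variables \<open>x_1,...,x_n\<close> are indexed by \<open>0,...,n-1\<close> here.\<close>

definition path_monomial :: "nat \<Rightarrow> nat \<Rightarrow> nat \<Rightarrow> ('k::comm_ring_1) mpoly" where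
  "path_monomial n t j = (\<Prod>i < t. var ((j + i) mod n))"

definition cycle_path_ideal :: "nat \<Rightarrow> nat \<Rightarrow> ('k::comm_ring_1) mpoly set" where
  "cycle_path_ideal n t = Idl\<^bsub>ring_on (mpolys n)\<^esub> (path_monomial n t ` {..<n})"

text \<open>
  The Rees algebra \<open>S[I s] \<subseteq> S[s]\<close>; \<open>S[s]\<close> is the type of univariate polynomials over
  \<open>'k mpoly\<close>, and \<open>Polynomial.monom f 1\<close> is \<open>f s\<close>.
\<close>

definition rees_algebra :: "('k::comm_ring_1) mpoly set \<Rightarrow> 'k mpoly set \<Rightarrow> 'k mpoly poly set" where
  "rees_algebra S I =
     generate_ring (ring_on UNIV) ({[:f:] | f. f \<in> S} \<union> {Polynomial.monom f 1 | f. f \<in> I})"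

definition rees_generators :: "nat \<Rightarrow> nat \<Rightarrow> ('k::comm_ring_1) mpoly poly list" where
  "rees_generators n t =
     map (\<lambda>i. [:var i:]) [0..<n] @ map (\<lambda>j. Polynomial.monom (path_monomial n t j) 1) [0..<n]"

end

theory Submission
  imports Defs "HOL-Number_Theory.Cong"
begin

text \<open>
  Number the generators around the cycle, modulo \<open>n\<close>, so that \<open>Y\<^sub>a\<close> is the generator \<open>u s\<close> of the
  Rees algebra whose monomial \<open>u\<close> misses \<open>X\<^sub>a\<close> and \<open>X\<^sub>a\<^sub>+\<^sub>1\<close>. Both \<open>X\<^sub>a Y\<^sub>a\<close> and \<open>X\<^sub>a\<^sub>+\<^sub>2 Y\<^sub>a\<^sub>+\<^sub>1\<close>
  are \<open>s\<close> times the product of all variables except \<open>X\<^sub>a\<^sub>+\<^sub>1\<close>, which gives \<open>n\<close> quadratic relations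
  \<open>g\<^sub>a = X\<^sub>a Y\<^sub>a - X\<^sub>a\<^sub>+\<^sub>2 Y\<^sub>a\<^sub>+\<^sub>1\<close> in the polynomial ring \<open>P\<close> in \<open>2 n\<close> variables.

  For odd \<open>n\<close> they generate the ideal \<open>J\<close> of all relations (\<open>kernel_ev\<close>), and the Rees algebra has
  dimension \<open>n + 1\<close> (\<open>krull_dim_image\<close>), so \<open>J\<close> has codimension \<open>n - 1\<close> and is one generator away
  from a complete intersection. Indeed \<open>g\<^sub>1, ..., g\<^sub>n\<^sub>-\<^sub>1\<close> is a regular sequence (\<open>rels_regular\<close>):
  in a suitable order the leading terms are \<open>X\<^sub>a Y\<^sub>a\<close>, and these are pairwise coprime. Let \<open>C\<close> be the
  ideal of this sequence. Then the canonical module \<open>Ext\<^sup>n\<^sup>-\<^sup>1(P/J, P)\<close> is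
  \<open>Hom(P/J, P/C) = (C : J)/C\<close> (\<open>generated_by_Ext\<close>), and \<open>C : J = C : g\<^sub>0\<close> because \<open>J = C + (g\<^sub>0)\<close>.

  Two multipliers bring \<open>g\<^sub>0\<close> into \<open>C\<close>. The first is \<open>X\<^sub>1\<close>, because the products \<open>X\<^sub>a\<^sub>+\<^sub>1 g\<^sub>a\<close>
  telescope around the cycle (\<open>x1_rel0\<close>). The second is \<open>h = Y\<^sub>2 Y\<^sub>4 ... Y\<^sub>n\<^sub>-\<^sub>1\<close>, because modulo \<open>C\<close>
  both terms of \<open>h g\<^sub>0\<close> can be rewritten as \<open>X\<^sub>1 Y\<^sub>0 Y\<^sub>1 Y\<^sub>3 ... Y\<^sub>n\<^sub>-\<^sub>2\<close> (\<open>h_rel0\<close>). Following the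
  rewriting of \<open>X\<^sub>2 Y\<^sub>1 m\<close> for a monomial \<open>m\<close> shows that there are no others:
  \<open>C : g\<^sub>0 = C + (X\<^sub>1, h)\<close> (\<open>colon_rel0\<close>). Finally \<open>(X\<^sub>1, h)\<close> is not principal modulo \<open>C\<close>
  (\<open>linked_not_principal\<close>), so that the type is \<open>2\<close>.

  Ext is computed from a graded free resolution of \<open>P/J\<close>, which exists because graded submodules of
  free modules are finitely generated (\<open>graded_resolution_exists\<close>).
\<close>

abbreviation keys where "keys \<equiv> Poly_Mapping.keys"
abbreviation lookup where "lookup \<equiv> Poly_Mapping.lookup"

section \<open>Polynomials in finitely many variables\<close>

abbreviation mon :: "(nat \<Rightarrow>\<^sub>0 nat) \<Rightarrow> 'k::comm_ring_1 mpoly" where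
  "mon m \<equiv> Poly_Mapping.single m 1"

abbreviation expo :: "nat \<Rightarrow> nat \<Rightarrow>\<^sub>0 nat" where
  "expo i \<equiv> Poly_Mapping.single i (Suc 0)"

lemma keys_plus_nat: "keys (m + m' :: nat \<Rightarrow>\<^sub>0 nat) = keys m \<union> keys m'"
  by (auto simp: in_keys_iff lookup_add)

lemma single_mult_mon: "Poly_Mapping.single m c * mon m' = Poly_Mapping.single (m + m') (c::'k::comm_ring_1)"
  by (simp add: mult_single)

lemma mpoly_eq_sum_single:
  "p = (\<Sum>m\<in>keys p. Poly_Mapping.single m (lookup p m))"
proof (rule poly_mapping_eqI)
  fix k
  show "lookup p k = lookup (\<Sum>m\<in>keys p. Poly_Mapping.single m (lookup p m)) k"
    by (auto simp: lookup_sum lookup_single when_def sum.delta' in_keys_iff)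
qed

lemma mpolys_0 [simp]: "0 \<in> mpolys N" by (simp add: mpolys_def)

lemma single_in_mpolys: "keys m \<subseteq> {..<N} \<Longrightarrow> Poly_Mapping.single m c \<in> mpolys N"
  by (simp add: mpolys_def)

lemma mpolys_1 [simp]: "1 \<in> mpolys N"
  using single_in_mpolys[of 0 N 1] by simp

lemma const_in_mpolys [simp]: "const c \<in> mpolys N"
  by (simp add: const_def single_in_mpolys)

lemma var_in_mpolys: "i < N \<Longrightarrow> var i \<in> mpolys N"
  by (simp add: var_def single_in_mpolys)

lemma mpolys_add: "p \<in> mpolys N \<Longrightarrow> q \<in> mpolys N \<Longrightarrow> p + q \<in> mpolys N"
  using keys_add[of p q] by (auto simp: mpolys_def)

lemma mpolys_uminus: "p \<in> mpolys N \<Longrightarrow> - p \<in> mpolys N"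
  by (auto simp: mpolys_def in_keys_iff)

lemma mpolys_diff: "p \<in> mpolys N \<Longrightarrow> q \<in> mpolys N \<Longrightarrow> p - q \<in> mpolys N"
  using mpolys_add[of p N "- q"] mpolys_uminus[of q N] by simp

lemma mpolys_mult: "p \<in> mpolys N \<Longrightarrow> q \<in> mpolys N \<Longrightarrow> p * q \<in> mpolys N"
  using keys_mult[of p q] by (fastforce simp: mpolys_def keys_plus_nat)

lemma mpolys_sum: "(\<And>i. i \<in> I \<Longrightarrow> f i \<in> mpolys N) \<Longrightarrow> sum f I \<in> mpolys N"
  by (induction I rule: infinite_finite_induct) (auto intro: mpolys_add)

lemma mpolys_mono: "N \<le> M \<Longrightarrow> mpolys N \<subseteq> mpolys M"
  by (fastforce simp: mpolys_def)

lemma keys_in_mpolys: "p \<in> mpolys N \<Longrightarrow> m \<in> keys p \<Longrightarrow> keys m \<subseteq> {..<N}"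
  by (auto simp: mpolys_def)

text \<open>
  Polynomial identities that are additive in the polynomial need checking on single terms only.
\<close>

lemma mpoly_additive_induct [case_names zero single add]:
  fixes p :: "'a::comm_ring_1 mpoly"
  assumes "P 0" "\<And>m c. P (Poly_Mapping.single m c)" "\<And>p q. P p \<Longrightarrow> P q \<Longrightarrow> P (p + q)"
  shows "P p"
proof -
  have *: "P (sum f A)" if "finite A" "\<And>a. a \<in> A \<Longrightarrow> P (f a)"
    for f :: "(nat \<Rightarrow>\<^sub>0 nat) \<Rightarrow> 'a mpoly" and A
    using that by (induction A rule: finite_induct) (auto intro: assms)
  have "P (\<Sum>m\<in>keys p. Poly_Mapping.single m (lookup p m))"
    by (rule *) (simp_all add: assms(2))
  then show ?thesis by (simp only: mpoly_eq_sum_single[symmetric])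
qed

lemma mpolys_additive_induct [consumes 1, case_names zero single add]:
  fixes p :: "'a::comm_ring_1 mpoly"
  assumes "p \<in> mpolys N" "P 0" "\<And>m c. keys m \<subseteq> {..<N} \<Longrightarrow> P (Poly_Mapping.single m c)"
    "\<And>p q. P p \<Longrightarrow> P q \<Longrightarrow> P (p + q)"
  shows "P p"
proof -
  have *: "P (sum f A)" if "finite A" "\<And>a. a \<in> A \<Longrightarrow> P (f a)"
    for f :: "(nat \<Rightarrow>\<^sub>0 nat) \<Rightarrow> 'a mpoly" and A
    using that by (induction A rule: finite_induct) (auto intro: assms)
  have "P (\<Sum>m\<in>keys p. Poly_Mapping.single m (lookup p m))"
    by (rule *) (auto intro!: assms(3) dest: keys_in_mpolys[OF assms(1)])
  then show ?thesis by (simp only: mpoly_eq_sum_single[symmetric])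
qed

lemma lookup_single_mult_add:
  "lookup (Poly_Mapping.single m c * p) (m + k) = c * lookup (p :: 'k::comm_ring_1 mpoly) k"
proof (induction p rule: mpoly_additive_induct)
  case (single m' c')
  then show ?case by (simp add: mult_single lookup_single when_def)
qed (simp_all add: lookup_add distrib_left)

lemma lookup_single_mult_not_dvd:
  assumes "\<And>r. k \<noteq> m + r"
  shows "lookup (Poly_Mapping.single m c * (p :: 'k::comm_ring_1 mpoly)) k = 0"
proof (induction p rule: mpoly_additive_induct)
  case (single m' c')
  then show ?case using assms[of m'] by (simp add: mult_single lookup_single when_def)
qed (simp_all add: lookup_add distrib_left)

lemma lookup_mult_zero:
  "lookup (p * q) 0 = lookup p 0 * lookup (q :: 'k::comm_ring_1 mpoly) 0"
proof (induction p rule: mpoly_additive_induct)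
  case (single m c)
  show ?case
  proof (cases "m = 0")
    case True
    then show ?thesis using lookup_single_mult_add[of 0 c q 0] by simp
  next
    case False
    then have "lookup (Poly_Mapping.single m c * q) 0 = 0"
      by (intro lookup_single_mult_not_dvd) (metis add_is_0 lookup_add lookup_zero poly_mapping_eqI)
    then show ?thesis using False by (simp add: lookup_single)
  qed
qed (simp_all add: lookup_add distrib_right)

section \<open>Syzygies of homogeneous matrices\<close>

text \<open>
  Vectors of length \<open>r\<close> with entries in \<open>P\<close> are functions that vanish from \<open>r\<close> on, so that
  sums of vectors need no dimension conditions.
\<close>

definition cvecs :: "'r::zero set \<Rightarrow> nat \<Rightarrow> (nat \<Rightarrow> 'r) set" where
  "cvecs P r = {v. (\<forall>j<r. v j \<in> P) \<and> (\<forall>j\<ge>r. v j = 0)}"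

lemma cvecs_mem: "v \<in> cvecs P r \<Longrightarrow> 0 \<in> P \<Longrightarrow> v j \<in> P"
  by (cases "j < r") (auto simp: cvecs_def)

lemma cvecs_zero: "v \<in> cvecs P r \<Longrightarrow> r \<le> j \<Longrightarrow> v j = 0"
  by (simp add: cvecs_def)

definition mat_apply :: "nat \<Rightarrow> nat \<Rightarrow> (nat \<Rightarrow> nat \<Rightarrow> 'r::comm_ring_1) \<Rightarrow> (nat \<Rightarrow> 'r) \<Rightarrow> nat \<Rightarrow> 'r" where
  "mat_apply r c A w = (\<lambda>i. if i < r then \<Sum>j<c. A i j * w j else 0)"

definition mon_dvd :: "(nat \<Rightarrow>\<^sub>0 nat) \<Rightarrow> (nat \<Rightarrow>\<^sub>0 nat) \<Rightarrow> bool" where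
  "mon_dvd m k \<longleftrightarrow> (\<exists>r. k = m + r)"

lemma mon_dvd_iff: "mon_dvd m k \<longleftrightarrow> (\<forall>i. lookup m i \<le> lookup k i)"
proof
  assume "\<forall>i. lookup m i \<le> lookup k i"
  then have "k = m + (k - m)"
    by (intro poly_mapping_eqI) (simp add: lookup_add lookup_minus)
  then show "mon_dvd m k" unfolding mon_dvd_def ..
qed (auto simp: mon_dvd_def lookup_add)

lemma nat_seq_mono_subseq:
  fixes s :: "nat \<Rightarrow> nat"
  shows "\<exists>f :: nat \<Rightarrow> nat. strict_mono f \<and> mono (s \<circ> f)"
proof -
  obtain f :: "nat \<Rightarrow> nat" where f: "strict_mono f" "monoseq (\<lambda>n. s (f n))" using seq_monosub by blast
  show ?thesis
  proof (cases "incseq (\<lambda>n. s (f n))")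
    case True
    then show ?thesis using f(1) by (auto simp: comp_def)
  next
    case False
    then have dec: "decseq (\<lambda>n. s (f n))" using f(2) monoseq_iff by blast
    obtain i0 where i0: "\<And>i. s (f i0) \<le> s (f i)"
      using ex_has_least_nat[of "\<lambda>_. True" 0 "\<lambda>i. s (f i)"] by auto
    have const: "s (f (i0 + i)) = s (f i0)" for i
      using i0[of "i0 + i"] decseqD[OF dec, of i0 "i0 + i"] by simp
    have "strict_mono (\<lambda>i. f (i0 + i))"
      using f(1) by (auto simp: strict_mono_def)
    moreover have "mono (s \<circ> (\<lambda>i. f (i0 + i)))" by (simp add: const comp_def mono_def)
    ultimately show ?thesis by blast
  qed
qed

lemma exponent_seq_mono_subseq:
  fixes s :: "nat \<Rightarrow> nat \<Rightarrow>\<^sub>0 nat"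
  shows "\<exists>f :: nat \<Rightarrow> nat. strict_mono f \<and> (\<forall>k<N. mono (\<lambda>i. lookup (s (f i)) k))"
proof (induction N)
  case 0
  have "strict_mono (id :: nat \<Rightarrow> nat)" by (simp add: strict_mono_def)
  then show ?case by blast
next
  case (Suc N)
  then obtain f :: "nat \<Rightarrow> nat" where f: "strict_mono f" "\<forall>k<N. mono (\<lambda>i. lookup (s (f i)) k)" by blast
  obtain g :: "nat \<Rightarrow> nat" where g: "strict_mono g" "mono ((\<lambda>i. lookup (s (f i)) N) \<circ> g)"
    using nat_seq_mono_subseq by blast
  have "strict_mono (\<lambda>i. f (g i))" using f(1) g(1) by (simp add: strict_mono_def)
  moreover have "mono (\<lambda>i. lookup (s (f (g i))) k)" if "k < Suc N" for k
  proof (cases "k = N")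
    case True
    then show ?thesis using g(2) by (simp add: comp_def)
  next
    case False
    then have "mono (\<lambda>i. lookup (s (f i)) k)" using f(2) that by simp
    then show ?thesis using strict_mono_mono[OF g(1)] by (simp add: mono_def)
  qed
  ultimately show ?case by blast
qed

lemma monomial_degree_add: "monomial_degree (m + k) = monomial_degree m + monomial_degree k"
  unfolding monomial_degree_def by (rule setsum_keys_plus_distrib) auto

lemma monomial_degree_single [simp]: "monomial_degree (Poly_Mapping.single i d) = d"
  by (simp add: monomial_degree_def)

lemma monomial_degree_0_iff: "monomial_degree m = 0 \<longleftrightarrow> m = 0"
  by (auto simp: monomial_degree_def in_keys_iff intro!: poly_mapping_eqI)

text \<open>
  Dickson's lemma, with the divisibility-minimal elements of \<open>A\<close> as \<open>F\<close>. If there were infinitely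
  many of them, a subsequence that is monotone in each of the \<open>N\<close> exponents would contain two
  different ones of which one divides the other.
\<close>

lemma dickson:
  assumes keys: "\<And>m. m \<in> A \<Longrightarrow> keys m \<subseteq> {..<N}"
  shows "\<exists>F\<subseteq>A. finite F \<and> (\<forall>m\<in>A. \<exists>f\<in>F. mon_dvd f m)"
proof -
  define F where "F = {m\<in>A. \<forall>f\<in>A. mon_dvd f m \<longrightarrow> f = m}"
  have "\<exists>f\<in>F. mon_dvd f m" if "m \<in> A" for m
    using that
  proof (induction "monomial_degree m" arbitrary: m rule: less_induct)
    case less
    show ?case
    proof (cases "m \<in> F")
      case True
      then show ?thesis by (auto simp: mon_dvd_iff)
    next
      case False
      then obtain f where f: "f \<in> A" "mon_dvd f m" "f \<noteq> m" using less.prems by (auto simp: F_def)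
      then obtain r where r: "m = f + r" by (auto simp: mon_dvd_def)
      then have "r \<noteq> 0" using f(3) by auto
      then have "monomial_degree f < monomial_degree m"
        using monomial_degree_0_iff[of r] by (simp add: r monomial_degree_add)
      then obtain h where "h \<in> F" "mon_dvd h f" using less.hyps f(1) by blast
      then show ?thesis using f(2) by (meson mon_dvd_iff order_trans)
    qed
  qed
  moreover have "finite F"
  proof (rule ccontr)
    assume "infinite F"
    then obtain s :: "nat \<Rightarrow> _" where s: "inj s" "range s \<subseteq> F"
      using infinite_countable_subset by blast
    obtain f :: "nat \<Rightarrow> nat" where f: "strict_mono f" "\<forall>k<N. mono (\<lambda>i. lookup (s (f i)) k)"
      using exponent_seq_mono_subseq by blast
    have inA: "s i \<in> A" for i using s(2) by (auto simp: F_def)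
    have "lookup (s (f 0)) k \<le> lookup (s (f 1)) k" for k
    proof (cases "k < N")
      case True
      then show ?thesis using f(2) by (auto simp: mono_def)
    next
      case False
      then have "k \<notin> keys (s (f 0))" using keys[OF inA[of "f 0"]] by auto
      then show ?thesis by (simp add: in_keys_iff)
    qed
    then have "mon_dvd (s (f 0)) (s (f 1))" by (simp add: mon_dvd_iff)
    then have "s (f 0) = s (f 1)" using s(2) inA[of "f 0"] by (auto simp: F_def)
    then have "f 0 = f 1" using s(1) by (simp add: inj_eq)
    then show False using f(1) by (metis strict_mono_eq zero_neq_one)
  qed
  ultimately show ?thesis unfolding F_def by (intro exI[of _ F]) (auto simp: F_def)
qed

lemma finite_bounded_exponents:
  "finite {m :: nat \<Rightarrow>\<^sub>0 nat. keys m \<subseteq> {..<N} \<and> (\<forall>i. lookup m i \<le> d)}"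
proof -
  have "finite {f :: nat \<Rightarrow> nat. \<forall>i. (i \<in> {..<N} \<longrightarrow> f i \<in> {..d}) \<and> (i \<notin> {..<N} \<longrightarrow> f i = 0)}"
    by (rule finite_set_of_finite_funs) auto
  moreover have "lookup ` {m :: nat \<Rightarrow>\<^sub>0 nat. keys m \<subseteq> {..<N} \<and> (\<forall>i. lookup m i \<le> d)} \<subseteq>
     {f. \<forall>i. (i \<in> {..<N} \<longrightarrow> f i \<in> {..d}) \<and> (i \<notin> {..<N} \<longrightarrow> f i = 0)}"
    by (auto simp: in_keys_iff)
  ultimately have "finite (lookup ` {m :: nat \<Rightarrow>\<^sub>0 nat. keys m \<subseteq> {..<N} \<and> (\<forall>i. lookup m i \<le> d)})"
    by (rule rev_finite_subset)
  then show ?thesis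
    by (rule finite_imageD) (auto intro!: inj_onI poly_mapping_eqI)
qed

lemma lookup_le_monomial_degree: "lookup m i \<le> monomial_degree m"
  unfolding monomial_degree_def
  by (cases "i \<in> keys m") (auto simp: in_keys_iff intro!: member_le_sum)

lemma finite_monomials_of_degree:
  "finite {m :: nat \<Rightarrow>\<^sub>0 nat. keys m \<subseteq> {..<N} \<and> int (monomial_degree m) = e}"
proof (rule finite_subset[OF _ finite_bounded_exponents[of N "nat e"]])
  show "{m :: nat \<Rightarrow>\<^sub>0 nat. keys m \<subseteq> {..<N} \<and> int (monomial_degree m) = e}
    \<subseteq> {m. keys m \<subseteq> {..<N} \<and> (\<forall>i. lookup m i \<le> nat e)}"
    using lookup_le_monomial_degree by auto
qed

definition homogeneous_component :: "int \<Rightarrow> 'k::comm_ring_1 mpoly \<Rightarrow> 'k mpoly" where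
  "homogeneous_component e p = (\<Sum>m\<in>{m\<in>keys p. int (monomial_degree m) = e}. Poly_Mapping.single m (lookup p m))"

lemma lookup_homogeneous_component: "lookup (homogeneous_component e p) m = (if int (monomial_degree m) = e then lookup p m else 0)"
  by (auto simp: homogeneous_component_def lookup_sum lookup_single when_def in_keys_iff)

lemma homogeneous_component_zero [simp]: "homogeneous_component e 0 = 0" by (simp add: homogeneous_component_def)

lemma homogeneous_component_add: "homogeneous_component e (p + q) = homogeneous_component e p + homogeneous_component e q"
  by (rule poly_mapping_eqI) (simp add: lookup_homogeneous_component lookup_add)

lemma homogeneous_component_sum: "homogeneous_component e (sum f I) = (\<Sum>i\<in>I. homogeneous_component e (f i))"
  by (induction I rule: infinite_finite_induct) (auto simp: homogeneous_component_add)

lemma homogeneous_component_single: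
  "homogeneous_component e (Poly_Mapping.single m c) = (if int (monomial_degree m) = e then Poly_Mapping.single m c else 0)"
  by (rule poly_mapping_eqI) (auto simp: lookup_homogeneous_component lookup_single when_def)

lemma homogeneous_component_in_mpolys: "p \<in> mpolys N \<Longrightarrow> homogeneous_component e p \<in> mpolys N"
  by (auto simp: mpolys_def in_keys_iff lookup_homogeneous_component split: if_splits)

lemma homogeneous_homogeneous_component: "homogeneous e (homogeneous_component e p)"
  by (auto simp: homogeneous_def in_keys_iff lookup_homogeneous_component split: if_splits)

lemma homogeneous_component_single_mult:
  "homogeneous_component e (Poly_Mapping.single m c * p) = Poly_Mapping.single m c * homogeneous_component (e - int (monomial_degree m)) p"
  by (induction p rule: mpoly_additive_induct)
    (auto simp: homogeneous_component_add distrib_left mult_single homogeneous_component_single monomial_degree_add)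

lemma homogeneous_component_mult:
  assumes "homogeneous d q"
  shows "homogeneous_component e (q * p) = q * homogeneous_component (e - d) p"
proof -
  have "homogeneous_component e ((\<Sum>m\<in>keys q. Poly_Mapping.single m (lookup q m)) * p)
      = (\<Sum>m\<in>keys q. Poly_Mapping.single m (lookup q m)) * homogeneous_component (e - d) p"
    using assms by (auto simp: sum_distrib_right homogeneous_component_sum homogeneous_component_single_mult homogeneous_def intro!: sum.cong)
  then show ?thesis by (simp only: mpoly_eq_sum_single[symmetric])
qed

lemma homogeneous_diff: "homogeneous e p \<Longrightarrow> homogeneous e q \<Longrightarrow> homogeneous e (p - q)"
  by (auto simp: homogeneous_def in_keys_iff lookup_minus)

lemma homogeneous_single_mult:
  assumes "homogeneous e p"
  shows "homogeneous (e + int (monomial_degree r)) (Poly_Mapping.single r c * p)"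
  unfolding homogeneous_def
proof
  fix m assume m: "m \<in> keys (Poly_Mapping.single r c * p)"
  then obtain k where k: "m = r + k"
    using lookup_single_mult_not_dvd[of m r c p] by (auto simp: in_keys_iff)
  then have "k \<in> keys p" using m by (auto simp: in_keys_iff lookup_single_mult_add)
  then show "int (monomial_degree m) = e + int (monomial_degree r)"
    using assms by (auto simp: homogeneous_def k monomial_degree_add)
qed

lemma keys_single_mult_le:
  assumes "p \<noteq> 0" "m \<in> keys (Poly_Mapping.single r c * (p :: 'k::comm_ring_1 mpoly))"
  shows "m \<le> r + Max (keys p)"
proof -
  obtain k where k: "m = r + k"
    using assms(2) lookup_single_mult_not_dvd[of m r c p] by (auto simp: in_keys_iff)
  then have "k \<in> keys p" using assms by (auto simp: in_keys_iff lookup_single_mult_add)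
  then show ?thesis by (simp add: k add_left_mono)
qed

text \<open>
  The noetherian property in its graded form, by leading terms: \<open>a\<close> lists the degrees of the basis
  of the free module that contains \<open>U\<close>. The leading
  term of a vector is the leading monomial of its last nonzero entry. By Dickson's lemma
  finitely many elements of \<open>U\<close> have leading terms that divide all the others, and division by
  them terminates because a degree contains finitely many monomials only.
\<close>

lemma graded_submodule_finitely_generated:
  fixes U :: "(nat \<Rightarrow> 'k::field mpoly) set" and a :: "nat \<Rightarrow> int"
  assumes U: "U \<subseteq> cvecs (mpolys N) c"
    and diff: "\<And>u v. u \<in> U \<Longrightarrow> v \<in> U \<Longrightarrow> (\<lambda>j. u j - v j) \<in> U"
    and mult: "\<And>p u. p \<in> mpolys N \<Longrightarrow> u \<in> U \<Longrightarrow> (\<lambda>j. p * u j) \<in> U"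
  shows "\<exists>t B a'. (\<forall>k<t. B k \<in> U \<and> (\<forall>j<c. homogeneous (a' k - a j) (B k j))) \<and>
    (\<forall>w\<in>U. \<forall>e. (\<forall>j<c. homogeneous (e - a j) (w j)) \<longrightarrow>
       (\<exists>u\<in>cvecs (mpolys N) t. w = (\<lambda>j. \<Sum>k<t. u k * B k j)))"
proof -
  define hv where "hv e w \<longleftrightarrow> (\<forall>j<c. homogeneous (e - a j) (w j))" for e and w :: "nat \<Rightarrow> 'k mpoly"
  define lead where "lead j m w \<longleftrightarrow> w \<in> U \<and> (\<forall>i>j. w i = 0) \<and> w j \<noteq> 0 \<and> Max (keys (w j)) = m" for j m w
  define Lead where "Lead j = {m. \<exists>w e. lead j m w \<and> hv e w}" for j
  have keysN: "keys m \<subseteq> {..<N}" if "w \<in> U" "m \<in> keys (w j)" for w m j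
  proof -
    have "w j \<in> mpolys N" using U that(1) by (cases "j < c") (auto simp: cvecs_def)
    then show ?thesis using that(2) keys_in_mpolys by blast
  qed
  have Max_in: "Max (keys p) \<in> keys p" if "p \<noteq> 0" for p :: "'k mpoly"
    using that by (intro Max_in) auto
  have "keys m \<subseteq> {..<N}" if mL: "m \<in> Lead j" for m j
  proof -
    obtain w where "lead j m w" using mL by (auto simp: Lead_def)
    then show ?thesis using keysN[of w m j] Max_in[of "w j"] by (auto simp: lead_def)
  qed
  then have "\<forall>j. \<exists>F\<subseteq>Lead j. finite F \<and> (\<forall>m\<in>Lead j. \<exists>f\<in>F. mon_dvd f m)"
    by (intro allI dickson)
  then obtain F where F: "\<And>j. F j \<subseteq> Lead j" "\<And>j. finite (F j)" "\<And>j m. m \<in> Lead j \<Longrightarrow> \<exists>f\<in>F j. mon_dvd f m"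
    unfolding choice_iff by blast
  have "\<forall>j f. \<exists>we. f \<in> F j \<longrightarrow> lead j f (fst we) \<and> hv (snd we) (fst we)"
  proof (intro allI)
    fix j f
    show "\<exists>we. f \<in> F j \<longrightarrow> lead j f (fst we) \<and> hv (snd we) (fst we)"
      using F(1)[of j] by (cases "f \<in> F j") (auto simp: Lead_def)
  qed
  then obtain WE0 where WE0: "\<And>j f. f \<in> F j \<Longrightarrow> lead j f (fst (WE0 j f)) \<and> hv (snd (WE0 j f)) (fst (WE0 j f))"
    unfolding choice_iff by blast
  define W where "W j f = fst (WE0 j f)" for j f
  define E where "E j f = snd (WE0 j f)" for j f
  have WE: "\<And>j f. f \<in> F j \<Longrightarrow> lead j f (W j f) \<and> hv (E j f) (W j f)"
    using WE0 by (simp add: W_def E_def)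
  obtain xs where xs: "set xs = (SIGMA j:{..<c}. F j)"
    using finite_list[of "SIGMA j:{..<c}. F j"] F(2) by auto
  define t where "t = length xs"
  define B where "B k = (case xs ! k of (j, f) \<Rightarrow> W j f)" for k
  define a' where "a' k = (case xs ! k of (j, f) \<Rightarrow> E j f)" for k
  have B: "B k \<in> U \<and> hv (a' k) (B k)" if "k < t" for k
    using nth_mem[of k xs] that WE unfolding B_def a'_def t_def xs by (auto simp: lead_def)
  define Span where "Span = {(\<lambda>j. \<Sum>k<t. u k * B k j) | u. u \<in> cvecs (mpolys N) t}"
  have Span_zero: "(\<lambda>j. 0) \<in> Span"
    unfolding Span_def by (rule CollectI, rule exI[of _ "\<lambda>_. 0"]) (simp add: cvecs_def)
  have Span_step: "w \<in> Span" if w'S: "w' \<in> Span" "p \<in> mpolys N" "k < t" "\<And>j. w j = w' j + p * B k j" for w w' p k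
  proof -
    obtain u where u: "u \<in> cvecs (mpolys N) t" "w' = (\<lambda>j. \<Sum>k<t. u k * B k j)"
      using w'S unfolding Span_def by blast
    have "w j = (\<Sum>i<t. (u i + (if i = k then p else 0)) * B i j)" for j
      using that(3,4) by (simp add: u(2) distrib_right sum.distrib if_distrib[of "\<lambda>x. x * _"] cong: if_cong)
    moreover have "(\<lambda>i. u i + (if i = k then p else 0)) \<in> cvecs (mpolys N) t"
      using u(1) that(2,3) by (auto simp: cvecs_def mpolys_add)
    ultimately show ?thesis unfolding Span_def by fast
  qed
  have main: "w \<in> Span" if "j \<le> c" "w \<in> U" "hv e w" "\<forall>i\<ge>j. w i = 0" for j w e
    using that
  proof (induction j arbitrary: w)
    case 0
    then have "w = (\<lambda>j. 0)" by auto
    then show ?case using Span_zero by simp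
  next
    case (Suc j)
    define Mon where "Mon = {m. keys m \<subseteq> {..<N} \<and> int (monomial_degree m) = e - a j}"
    have finM: "finite Mon" unfolding Mon_def by (rule finite_monomials_of_degree)
    \<comment> \<open>The number of monomials of the right degree up to the leading one decreases in each division step.\<close>
    define \<mu> where "\<mu> w = card {m\<in>Mon. w j \<noteq> 0 \<and> m \<le> Max (keys (w j))}" for w :: "nat \<Rightarrow> 'k mpoly"
    from Suc.prems(2-) show ?case
    proof (induction "\<mu> w" arbitrary: w rule: less_induct)
      case less
      show ?case
      proof (cases "w j = 0")
        case True
        then have "\<forall>i\<ge>j. w i = 0" using less.prems(3) by (metis le_antisym not_less_eq_eq)
        then show ?thesis using Suc.IH Suc.prems(1) less.prems by simp
      next
        case False
        define m where "m = Max (keys (w j))"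
        have jc: "j < c" using Suc.prems(1) by simp
        have m: "m \<in> keys (w j)" unfolding m_def by (rule Max_in[OF False])
        have mMon: "m \<in> Mon"
          using keysN[OF less.prems(1) m] less.prems(2) m jc by (auto simp: Mon_def hv_def homogeneous_def)
        have "lead j m w" using less.prems False by (auto simp: lead_def m_def)
        then have "m \<in> Lead j" using less.prems(2) by (auto simp: Lead_def)
        then obtain f r where f: "f \<in> F j" "m = f + r" using F(3) by (fastforce simp: mon_dvd_def)
        then have "(j, f) \<in> set xs" using jc by (simp add: xs)
        then obtain k where k: "k < t" "xs ! k = (j, f)" by (auto simp: in_set_conv_nth t_def)
        have Bk: "lead j f (B k)" "hv (a' k) (B k)" "B k \<in> U"
          using WE[OF f(1)] by (auto simp: B_def a'_def k(2) lead_def)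
        have fk: "f \<in> keys (B k j)" using Bk(1) Max_in unfolding lead_def by metis
        have rN: "keys r \<subseteq> {..<N}" using keysN[OF less.prems(1) m] by (auto simp: f(2) keys_plus_nat)
        define p where "p = Poly_Mapping.single r (lookup (w j) m / lookup (B k j) f)"
        have pN: "p \<in> mpolys N" using rN by (simp add: p_def single_in_mpolys)
        define w' where "w' = (\<lambda>i. w i - p * B k i)"
        have w'U: "w' \<in> U" unfolding w'_def by (intro diff mult less.prems pN Bk)
        have "int (monomial_degree f) = a' k - a j"
          using Bk(2) fk jc by (auto simp: hv_def homogeneous_def)
        then have ek: "e = a' k + int (monomial_degree r)"
          using mMon by (simp add: Mon_def f(2) monomial_degree_add)
        have "hv e w'"
          unfolding hv_def
        proof (intro allI impI)
          fix i assume i: "i < c"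
          have "homogeneous ((a' k - a i) + int (monomial_degree r)) (p * B k i)"
            unfolding p_def using Bk(2) i by (intro homogeneous_single_mult) (auto simp: hv_def)
          then have "homogeneous (e - a i) (p * B k i)" by (simp add: ek algebra_simps)
          then show "homogeneous (e - a i) (w' i)"
            unfolding w'_def using less.prems(2) i by (intro homogeneous_diff) (auto simp: hv_def)
        qed
        have w'0: "\<forall>i\<ge>Suc j. w' i = 0" using less.prems(3) Bk(1) by (auto simp: w'_def lead_def)
        have "m \<notin> keys (w' j)"
          using fk by (simp add: in_keys_iff w'_def lookup_minus p_def f(2) add.commute[of f r] lookup_single_mult_add)
        moreover have "m' \<le> m" if "m' \<in> keys (w' j)" for m'
        proof -
          have "m' \<in> keys (w j) \<or> m' \<in> keys (p * B k j)"
            using that by (auto simp: w'_def in_keys_iff lookup_minus)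
          then show ?thesis
          proof
            assume "m' \<in> keys (w j)"
            then show ?thesis by (simp add: m_def)
          next
            assume "m' \<in> keys (p * B k j)"
            then show ?thesis using keys_single_mult_le[of "B k j" m' r] Bk(1)
              by (auto simp: p_def lead_def f(2) add.commute)
          qed
        qed
        ultimately have small: "Max (keys (w' j)) < m" if "w' j \<noteq> 0"
          using Max_in[OF that] by (metis order.not_eq_order_implies_strict)
        have "{m'\<in>Mon. w' j \<noteq> 0 \<and> m' \<le> Max (keys (w' j))} \<subset> {m'\<in>Mon. w j \<noteq> 0 \<and> m' \<le> Max (keys (w j))}"
        proof
          show "{m'\<in>Mon. w' j \<noteq> 0 \<and> m' \<le> Max (keys (w' j))} \<subseteq> {m'\<in>Mon. w j \<noteq> 0 \<and> m' \<le> Max (keys (w j))}"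
            using small False unfolding m_def by (blast intro: order_trans less_imp_le)
          show "{m'\<in>Mon. w' j \<noteq> 0 \<and> m' \<le> Max (keys (w' j))} \<noteq> {m'\<in>Mon. w j \<noteq> 0 \<and> m' \<le> Max (keys (w j))}"
            using small mMon False unfolding m_def by (metis (mono_tags, lifting) mem_Collect_eq not_less order_refl)
        qed
        then have "\<mu> w' < \<mu> w" unfolding \<mu>_def using finM by (intro psubset_card_mono) auto
        then have "w' \<in> Span" using less.hyps w'U \<open>hv e w'\<close> w'0 by blast
        then show ?thesis by (rule Span_step[OF _ pN k(1)]) (simp add: w'_def)
      qed
    qed
  qed
  have "w \<in> Span" if "w \<in> U" "hv e w" for w e
    by (rule main[of c w e]) (use that U in \<open>auto simp: cvecs_def\<close>)
  then have "\<exists>u\<in>cvecs (mpolys N) t. w = (\<lambda>j. \<Sum>k<t. u k * B k j)" if "w \<in> U" "hv e w" for w e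
    using that unfolding Span_def by fast
  then show ?thesis using B unfolding hv_def by blast
qed

text \<open>
  The homogeneous components of a syzygy of a homogeneous matrix are syzygies again, so homogeneous
  syzygies suffice, and these form the homogeneous elements of a graded submodule.
\<close>

lemma homogeneous_syzygies:
  fixes A :: "nat \<Rightarrow> nat \<Rightarrow> 'k::field mpoly" and a0 a1 :: "nat \<Rightarrow> int"
  assumes A: "\<And>i j. i < r \<Longrightarrow> j < c \<Longrightarrow> A i j \<in> mpolys N \<and> homogeneous (a1 j - a0 i) (A i j)"
  shows "\<exists>t a2 B. (\<forall>j<c. \<forall>k<t. B j k \<in> mpolys N \<and> homogeneous (a2 k - a1 j) (B j k)) \<and>
    {w \<in> cvecs (mpolys N) c. mat_apply r c A w = (\<lambda>i. 0)} = mat_apply c t B ` cvecs (mpolys N) t"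
proof -
  define U where "U = {w \<in> cvecs (mpolys N) c. mat_apply r c A w = (\<lambda>i. 0)}"
  have Uiff: "w \<in> U \<longleftrightarrow> w \<in> cvecs (mpolys N) c \<and> (\<forall>i<r. (\<Sum>j<c. A i j * w j) = 0)" for w
    by (auto simp: U_def mat_apply_def fun_eq_iff)
  have "\<exists>t B a'. (\<forall>k<t. B k \<in> U \<and> (\<forall>j<c. homogeneous (a' k - a1 j) (B k j))) \<and>
    (\<forall>w\<in>U. \<forall>e. (\<forall>j<c. homogeneous (e - a1 j) (w j)) \<longrightarrow>
       (\<exists>u\<in>cvecs (mpolys N) t. w = (\<lambda>j. \<Sum>k<t. u k * B k j)))"
  proof (rule graded_submodule_finitely_generated)
    show "U \<subseteq> cvecs (mpolys N) c" by (auto simp: U_def)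
    show "(\<lambda>j. u j - v j) \<in> U" if "u \<in> U" "v \<in> U" for u v
      using that by (auto simp: Uiff cvecs_def mpolys_diff right_diff_distrib sum_subtractf)
    show "(\<lambda>j. p * u j) \<in> U" if "p \<in> mpolys N" "u \<in> U" for p u
      using that by (auto simp: Uiff cvecs_def mpolys_mult mult.left_commute simp flip: sum_distrib_left)
  qed
  then obtain t B a' where B': "\<forall>k<t. B k \<in> U \<and> (\<forall>j<c. homogeneous (a' k - a1 j) (B k j))"
    and gen': "\<forall>w\<in>U. \<forall>e. (\<forall>j<c. homogeneous (e - a1 j) (w j)) \<longrightarrow>
       (\<exists>u\<in>cvecs (mpolys N) t. w = (\<lambda>j. \<Sum>k<t. u k * B k j))" by (elim exE conjE)
  have B: "B k \<in> U \<and> (\<forall>j<c. homogeneous (a' k - a1 j) (B k j))" if "k < t" for k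
    using B' that by blast
  have gen: "\<exists>u\<in>cvecs (mpolys N) t. w = (\<lambda>j. \<Sum>k<t. u k * B k j)"
    if "w \<in> U" "\<forall>j<c. homogeneous (e - a1 j) (w j)" for w e
    using gen'[THEN bspec, OF that(1)] that(2) by blast
  have Bc: "B k \<in> cvecs (mpolys N) c" if "k < t" for k
    using B[OF that] unfolding Uiff by blast
  have BN: "B k j \<in> mpolys N" if "k < t" for k j
    using cvecs_mem[OF Bc[OF that]] by simp
  have B0: "B k j = 0" if "k < t" "\<not> j < c" for k j
    using cvecs_zero[OF Bc[OF that(1)]] that(2) by simp
  have ap: "mat_apply c t (\<lambda>j k. B k j) u = (\<lambda>j. \<Sum>k<t. u k * B k j)" for u
    using B0 by (auto simp: mat_apply_def fun_eq_iff mult.commute intro!: sum.cong)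
  have "U = mat_apply c t (\<lambda>j k. B k j) ` cvecs (mpolys N) t"
  proof (intro equalityI subsetI)
    fix w assume w: "w \<in> U"
    define Es where "Es = (\<Union>j<c. (\<lambda>m. int (monomial_degree m) + a1 j) ` keys (w j))"
    define wc where "wc e j = homogeneous_component (e - a1 j) (w j)" for e j
    have "wc e \<in> U" for e
      unfolding Uiff
    proof (intro conjI allI impI)
      show "wc e \<in> cvecs (mpolys N) c"
        using w by (auto simp: Uiff cvecs_def wc_def homogeneous_component_in_mpolys)
      fix i assume i: "i < r"
      have "(\<Sum>j<c. A i j * wc e j) = (\<Sum>j<c. homogeneous_component (e - a0 i) (A i j * w j))"
      proof (rule sum.cong[OF refl])
        fix j assume "j \<in> {..<c}"
        then show "A i j * wc e j = homogeneous_component (e - a0 i) (A i j * w j)"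
          using A[OF i, of j] homogeneous_component_mult[of "a1 j - a0 i" "A i j" "e - a0 i" "w j"] by (simp add: wc_def)
      qed
      also have "\<dots> = 0" using w i by (simp add: Uiff flip: homogeneous_component_sum)
      finally show "(\<Sum>j<c. A i j * wc e j) = 0" .
    qed
    then have "\<exists>u\<in>cvecs (mpolys N) t. wc e = (\<lambda>j. \<Sum>k<t. u k * B k j)" for e
      by (rule gen[where e = e]) (simp add: wc_def homogeneous_homogeneous_component)
    then obtain u where u: "\<And>e. u e \<in> cvecs (mpolys N) t" "\<And>e. wc e = (\<lambda>j. \<Sum>k<t. u e k * B k j)" by metis
    have fin: "finite Es" by (auto simp: Es_def)
    have "w j = (\<Sum>e\<in>Es. wc e j)" for j
    proof (cases "j < c")
      case True
      have "lookup (w j) m = (\<Sum>e\<in>Es. lookup (wc e j) m)" for m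
      proof (cases "m \<in> keys (w j)")
        case mk: True
        then have "int (monomial_degree m) + a1 j \<in> Es" using True by (auto simp: Es_def)
        moreover have "lookup (wc e j) m = (if e = int (monomial_degree m) + a1 j then lookup (w j) m else 0)" for e
          by (auto simp: wc_def lookup_homogeneous_component)
        ultimately show ?thesis using fin by simp
      next
        case False
        then have "lookup (wc e j) m = 0" "lookup (w j) m = 0" for e
          by (simp_all add: wc_def lookup_homogeneous_component in_keys_iff)
        then show ?thesis by simp
      qed
      then show ?thesis by (intro poly_mapping_eqI) (simp add: lookup_sum)
    next
      case False
      then show ?thesis using w by (simp add: Uiff cvecs_def wc_def)
    qed
    also have "(\<Sum>e\<in>Es. wc e j) = (\<Sum>k<t. (\<Sum>e\<in>Es. u e k) * B k j)" for j
      by (simp add: u(2) sum_distrib_right) (rule sum.swap)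
    finally have "w = mat_apply c t (\<lambda>j k. B k j) (\<lambda>k. \<Sum>e\<in>Es. u e k)" unfolding ap by blast
    moreover have "(\<lambda>k. \<Sum>e\<in>Es. u e k) \<in> cvecs (mpolys N) t"
      using u(1) by (auto simp: cvecs_def intro!: mpolys_sum)
    ultimately show "w \<in> mat_apply c t (\<lambda>j k. B k j) ` cvecs (mpolys N) t" by blast
  next
    fix w assume "w \<in> mat_apply c t (\<lambda>j k. B k j) ` cvecs (mpolys N) t"
    then obtain u where u: "u \<in> cvecs (mpolys N) t" "w = (\<lambda>j. \<Sum>k<t. u k * B k j)" unfolding ap by blast
    show "w \<in> U"
      unfolding Uiff
    proof (intro conjI allI impI)
      show "w \<in> cvecs (mpolys N) c"
        using u BN B0 by (auto simp: cvecs_def intro!: mpolys_sum mpolys_mult)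
      fix i assume i: "i < r"
      have "(\<Sum>j<c. A i j * w j) = (\<Sum>k<t. u k * (\<Sum>j<c. A i j * B k j))"
        by (simp add: u(2) sum_distrib_left mult.left_commute) (rule sum.swap)
      also have "\<dots> = 0" using B i by (simp add: Uiff)
      finally show "(\<Sum>j<c. A i j * w j) = 0" .
    qed
  qed
  then show ?thesis
    using B BN unfolding U_def[symmetric]
    by (intro exI[of _ t] exI[of _ a'] exI[of _ "\<lambda>j k. B k j"]) auto
qed

section \<open>Graded free resolutions\<close>

text \<open>
  By dependent choice: every homogeneous matrix has a homogeneous matrix of syzygies.
\<close>

lemma graded_resolution_exists:
  fixes A0 :: "nat \<Rightarrow> nat \<Rightarrow> 'k::field mpoly" and a0 a1 :: "nat \<Rightarrow> int"
  assumes A0: "\<And>i j. i < r \<Longrightarrow> j < c \<Longrightarrow> A0 i j \<in> mpolys N \<and> homogeneous (a1 j - a0 i) (A0 i j)"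
  shows "\<exists>b a A. b 0 = r \<and> a 0 = a0 \<and> b (Suc 0) = c \<and> a (Suc 0) = a1 \<and> A 0 = A0 \<and>
    (\<forall>k. \<forall>i<b k. \<forall>j<b (Suc k). A k i j \<in> mpolys N \<and> homogeneous (a (Suc k) j - a k i) (A k i j)) \<and>
    (\<forall>k. {w \<in> cvecs (mpolys N) (b (Suc k)). mat_apply (b k) (b (Suc k)) (A k) w = (\<lambda>i. 0)} =
      mat_apply (b (Suc k)) (b (Suc (Suc k))) (A (Suc k)) ` cvecs (mpolys N) (b (Suc (Suc k))))"
proof -
  define good :: "nat \<times> (nat \<Rightarrow> int) \<times> nat \<times> (nat \<Rightarrow> int) \<times> (nat \<Rightarrow> nat \<Rightarrow> 'k mpoly) \<Rightarrow> bool" where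
    "good S \<longleftrightarrow> (case S of (r, a0, c, a1, A) \<Rightarrow>
      \<forall>i<r. \<forall>j<c. A i j \<in> mpolys N \<and> homogeneous (a1 j - a0 i) (A i j))" for S
  define follows :: "nat \<times> (nat \<Rightarrow> int) \<times> nat \<times> (nat \<Rightarrow> int) \<times> (nat \<Rightarrow> nat \<Rightarrow> 'k mpoly) \<Rightarrow>
      nat \<times> (nat \<Rightarrow> int) \<times> nat \<times> (nat \<Rightarrow> int) \<times> (nat \<Rightarrow> nat \<Rightarrow> 'k mpoly) \<Rightarrow> bool" where
    "follows S S' \<longleftrightarrow> (case S of (r, a0, c, a1, A) \<Rightarrow> case S' of (r', a0', c', a1', A') \<Rightarrow>
      r' = c \<and> a0' = a1 \<and>
      {w \<in> cvecs (mpolys N) c. mat_apply r c A w = (\<lambda>i. 0)} = mat_apply c c' A' ` cvecs (mpolys N) c')" for S S'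
  have "\<exists>f. \<forall>k. (good (f k) \<and> (k = 0 \<longrightarrow> f k = (r, a0, c, a1, A0))) \<and> follows (f k) (f (Suc k))"
  proof (rule dependent_nat_choice)
    show "\<exists>S. good S \<and> ((0::nat) = 0 \<longrightarrow> S = (r, a0, c, a1, A0))"
      using A0 by (auto simp: good_def)
    fix S and k :: nat assume S: "good S \<and> (k = 0 \<longrightarrow> S = (r, a0, c, a1, A0))"
    obtain r1 b0 c1 b1 B where SS: "S = (r1, b0, c1, b1, B)" by (cases S)
    obtain t a2 B' where B': "(\<forall>j<c1. \<forall>k<t. B' j k \<in> mpolys N \<and> homogeneous (a2 k - b1 j) (B' j k)) \<and>
      {w \<in> cvecs (mpolys N) c1. mat_apply r1 c1 B w = (\<lambda>i. 0)} = mat_apply c1 t B' ` cvecs (mpolys N) t"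
      using homogeneous_syzygies[of r1 c1 B N b1 b0] S by (auto simp: good_def SS)
    then have "good (c1, b1, t, a2, B') \<and> follows S (c1, b1, t, a2, B')"
      by (simp add: good_def follows_def SS)
    then show "\<exists>S'. (good S' \<and> (Suc k = 0 \<longrightarrow> S' = (r, a0, c, a1, A0))) \<and> follows S S'"
      by blast
  qed
  then obtain f where f: "\<And>k. good (f k)" "f 0 = (r, a0, c, a1, A0)" "\<And>k. follows (f k) (f (Suc k))"
    by blast
  define b where "b k = fst (f k)" for k
  define a where "a k = fst (snd (f k))" for k
  define A where "A k = snd (snd (snd (snd (f k))))" for k
  have fk: "f k = (b k, a k, b (Suc k), a (Suc k), A k)" for k
    using f(3)[of k] by (auto simp: follows_def b_def a_def A_def split: prod.splits)
  have "b 0 = r" "a 0 = a0" "b (Suc 0) = c" "a (Suc 0) = a1" "A 0 = A0"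
    using f(2) fk[of 0] by simp_all
  moreover have "A k i j \<in> mpolys N \<and> homogeneous (a (Suc k) j - a k i) (A k i j)"
    if "i < b k" "j < b (Suc k)" for k i j
    using f(1)[of k] that by (simp add: good_def fk)
  moreover have "{w \<in> cvecs (mpolys N) (b (Suc k)). mat_apply (b k) (b (Suc k)) (A k) w = (\<lambda>i. 0)} =
      mat_apply (b (Suc k)) (b (Suc (Suc k))) (A (Suc k)) ` cvecs (mpolys N) (b (Suc (Suc k)))" for k
    using f(3)[of k] by (simp only: follows_def fk prod.case)
  ultimately show ?thesis by (intro exI[of _ b] exI[of _ a] exI[of _ A]) blast
qed

section \<open>Ext by a regular sequence\<close>

lemma mult_if_zero:
  fixes x y :: "'r::comm_ring_1"
  shows "x * (if b then y else 0) = (if b then x * y else 0)"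
    and "(if b then y else 0) * x = (if b then y * x else 0)"
  by simp_all

locale unital_subring =
  fixes P :: "'r::comm_ring_1 set"
  assumes zero_mem [simp]: "0 \<in> P" and one_mem [simp]: "1 \<in> P"
    and diff_mem: "p \<in> P \<Longrightarrow> q \<in> P \<Longrightarrow> p - q \<in> P"
    and mult_mem: "p \<in> P \<Longrightarrow> q \<in> P \<Longrightarrow> p * q \<in> P"
begin

lemma add_mem: "p \<in> P \<Longrightarrow> q \<in> P \<Longrightarrow> p + q \<in> P"
  using diff_mem[of p "0 - q"] diff_mem[of 0 q] by simp

lemma uminus_mem: "p \<in> P \<Longrightarrow> - p \<in> P"
  using diff_mem[of 0 p] by simp

lemma sum_mem: "(\<And>i. i \<in> I \<Longrightarrow> f i \<in> P) \<Longrightarrow> sum f I \<in> P"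
  by (induction I rule: infinite_finite_induct) (auto intro: add_mem)

definition is_ideal :: "'r set \<Rightarrow> bool" where
  "is_ideal I \<longleftrightarrow> I \<subseteq> P \<and> 0 \<in> I \<and> (\<forall>x\<in>I. \<forall>y\<in>I. x - y \<in> I) \<and> (\<forall>x\<in>I. \<forall>p\<in>P. p * x \<in> I)"

lemma is_idealD:
  assumes "is_ideal I"
  shows "I \<subseteq> P" "0 \<in> I" "x \<in> I \<Longrightarrow> y \<in> I \<Longrightarrow> x - y \<in> I" "x \<in> I \<Longrightarrow> y \<in> I \<Longrightarrow> x + y \<in> I"
    "x \<in> I \<Longrightarrow> p \<in> P \<Longrightarrow> p * x \<in> I" "x \<in> I \<Longrightarrow> - x \<in> I"
proof -
  show *: "I \<subseteq> P" "0 \<in> I" "x \<in> I \<Longrightarrow> y \<in> I \<Longrightarrow> x - y \<in> I" "x \<in> I \<Longrightarrow> p \<in> P \<Longrightarrow> p * x \<in> I" for x y p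
    using assms by (auto simp: is_ideal_def)
  show **: "x \<in> I \<Longrightarrow> - x \<in> I" for x using *(3)[of 0 x] *(2) by simp
  show "x \<in> I \<Longrightarrow> y \<in> I \<Longrightarrow> x + y \<in> I" using *(3)[of x "- y"] ** by simp
qed

lemma ideal_sum: "is_ideal I \<Longrightarrow> (\<And>i. i \<in> X \<Longrightarrow> f i \<in> I) \<Longrightarrow> sum f X \<in> I"
  by (induction X rule: infinite_finite_induct) (auto intro: is_idealD)

lemma is_ideal_zero: "is_ideal {0}" by (auto simp: is_ideal_def)

lemma mat_apply_cvecs:
  assumes "\<And>i j. i < r \<Longrightarrow> j < c \<Longrightarrow> A i j \<in> P" "w \<in> cvecs P c"
  shows "mat_apply r c A w \<in> cvecs P r"
  using assms by (auto simp: mat_apply_def cvecs_def intro!: sum_mem mult_mem)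

lemma mat_apply_unit: "l < c \<Longrightarrow> mat_apply r c A (\<lambda>j. if j = l then 1 else 0) = (\<lambda>i. if i < r then A i l else 0)"
  by (simp add: mat_apply_def mult_if_zero cong: if_cong)

lemma mat_apply_restrict: "mat_apply r c A (\<lambda>j. if j < c then f j else 0) = mat_apply r c A f"
  by (auto simp: mat_apply_def intro!: sum.cong)

definition generated_by :: "nat \<Rightarrow> (nat \<Rightarrow> 'r) set \<Rightarrow> (nat \<Rightarrow> 'r) set \<Rightarrow> bool" where
  "generated_by t Z B \<longleftrightarrow> (\<exists>G. (\<forall>j<t. G j \<in> Z) \<and>
     (\<forall>z\<in>Z. \<exists>w\<in>cvecs P t. (\<lambda>i. z i - (\<Sum>j<t. w j * G j i)) \<in> B))"

text \<open>
  A relation that is linear, total and onto, and that matches \<open>B\<close> with \<open>B'\<close>, is the graph of an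
  isomorphism of \<open>Z/B\<close> with \<open>Z'/B'\<close>.
\<close>

lemma generated_by_transfer:
  assumes total: "\<And>z. z \<in> Z \<Longrightarrow> \<exists>z'\<in>Z'. \<rho> z z'" and onto: "\<And>z'. z' \<in> Z' \<Longrightarrow> \<exists>z\<in>Z. \<rho> z z'"
    and lin: "\<And>z z' G G' w. \<rho> z z' \<Longrightarrow> (\<And>j. j < t \<Longrightarrow> \<rho> (G j) (G' j)) \<Longrightarrow> w \<in> cvecs P t \<Longrightarrow>
      \<rho> (\<lambda>i. z i - (\<Sum>j<t. w j * G j i)) (\<lambda>i. z' i - (\<Sum>j<t. w j * G' j i))"
    and iff: "\<And>z z'. \<rho> z z' \<Longrightarrow> z \<in> B \<Longrightarrow> z' \<in> B'"
    and gen: "generated_by t Z B"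
  shows "generated_by t Z' B'"
proof -
  obtain G where G: "\<And>j. j < t \<Longrightarrow> G j \<in> Z"
      "\<And>z. z \<in> Z \<Longrightarrow> \<exists>w\<in>cvecs P t. (\<lambda>i. z i - (\<Sum>j<t. w j * G j i)) \<in> B"
    using gen unfolding generated_by_def by blast
  have "\<forall>j. \<exists>g'. j < t \<longrightarrow> g' \<in> Z' \<and> \<rho> (G j) g'" using G(1) total by blast
  then obtain G' where G': "\<And>j. j < t \<Longrightarrow> G' j \<in> Z' \<and> \<rho> (G j) (G' j)"
    unfolding choice_iff by blast
  have "\<exists>w\<in>cvecs P t. (\<lambda>i. z' i - (\<Sum>j<t. w j * G' j i)) \<in> B'" if z': "z' \<in> Z'" for z'
  proof -
    obtain z where z: "z \<in> Z" "\<rho> z z'" using onto[OF z'] by blast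
    obtain w where w: "w \<in> cvecs P t" "(\<lambda>i. z i - (\<Sum>j<t. w j * G j i)) \<in> B" using G(2)[OF z(1)] by blast
    have "\<rho> (\<lambda>i. z i - (\<Sum>j<t. w j * G j i)) (\<lambda>i. z' i - (\<Sum>j<t. w j * G' j i))"
      using G' by (intro lin z(2) w(1)) blast
    then show ?thesis using iff w by blast
  qed
  then show ?thesis unfolding generated_by_def using G' by blast
qed

text \<open>The ideal generated by \<open>g 0, ..., g (i - 1)\<close>.\<close>

primrec partial_ideal :: "(nat \<Rightarrow> 'r) \<Rightarrow> nat \<Rightarrow> 'r set" where
  "partial_ideal g 0 = {0}"
| "partial_ideal g (Suc i) = {p + q * g i | p q. p \<in> partial_ideal g i \<and> q \<in> P}"

lemma partial_ideal_SucI: "p \<in> partial_ideal g i \<Longrightarrow> q \<in> P \<Longrightarrow> x = p + q * g i \<Longrightarrow> x \<in> partial_ideal g (Suc i)"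
  by auto

lemma partial_ideal_SucE:
  assumes "x \<in> partial_ideal g (Suc i)"
  obtains p q where "x = p + q * g i" "p \<in> partial_ideal g i" "q \<in> P"
  using assms by auto

declare partial_ideal.simps(2) [simp del]

lemma is_ideal_partial_ideal:
  assumes "\<And>j. j < i \<Longrightarrow> g j \<in> P"
  shows "is_ideal (partial_ideal g i)"
  using assms
proof (induction i)
  case (Suc i)
  then have I: "is_ideal (partial_ideal g i)" by simp
  have "x - y \<in> partial_ideal g (Suc i)"
    if xy: "x \<in> partial_ideal g (Suc i)" "y \<in> partial_ideal g (Suc i)" for x y
  proof -
    obtain p q p' q' where "x = p + q * g i" "y = p' + q' * g i"
      "p \<in> partial_ideal g i" "p' \<in> partial_ideal g i" "q \<in> P" "q' \<in> P"
      using xy by (meson partial_ideal_SucE)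
    then show ?thesis
      by (intro partial_ideal_SucI[of "p - p'" g i "q - q'"] is_idealD(3)[OF I] diff_mem)
        (auto simp: algebra_simps)
  qed
  moreover have "r * x \<in> partial_ideal g (Suc i)" if x: "x \<in> partial_ideal g (Suc i)" and r: "r \<in> P" for x r
  proof -
    obtain p q where "x = p + q * g i" "p \<in> partial_ideal g i" "q \<in> P" using x by (rule partial_ideal_SucE)
    then show ?thesis
      by (intro partial_ideal_SucI[of "r * p" g i "r * q"] is_idealD(5)[OF I] mult_mem r)
        (auto simp: algebra_simps)
  qed
  moreover have "0 \<in> partial_ideal g (Suc i)"
    by (rule partial_ideal_SucI[of 0 g i 0]) (auto simp: is_idealD(2)[OF I])
  moreover have "partial_ideal g (Suc i) \<subseteq> P"
    using is_idealD(1)[OF I] Suc.prems[of i] by (auto intro!: add_mem mult_mem elim!: partial_ideal_SucE)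
  ultimately show ?case unfolding is_ideal_def by blast
qed (simp add: is_ideal_zero)

lemma partial_ideal_mono:
  assumes "i \<le> j"
  shows "partial_ideal g i \<subseteq> partial_ideal g j"
  using assms
proof (induction rule: dec_induct)
  case (step j)
  have "partial_ideal g j \<subseteq> partial_ideal g (Suc j)"
    using partial_ideal_SucI[of _ g j 0] by auto
  then show ?case using step.IH by blast
qed simp

lemma gen_in_partial_ideal: 
  assumes "\<And>j. j < i \<Longrightarrow> g j \<in> P" "j < i"
  shows "g j \<in> partial_ideal g i"
proof -
  have "g j \<in> partial_ideal g (Suc j)"
    by (rule partial_ideal_SucI[of 0 g j 1])
      (use assms in \<open>auto intro!: is_idealD(2) is_ideal_partial_ideal\<close>)
  then show ?thesis using partial_ideal_mono[of "Suc j" i g] assms(2) by auto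
qed

end

text \<open>
  A free resolution of \<open>P/J\<close>. For an ideal \<open>I\<close>, \<open>cocycles k I\<close> modulo \<open>coboundaries k I\<close> is
  \<open>Ext^k(P/J, P/I)\<close>, with classes represented by vectors over \<open>P\<close>.
\<close>

locale free_resolution = unital_subring P for P :: "'r::comm_ring_1 set" +
  fixes J :: "'r set" and b :: "nat \<Rightarrow> nat" and A :: "nat \<Rightarrow> nat \<Rightarrow> nat \<Rightarrow> 'r"
  assumes b0: "b 0 = 1"
    and entries: "i < b k \<Longrightarrow> j < b (Suc k) \<Longrightarrow> A k i j \<in> P"
    and augmentation: "J = (\<lambda>w. \<Sum>j<b (Suc 0). A 0 0 j * w j) ` cvecs P (b (Suc 0))"
    and exact: "{w \<in> cvecs P (b (Suc k)). mat_apply (b k) (b (Suc k)) (A k) w = (\<lambda>i. 0)} =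
      mat_apply (b (Suc k)) (b (Suc (Suc k))) (A (Suc k)) ` cvecs P (b (Suc (Suc k)))"
begin

definition dual :: "nat \<Rightarrow> (nat \<Rightarrow> 'r) \<Rightarrow> nat \<Rightarrow> 'r" where
  "dual k = mat_apply (b (Suc k)) (b k) (\<lambda>j i. A k i j)"

primrec dual_images :: "nat \<Rightarrow> (nat \<Rightarrow> 'r) set" where
  "dual_images 0 = {\<lambda>_. 0}"
| "dual_images (Suc k) = dual k ` cvecs P (b k)"

definition cocycles :: "nat \<Rightarrow> 'r set \<Rightarrow> (nat \<Rightarrow> 'r) set" where
  "cocycles k I = {v \<in> cvecs P (b k). \<forall>j. dual k v j \<in> I}"

definition coboundaries :: "nat \<Rightarrow> 'r set \<Rightarrow> (nat \<Rightarrow> 'r) set" where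
  "coboundaries k I = {v \<in> cvecs P (b k). \<exists>u\<in>dual_images k. \<forall>j. v j - u j \<in> I}"

lemma dual_cvecs: "v \<in> cvecs P (b k) \<Longrightarrow> dual k v \<in> cvecs P (b (Suc k))"
  unfolding dual_def by (rule mat_apply_cvecs) (auto intro: entries)

lemma dual_diff: "dual k (\<lambda>i. x i - y i) = (\<lambda>i. dual k x i - dual k y i)"
  by (auto simp: dual_def mat_apply_def right_diff_distrib sum_subtractf)

lemma dual_smult: "dual k (\<lambda>i. r * x i) = (\<lambda>i. r * dual k x i)"
  by (auto simp: dual_def mat_apply_def sum_distrib_left mult.left_commute)

lemma dual_sum: "dual k (\<lambda>i. \<Sum>j<t. w j * G j i) = (\<lambda>i. \<Sum>j<t. w j * dual k (G j) i)"
proof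
  fix i
  show "dual k (\<lambda>i. \<Sum>j<t. w j * G j i) i = (\<Sum>j<t. w j * dual k (G j) i)"
    unfolding dual_def mat_apply_def
    by (cases "i < b (Suc k)") (simp_all add: sum_distrib_left mult.left_commute sum.swap[of _ "{..<t}"])
qed

lemma dual_ideal:
  assumes I: "is_ideal I" and x: "\<And>i. x i \<in> I"
  shows "dual k x j \<in> I"
  unfolding dual_def mat_apply_def using I x entries
  by (auto intro!: ideal_sum is_idealD(5) is_idealD(2))

lemma dual_dual:
  assumes "x \<in> cvecs P (b k)"
  shows "dual (Suc k) (dual k x) = (\<lambda>j. 0)"
proof
  fix l
  show "dual (Suc k) (dual k x) l = 0"
  proof (cases "l < b (Suc (Suc k))")
    case True
    have "(\<lambda>j. if j = l then 1 else 0) \<in> cvecs P (b (Suc (Suc k)))"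
      using True by (auto simp: cvecs_def)
    then have "mat_apply (b (Suc k)) (b (Suc (Suc k))) (A (Suc k)) (\<lambda>j. if j = l then 1 else 0) \<in>
      {w \<in> cvecs P (b (Suc k)). mat_apply (b k) (b (Suc k)) (A k) w = (\<lambda>i. 0)}"
      unfolding exact by blast
    then have H: "mat_apply (b k) (b (Suc k)) (A k)
      (mat_apply (b (Suc k)) (b (Suc (Suc k))) (A (Suc k)) (\<lambda>j. if j = l then 1 else 0)) = (\<lambda>i. 0)" by blast
    have *: "(\<Sum>m<b (Suc k). A k i m * A (Suc k) m l) = 0" if "i < b k" for i
      using fun_cong[OF H, of i] that unfolding mat_apply_unit[OF True] mat_apply_restrict by (simp add: mat_apply_def)
    have "dual (Suc k) (dual k x) l = (\<Sum>m<b (Suc k). A (Suc k) m l * (\<Sum>i<b k. A k i m * x i))"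
      using True by (simp add: dual_def mat_apply_def)
    also have "\<dots> = (\<Sum>i<b k. x i * (\<Sum>m<b (Suc k). A k i m * A (Suc k) m l))"
      unfolding sum_distrib_left by (subst sum.swap) (simp add: ac_simps)
    also have "\<dots> = 0" using * by simp
    finally show ?thesis .
  qed (simp add: dual_def mat_apply_def)
qed

text \<open>
  Multiplication by an element of \<open>J\<close> is zero on \<open>P/J\<close>, hence null-homotopic on the resolution.
\<close>

lemma nullhomotopy:
  assumes r: "r \<in> J"
  shows "\<exists>S T. (\<forall>i<b (Suc k). \<forall>j<b k. S i j \<in> P) \<and> (k > 0 \<longrightarrow> (\<forall>i<b k. \<forall>j<b (k - 1). T i j \<in> P)) \<and>
    (\<forall>i<b k. \<forall>l<b k. (\<Sum>m<b (Suc k). A k i m * S m l) +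
      (if k = 0 then 0 else \<Sum>m<b (k - 1). T i m * A (k - 1) m l) = (if i = l then r else 0))"
proof (induction k)
  case 0
  obtain w where w: "w \<in> cvecs P (b (Suc 0))" "r = (\<Sum>j<b (Suc 0). A 0 0 j * w j)"
    using r augmentation by blast
  then show ?case
    by (intro exI[of _ "\<lambda>i j. w i"]) (auto simp: b0 cvecs_def)
next
  case (Suc k)
  then obtain S T where S: "\<And>i j. i < b (Suc k) \<Longrightarrow> j < b k \<Longrightarrow> S i j \<in> P"
    and T: "\<And>i l. i < b k \<Longrightarrow> l < b k \<Longrightarrow> (\<Sum>m<b (Suc k). A k i m * S m l) +
      (if k = 0 then 0 else \<Sum>m<b (k - 1). T i m * A (k - 1) m l) = (if i = l then r else 0)"
    by blast
  have rP: "r \<in> P"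
    using r by (auto simp: augmentation b0 cvecs_def intro!: sum_mem mult_mem entries)
  have AA: "(\<Sum>m<b k. A (k - 1) p m * A k m l) = 0" if k: "k > 0" and p: "p < b (k - 1)" and l: "l < b (Suc k)" for p l
  proof -
    obtain k' where k': "k = Suc k'" using k by (cases k) auto
    have "(\<lambda>j. if j = p then 1 else 0) \<in> cvecs P (b k')" using p by (auto simp: cvecs_def k')
    then have "dual (Suc k') (dual k' (\<lambda>j. if j = p then 1 else 0)) l = 0"
      by (simp add: dual_dual)
    then have "mat_apply (b (Suc (Suc k'))) (b (Suc k')) (\<lambda>j i. A (Suc k') i j) (\<lambda>m. A k' p m) l = 0"
      using p unfolding dual_def by (simp add: mat_apply_unit mat_apply_restrict k')
    then show ?thesis using l by (simp add: mat_apply_def k' mult.commute)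
  qed
  define X where "X l j = (if j < b (Suc k) then (if j = l then r else 0) - (\<Sum>m<b k. S j m * A k m l) else 0)" for l j
  have "\<exists>w. l < b (Suc k) \<longrightarrow> w \<in> cvecs P (b (Suc (Suc k))) \<and>
      X l = mat_apply (b (Suc k)) (b (Suc (Suc k))) (A (Suc k)) w" for l
  proof (cases "l < b (Suc k)")
    case l: True
    have "X l \<in> cvecs P (b (Suc k))"
      unfolding X_def cvecs_def using rP S l
      by (auto intro!: diff_mem uminus_mem sum_mem mult_mem entries)
    moreover have "mat_apply (b k) (b (Suc k)) (A k) (X l) = (\<lambda>i. 0)"
    proof
      fix i
      show "mat_apply (b k) (b (Suc k)) (A k) (X l) i = 0"
      proof (cases "i < b k")
        case i: True
        define Q where "Q m = (if k = 0 then 0 else \<Sum>p<b (k - 1). T i p * A (k - 1) p m)" for m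
        have TQ: "(\<Sum>j<b (Suc k). A k i j * S j m) = (if i = m then r else 0) - Q m" if "m < b k" for m
          unfolding eq_diff_eq Q_def by (rule T[OF i that])
        have "mat_apply (b k) (b (Suc k)) (A k) (X l) i =
          (\<Sum>j<b (Suc k). A k i j * (if j = l then r else 0)) -
          (\<Sum>j<b (Suc k). A k i j * (\<Sum>m<b k. S j m * A k m l))"
          using i by (simp add: mat_apply_def X_def right_diff_distrib sum_subtractf)
        also have "(\<Sum>j<b (Suc k). A k i j * (if j = l then r else 0)) = A k i l * r"
          using l by (simp add: mult_if_zero)
        also have "(\<Sum>j<b (Suc k). A k i j * (\<Sum>m<b k. S j m * A k m l)) =
          (\<Sum>m<b k. (\<Sum>j<b (Suc k). A k i j * S j m) * A k m l)"
          unfolding sum_distrib_left sum_distrib_right by (subst sum.swap) (simp add: ac_simps)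
        also have "\<dots> = (\<Sum>m<b k. ((if i = m then r else 0) - Q m) * A k m l)"
          by (intro sum.cong refl) (simp only: TQ lessThan_iff)
        also have "\<dots> = r * A k i l - (\<Sum>m<b k. Q m * A k m l)"
          using i by (simp add: left_diff_distrib sum_subtractf mult_if_zero)
        also have "(\<Sum>m<b k. Q m * A k m l) = 0"
        proof (cases "k = 0")
          case False
          have "(\<Sum>m<b k. (\<Sum>p<b (k - 1). T i p * A (k - 1) p m) * A k m l) =
            (\<Sum>p<b (k - 1). T i p * (\<Sum>m<b k. A (k - 1) p m * A k m l))"
            unfolding sum_distrib_left sum_distrib_right by (subst sum.swap) (simp add: ac_simps)
          then show ?thesis using AA False l by (simp add: Q_def)
        qed (simp add: Q_def)
        finally show ?thesis by (simp add: mult.commute)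
      qed (simp add: mat_apply_def)
    qed
    ultimately have "X l \<in> mat_apply (b (Suc k)) (b (Suc (Suc k))) (A (Suc k)) ` cvecs P (b (Suc (Suc k)))"
      unfolding exact[symmetric] by blast
    then show ?thesis by blast
  qed blast
  then have "\<forall>l. \<exists>w. l < b (Suc k) \<longrightarrow> w \<in> cvecs P (b (Suc (Suc k))) \<and>
      X l = mat_apply (b (Suc k)) (b (Suc (Suc k))) (A (Suc k)) w" by blast
  then obtain W where W: "\<And>l. l < b (Suc k) \<Longrightarrow> W l \<in> cvecs P (b (Suc (Suc k)))"
      "\<And>l. l < b (Suc k) \<Longrightarrow> X l = mat_apply (b (Suc k)) (b (Suc (Suc k))) (A (Suc k)) (W l)"
    unfolding choice_iff by blast
  have eq: "(\<Sum>m<b (Suc (Suc k)). A (Suc k) i m * W l m) + (\<Sum>m<b k. S i m * A k m l) = (if i = l then r else 0)"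
    if "i < b (Suc k)" "l < b (Suc k)" for i l
    using fun_cong[OF W(2)[OF that(2)], of i] that(1) by (simp add: X_def mat_apply_def algebra_simps split: if_splits)
  have WP: "W l i \<in> P" if "l < b (Suc k)" for l i using cvecs_mem[OF W(1)[OF that]] by simp
  show ?case
    by (rule exI[of _ "\<lambda>i l. W l i"], rule exI[of _ S]) (simp add: eq S WP)
qed

text \<open>
  The transposed homotopy writes \<open>r v\<close> as a coboundary plus a combination of the entries of the
  image of \<open>v\<close>, which are in \<open>I\<close>.
\<close>

lemma annihilates:
  assumes r: "r \<in> J" and I: "is_ideal I" and v: "v \<in> cocycles k I"
  shows "\<exists>u\<in>dual_images k. \<forall>j. r * v j - u j \<in> I"
proof -
  obtain S T where S: "\<And>i j. i < b (Suc k) \<Longrightarrow> j < b k \<Longrightarrow> S i j \<in> P"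
    and T: "\<And>i j. k > 0 \<Longrightarrow> i < b k \<Longrightarrow> j < b (k - 1) \<Longrightarrow> T i j \<in> P"
    and ST: "\<And>i l. i < b k \<Longrightarrow> l < b k \<Longrightarrow> (\<Sum>m<b (Suc k). A k i m * S m l) +
      (if k = 0 then 0 else \<Sum>m<b (k - 1). T i m * A (k - 1) m l) = (if i = l then r else 0)"
    using nullhomotopy[OF r, of k] by blast
  have vc: "v \<in> cvecs P (b k)" and vI: "\<And>j. dual k v j \<in> I" using v by (auto simp: cocycles_def)
  define u where "u l = (if l < b k then \<Sum>i<b k. v i * (if k = 0 then 0 else \<Sum>m<b (k - 1). T i m * A (k - 1) m l) else 0)" for l
  have "r * v l - u l \<in> I" for l
  proof (cases "l < b k")
    case l: True
    have "r * v l = (\<Sum>i<b k. v i * (if i = l then r else 0))"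
      using l by (simp add: mult_if_zero mult.commute)
    also have "\<dots> = (\<Sum>i<b k. v i * ((\<Sum>m<b (Suc k). A k i m * S m l) +
      (if k = 0 then 0 else \<Sum>m<b (k - 1). T i m * A (k - 1) m l)))"
      by (intro sum.cong refl) (simp only: ST l lessThan_iff)
    also have "\<dots> = (\<Sum>i<b k. v i * (\<Sum>m<b (Suc k). A k i m * S m l)) + u l"
      using l by (simp add: distrib_left sum.distrib u_def)
    also have "(\<Sum>i<b k. v i * (\<Sum>m<b (Suc k). A k i m * S m l)) = (\<Sum>m<b (Suc k). S m l * dual k v m)"
      unfolding sum_distrib_left by (subst sum.swap) (simp add: dual_def mat_apply_def ac_simps sum_distrib_left)
    finally have "r * v l - u l = (\<Sum>m<b (Suc k). S m l * dual k v m)" by simp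
    also have "\<dots> \<in> I" using S l vI I by (auto intro!: ideal_sum is_idealD(5))
    finally show ?thesis .
  next
    case False
    then show ?thesis using vc I by (simp add: u_def cvecs_zero is_idealD)
  qed
  moreover have "u \<in> dual_images k"
  proof (cases k)
    case (Suc k')
    define y where "y m = (if m < b k' then \<Sum>i<b k. v i * T i m else 0)" for m
    have "y \<in> cvecs P (b k')"
      using T vc by (auto simp: y_def cvecs_def Suc intro!: sum_mem mult_mem)
    moreover have "u = dual k' y"
    proof
      fix l
      have "(\<Sum>i<b k. v i * (\<Sum>m<b k'. T i m * A k' m l)) = (\<Sum>m<b k'. A k' m l * (\<Sum>i<b k. v i * T i m))"
        unfolding sum_distrib_left by (subst sum.swap) (simp add: ac_simps)
      then show "u l = dual k' y l"
        unfolding dual_def y_def mat_apply_restrict by (simp add: u_def mat_apply_def Suc)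
    qed
    ultimately show ?thesis by (simp add: Suc)
  qed (simp add: u_def fun_eq_iff)
  ultimately show ?thesis by blast
qed

lemma dual_images_cvecs: "u \<in> dual_images k \<Longrightarrow> u \<in> cvecs P (b k)"
  by (cases k) (auto simp: dual_cvecs, auto simp: cvecs_def)

lemma cocycles_lincomb:
  assumes I: "is_ideal I" and z: "z \<in> cocycles k I" and G: "\<And>j. j < t \<Longrightarrow> G j \<in> cocycles k I"
    and w: "w \<in> cvecs P t"
  shows "(\<lambda>i. z i - (\<Sum>j<t. w j * G j i)) \<in> cocycles k I"
proof -
  have wP: "w j \<in> P" for j using w by (simp add: cvecs_mem)
  have "(\<lambda>i. z i - (\<Sum>j<t. w j * G j i)) \<in> cvecs P (b k)"
    using z G wP by (auto simp: cvecs_def cocycles_def intro!: diff_mem sum_mem mult_mem)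
  moreover have "dual k (\<lambda>i. z i - (\<Sum>j<t. w j * G j i)) m \<in> I" for m
    unfolding dual_diff dual_sum using z G wP
    by (intro is_idealD(3)[OF I] ideal_sum[OF I] is_idealD(5)[OF I]) (auto simp: cocycles_def)
  ultimately show ?thesis by (simp add: cocycles_def)
qed

end

text \<open>
  For a regular sequence \<open>g 0, ..., g (c - 1)\<close> in \<open>J\<close>, the long exact sequences of
  \<open>0 \<rightarrow> P/C_i \<rightarrow> P/C_i \<rightarrow> P/C_(i+1) \<rightarrow> 0\<close>, where \<open>C_i\<close> is the partial ideal and the first map
  is multiplication by \<open>g i\<close>, break into short exact sequences because \<open>g i\<close> acts as zero on Ext.
\<close>

locale resolution_regular_sequence = free_resolution +
  fixes g :: "nat \<Rightarrow> 'a" and c :: nat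
  assumes gJ: "i < c \<Longrightarrow> g i \<in> J" and gP: "g i \<in> P"
    and regular: "i < c \<Longrightarrow> q \<in> P \<Longrightarrow> g i * q \<in> partial_ideal g i \<Longrightarrow> q \<in> partial_ideal g i"
begin

abbreviation C where "C i \<equiv> partial_ideal g i"

lemma idC: "is_ideal (C i)" using gP by (rule is_ideal_partial_ideal)

lemma C_Suc_decompose:
  assumes "v \<in> cvecs P r" "\<And>j. v j \<in> C (Suc i)"
  shows "\<exists>q\<in>cvecs P r. \<forall>j. v j - g i * q j \<in> C i"
proof -
  have "\<forall>j. \<exists>q. q \<in> P \<and> v j - g i * q \<in> C i"
  proof
    fix j
    obtain p q where "v j = p + q * g i" "p \<in> C i" "q \<in> P" using assms(2)[of j] by (rule partial_ideal_SucE)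
    then show "\<exists>q. q \<in> P \<and> v j - g i * q \<in> C i" by (intro exI[of _ q]) (simp add: mult.commute)
  qed
  then obtain q where q: "\<And>j. q j \<in> P \<and> v j - g i * q j \<in> C i" unfolding choice_iff by blast
  have "(\<lambda>j. if j < r then q j else 0) \<in> cvecs P r" using q by (auto simp: cvecs_def)
  moreover have "\<forall>j. v j - g i * (if j < r then q j else 0) \<in> C i"
    using q assms(1) by (auto simp: cvecs_zero is_idealD(2)[OF idC])
  ultimately show ?thesis by (intro bexI[of _ "\<lambda>j. if j < r then q j else 0"])
qed

lemma C_diff_trans: "x - y \<in> C i \<Longrightarrow> y - z \<in> C i \<Longrightarrow> x - z \<in> C i"
  using is_idealD(4)[OF idC, of "x - y" i "y - z"] by simp

lemma C_diff_sym: "x - y \<in> C i \<Longrightarrow> y - x \<in> C i"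
  using is_idealD(6)[OF idC, of "x - y" i] by simp

lemma dual_cong: "(\<And>j. x j - y j \<in> C i) \<Longrightarrow> dual k x m - dual k y m \<in> C i"
  using dual_ideal[OF idC, of "\<lambda>j. x j - y j" i k m] by (simp add: dual_diff)

lemma dual_dual_images: "u \<in> dual_images k \<Longrightarrow> dual k u = (\<lambda>_. 0)"
proof (cases k)
  case 0
  then show "u \<in> dual_images k \<Longrightarrow> ?thesis" by (simp add: dual_def mat_apply_def fun_eq_iff)
qed (auto simp: dual_dual)

text \<open>
  Ext vanishes below the length of the part of the regular sequence that is still available: as
  \<open>g i\<close> is zero on \<open>Ext^(k+1)(P/J, P/C_i)\<close>, each class there comes from \<open>Ext^k(P/J, P/C_(i+1))\<close>, which
  is zero by induction.
\<close>

lemma vanishing: "k + i < c \<Longrightarrow> v \<in> cocycles k (C i) \<Longrightarrow> v \<in> coboundaries k (C i)"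
proof (induction k arbitrary: i v)
  case 0
  obtain u where "u \<in> dual_images 0" "\<And>j. g i * v j - u j \<in> C i"
    using annihilates[OF gJ idC 0(2), of i] 0(1) by auto
  then have "g i * v j \<in> C i" for j by simp
  moreover have v: "v \<in> cvecs P (b 0)" using 0(2) by (simp add: cocycles_def)
  ultimately have "v j \<in> C i" for j using regular[of i "v j"] 0(1) cvecs_mem[OF v] by simp
  then show ?case using v by (simp add: coboundaries_def)
next
  case (Suc k)
  have v: "v \<in> cvecs P (b (Suc k))" using Suc.prems by (simp add: cocycles_def)
  obtain u where u: "u \<in> cvecs P (b k)" "\<And>j. g i * v j - dual k u j \<in> C i"
    using annihilates[OF gJ idC Suc.prems(2), of i] Suc.prems(1) by auto
  have "dual k u j \<in> C (Suc i)" for j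
    by (rule partial_ideal_SucI[OF C_diff_sym[OF u(2)[of j]], of "v j"])
      (use cvecs_mem[OF v] in \<open>auto simp: mult.commute\<close>)
  then have "u \<in> cocycles k (C (Suc i))" using u(1) by (simp add: cocycles_def)
  then have "u \<in> coboundaries k (C (Suc i))" using Suc.IH[of "Suc i" u] Suc.prems(1) by simp
  then obtain x where x: "x \<in> dual_images k" "\<And>j. u j - x j \<in> C (Suc i)" by (auto simp: coboundaries_def)
  have ux: "(\<lambda>j. u j - x j) \<in> cvecs P (b k)"
    using u(1) dual_images_cvecs[OF x(1)] by (auto simp: cvecs_def diff_mem)
  obtain q where q: "q \<in> cvecs P (b k)" "\<And>j. (u j - x j) - g i * q j \<in> C i"
    using C_Suc_decompose[OF ux x(2)] by blast
  have uq: "dual k u j - g i * dual k q j \<in> C i" for j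
    using dual_cong[of "\<lambda>j. u j - x j" "\<lambda>j. g i * q j" i k j] q(2)
    by (simp add: dual_diff dual_smult dual_dual_images[OF x(1)])
  have "g i * v j - g i * dual k q j \<in> C i" for j by (rule C_diff_trans[OF u(2) uq])
  then have "v j - dual k q j \<in> C i" for j
    using regular[of i "v j - dual k q j"] Suc.prems(1) cvecs_mem[OF v] cvecs_mem[OF dual_cvecs[OF q(1)]]
    by (simp add: right_diff_distrib diff_mem)
  then show ?case using v q(1) by (auto simp: coboundaries_def)
qed

text \<open>
  The graph, on representatives, of the connecting homomorphism from \<open>Ext^k(P/J, P/C_(i+1))\<close> to
  \<open>Ext^(k+1)(P/J, P/C_i)\<close>.
\<close>

definition connecting :: "nat \<Rightarrow> nat \<Rightarrow> (nat \<Rightarrow> 'a) \<Rightarrow> (nat \<Rightarrow> 'a) \<Rightarrow> bool" where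
  "connecting k i v w \<longleftrightarrow> v \<in> cocycles k (C (Suc i)) \<and> w \<in> cocycles (Suc k) (C i) \<and>
     (\<forall>m. dual k v m - g i * w m \<in> C i)"

lemma connecting_total:
  assumes "i < c" and v: "v \<in> cocycles k (C (Suc i))"
  shows "\<exists>w. connecting k i v w"
proof -
  have vc: "v \<in> cvecs P (b k)" "\<And>j. dual k v j \<in> C (Suc i)" using v by (auto simp: cocycles_def)
  obtain w where w: "w \<in> cvecs P (b (Suc k))" "\<And>j. dual k v j - g i * w j \<in> C i"
    using C_Suc_decompose[OF dual_cvecs[OF vc(1)], of i] vc(2) by blast
  have "g i * dual (Suc k) w m \<in> C i" for m
    using is_idealD(6)[OF idC dual_cong[of "dual k v" "\<lambda>j. g i * w j" i "Suc k" m]] w(2)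
    by (simp add: dual_smult dual_dual[OF vc(1)])
  then have "dual (Suc k) w m \<in> C i" for m
    using regular[OF assms(1)] cvecs_mem[OF dual_cvecs[OF w(1)]] by simp
  then show ?thesis using v w by (auto simp: connecting_def cocycles_def)
qed

lemma connecting_onto:
  assumes "i < c" and w: "w \<in> cocycles (Suc k) (C i)"
  shows "\<exists>v. connecting k i v w"
proof -
  have wc: "w \<in> cvecs P (b (Suc k))" using w by (auto simp: cocycles_def)
  obtain v where v: "v \<in> cvecs P (b k)" "\<And>j. g i * w j - dual k v j \<in> C i"
    using annihilates[OF gJ[OF assms(1)] idC w] by auto
  have "dual k v j \<in> C (Suc i)" for j
    by (rule partial_ideal_SucI[OF C_diff_sym[OF v(2)[of j]], of "w j"])
      (use cvecs_mem[OF wc] in \<open>auto simp: mult.commute\<close>)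
  then show ?thesis using v w by (auto simp: connecting_def cocycles_def intro: C_diff_sym)
qed

lemma connecting_linear:
  assumes z: "connecting k i z z'" and G: "\<And>j. j < t \<Longrightarrow> connecting k i (G j) (G' j)" and w: "w \<in> cvecs P t"
  shows "connecting k i (\<lambda>l. z l - (\<Sum>j<t. w j * G j l)) (\<lambda>l. z' l - (\<Sum>j<t. w j * G' j l))"
proof -
  have "dual k (\<lambda>l. z l - (\<Sum>j<t. w j * G j l)) m - g i * (z' m - (\<Sum>j<t. w j * G' j m)) \<in> C i" for m
  proof -
    have "dual k (\<lambda>l. z l - (\<Sum>j<t. w j * G j l)) m - g i * (z' m - (\<Sum>j<t. w j * G' j m)) =
      (dual k z m - g i * z' m) - (\<Sum>j<t. w j * (dual k (G j) m - g i * G' j m))"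
      by (simp add: dual_diff dual_sum right_diff_distrib sum_subtractf sum_distrib_left mult.left_commute)
    also have "\<dots> \<in> C i"
    proof (rule is_idealD(3)[OF idC])
      show "dual k z m - g i * z' m \<in> C i" using z by (simp add: connecting_def)
      show "(\<Sum>j<t. w j * (dual k (G j) m - g i * G' j m)) \<in> C i"
        using G cvecs_mem[OF w]
        by (auto simp: connecting_def intro!: ideal_sum[OF idC] is_idealD(5)[OF idC, rotated])
    qed
    finally show ?thesis .
  qed
  then show ?thesis
    using z G w by (auto simp: connecting_def intro!: cocycles_lincomb idC)
qed

text \<open>
  The connecting homomorphism is well defined, and it is injective because the term before it in
  the long exact sequence, \<open>Ext^k(P/J, P/C_i)\<close>, vanishes.
\<close>

lemma connecting_coboundaries:
  assumes "k + i < c" and vw: "connecting k i v w"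
  shows "v \<in> coboundaries k (C (Suc i)) \<longleftrightarrow> w \<in> coboundaries (Suc k) (C i)"
proof
  have v: "v \<in> cvecs P (b k)" and w: "w \<in> cvecs P (b (Suc k))" and vw': "\<And>m. dual k v m - g i * w m \<in> C i"
    using vw by (auto simp: connecting_def cocycles_def)
  {
    assume "v \<in> coboundaries k (C (Suc i))"
    then obtain x where x: "x \<in> dual_images k" "\<And>j. v j - x j \<in> C (Suc i)" by (auto simp: coboundaries_def)
    have vx: "(\<lambda>j. v j - x j) \<in> cvecs P (b k)"
      using v dual_images_cvecs[OF x(1)] by (auto simp: cvecs_def diff_mem)
    obtain q where q: "q \<in> cvecs P (b k)" "\<And>j. (v j - x j) - g i * q j \<in> C i"
      using C_Suc_decompose[OF vx x(2)] by blast
    have vq: "dual k v j - g i * dual k q j \<in> C i" for j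
      using dual_cong[of "\<lambda>j. v j - x j" "\<lambda>j. g i * q j" i k j] q(2)
      by (simp add: dual_diff dual_smult dual_dual_images[OF x(1)])
    have "g i * w j - g i * dual k q j \<in> C i" for j by (rule C_diff_trans[OF C_diff_sym[OF vw'] vq])
    then have "w j - dual k q j \<in> C i" for j
      using regular[of i "w j - dual k q j"] assms(1) cvecs_mem[OF w] cvecs_mem[OF dual_cvecs[OF q(1)]]
      by (simp add: right_diff_distrib diff_mem)
    then show "w \<in> coboundaries (Suc k) (C i)" using w q(1) by (auto simp: coboundaries_def)
  next
    assume "w \<in> coboundaries (Suc k) (C i)"
    then obtain q where q: "q \<in> cvecs P (b k)" "\<And>j. w j - dual k q j \<in> C i" by (auto simp: coboundaries_def)
    have wq: "g i * w j - g i * dual k q j \<in> C i" for j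
      using is_idealD(5)[OF idC q(2)[of j] gP[of i]] by (simp add: right_diff_distrib)
    have "dual k v j - g i * dual k q j \<in> C i" for j by (rule C_diff_trans[OF vw' wq])
    then have "(\<lambda>j. v j - g i * q j) \<in> cocycles k (C i)"
      using v q(1) gP by (auto simp: cocycles_def dual_diff dual_smult cvecs_def diff_mem mult_mem)
    then have "(\<lambda>j. v j - g i * q j) \<in> coboundaries k (C i)" using vanishing assms(1) by blast
    then obtain x where x: "x \<in> dual_images k" "\<And>j. (v j - g i * q j) - x j \<in> C i" by (auto simp: coboundaries_def)
    have "v j - x j \<in> C (Suc i)" for j
      by (rule partial_ideal_SucI[OF x(2)[of j], of "q j"]) (use cvecs_mem[OF q(1)] in \<open>auto simp: algebra_simps\<close>)
    then show "v \<in> coboundaries k (C (Suc i))" using v x(1) by (auto simp: coboundaries_def)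
  }
qed

lemma generated_by_step:
  assumes "k + i < c"
  shows "generated_by t (cocycles k (C (Suc i))) (coboundaries k (C (Suc i))) \<longleftrightarrow>
    generated_by t (cocycles (Suc k) (C i)) (coboundaries (Suc k) (C i))"
proof -
  have i: "i < c" using assms by simp
  have total: "\<exists>w\<in>cocycles (Suc k) (C i). connecting k i v w" if "v \<in> cocycles k (C (Suc i))" for v
    using connecting_total[OF i that] by (auto simp: connecting_def)
  have onto: "\<exists>v\<in>cocycles k (C (Suc i)). connecting k i v w" if "w \<in> cocycles (Suc k) (C i)" for w
    using connecting_onto[OF i that] by (auto simp: connecting_def)
  note iff = connecting_coboundaries[OF assms]
  show ?thesis
  proof
    assume "generated_by t (cocycles k (C (Suc i))) (coboundaries k (C (Suc i)))"
    from total onto connecting_linear iff[THEN iffD1] this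
    show "generated_by t (cocycles (Suc k) (C i)) (coboundaries (Suc k) (C i))"
      by (rule generated_by_transfer)
  next
    assume "generated_by t (cocycles (Suc k) (C i)) (coboundaries (Suc k) (C i))"
    from onto total connecting_linear iff[THEN iffD2] this
    show "generated_by t (cocycles k (C (Suc i))) (coboundaries k (C (Suc i)))"
      by (rule generated_by_transfer[where \<rho> = "\<lambda>w v. connecting k i v w"])
  qed
qed

text \<open>
  Composing the connecting isomorphisms gives \<open>Ext^c(P/J, P) = Ext^0(P/J, P/C_c)\<close>.
\<close>

lemma generated_by_Ext:
  "generated_by t (cocycles c {0}) (coboundaries c {0}) \<longleftrightarrow>
   generated_by t (cocycles 0 (C c)) (coboundaries 0 (C c))"
proof -
  have "generated_by t (cocycles (c - i) (C i)) (coboundaries (c - i) (C i)) \<longleftrightarrow>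
   generated_by t (cocycles c {0}) (coboundaries c {0})" if "i \<le> c" for i
    using that
  proof (induction i)
    case (Suc i)
    have eq: "Suc (c - Suc i) = c - i" using Suc.prems by simp
    have "generated_by t (cocycles (c - Suc i) (C (Suc i))) (coboundaries (c - Suc i) (C (Suc i))) \<longleftrightarrow>
      generated_by t (cocycles (Suc (c - Suc i)) (C i)) (coboundaries (Suc (c - Suc i)) (C i))"
      by (rule generated_by_step) (use Suc.prems in simp)
    then show ?case using Suc by (simp add: eq)
  qed simp
  from this[of c] show ?thesis by simp
qed

end

section \<open>Rewriting of monomials\<close>

lemma mon_dvd_0: "mon_dvd 0 m" by (simp add: mon_dvd_iff)

lemma mon_dvd_expo: "mon_dvd (expo i) m \<longleftrightarrow> i \<in> keys m"
  by (auto simp: mon_dvd_iff lookup_single when_def in_keys_iff Suc_le_eq)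

lemma mon_dvd_add_expo:
  assumes "mon_dvd k m" "i \<notin> keys k" "i \<in> keys m"
  shows "mon_dvd (k + expo i) m"
proof -
  obtain r where r: "m = k + r" using assms(1) by (auto simp: mon_dvd_def)
  then have "mon_dvd (expo i) r" using assms(2,3) by (auto simp: mon_dvd_expo keys_plus_nat)
  then show ?thesis by (auto simp: mon_dvd_def r add.assoc)
qed

text \<open>
  The weight makes rewriting terminate, and coprime left-hand sides make it confluent. Modulo the
  binomials \<open>lhs a - rhs a\<close>, the irreducible monomials are therefore a basis of the polynomials.
\<close>

locale monomial_rewriting =
  fixes I :: "nat set" and lhs rhs :: "nat \<Rightarrow> nat \<Rightarrow>\<^sub>0 nat" and weight :: "(nat \<Rightarrow>\<^sub>0 nat) \<Rightarrow> nat"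
  assumes weight_add: "weight (m + k) = weight m + weight k"
    and weight_decreases: "a \<in> I \<Longrightarrow> weight (rhs a) < weight (lhs a)"
    and coprime: "a \<in> I \<Longrightarrow> b \<in> I \<Longrightarrow> a \<noteq> b \<Longrightarrow> mon_dvd (lhs a) m \<Longrightarrow> mon_dvd (lhs b) m \<Longrightarrow> mon_dvd (lhs a + lhs b) m"
begin

definition step :: "(nat \<Rightarrow>\<^sub>0 nat) \<Rightarrow> (nat \<Rightarrow>\<^sub>0 nat) \<Rightarrow> bool" where
  "step m k \<longleftrightarrow> (\<exists>a\<in>I. \<exists>r. m = lhs a + r \<and> k = rhs a + r)"

definition irreducible_mon :: "(nat \<Rightarrow>\<^sub>0 nat) \<Rightarrow> bool" where
  "irreducible_mon m \<longleftrightarrow> (\<forall>a\<in>I. \<not> mon_dvd (lhs a) m)"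

lemma step_weight: "step m k \<Longrightarrow> weight k < weight m"
  by (auto simp: step_def weight_add weight_decreases)

lemma irreducible_no_step: "irreducible_mon m \<Longrightarrow> \<not> step m k"
  by (auto simp: irreducible_mon_def step_def mon_dvd_def)

text \<open>Left-hand sides are coprime, so two different steps commute.\<close>

lemma step_diamond:
  assumes "step m k" "step m k'" "k \<noteq> k'"
  shows "\<exists>l. step k l \<and> step k' l"
proof -
  obtain a r where a: "a \<in> I" "m = lhs a + r" "k = rhs a + r" using assms(1) by (auto simp: step_def)
  obtain b s where b: "b \<in> I" "m = lhs b + s" "k' = rhs b + s" using assms(2) by (auto simp: step_def)
  have "a \<noteq> b" using a b assms(3) by auto
  moreover have "mon_dvd (lhs a) m" "mon_dvd (lhs b) m" unfolding mon_dvd_def using a(2) b(2) by blast+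
  ultimately have "mon_dvd (lhs a + lhs b) m" using coprime a(1) b(1) by blast
  then obtain t where t: "m = lhs a + lhs b + t" by (auto simp: mon_dvd_def)
  have r: "r = lhs b + t" using a(2) t by (simp add: add.assoc)
  have "lhs b + s = lhs b + (lhs a + t)" using b(2) t by (simp add: ac_simps)
  then have s: "s = lhs a + t" by (rule add_left_imp_eq)
  have "step k (rhs a + rhs b + t)"
    unfolding step_def using b(1) by (intro bexI[of _ b] exI[of _ "rhs a + t"]) (auto simp: a(3) r ac_simps)
  moreover have "step k' (rhs a + rhs b + t)"
    unfolding step_def using a(1) by (intro bexI[of _ a] exI[of _ "rhs b + t"]) (auto simp: b(3) s ac_simps)
  ultimately show ?thesis by blast
qed

text \<open>
  Newman's argument: the diamond property joins two first steps in a monomial of smaller weight,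
  which has a normal form, and uniqueness below gives the same normal form on both sides.
\<close>

lemma ex1_normal_form: "\<exists>!k. step\<^sup>*\<^sup>* m k \<and> irreducible_mon k"
proof (induction "weight m" arbitrary: m rule: less_induct)
  case less
  show ?case
  proof (cases "irreducible_mon m")
    case True
    then show ?thesis using irreducible_no_step by (metis converse_rtranclpE rtranclp.rtrancl_refl)
  next
    case False
    then obtain m1 where m1: "step m m1" by (auto simp: irreducible_mon_def step_def mon_dvd_def)
    obtain k1 where k1: "step\<^sup>*\<^sup>* m1 k1" "irreducible_mon k1"
      and unique: "\<And>k. step\<^sup>*\<^sup>* m1 k \<Longrightarrow> irreducible_mon k \<Longrightarrow> k = k1"
      using less[OF step_weight[OF m1]] by blast
    have "k = k1" if k: "step\<^sup>*\<^sup>* m k" "irreducible_mon k" for k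
    proof -
      have "m \<noteq> k" using False k(2) by auto
      then obtain m2 where m2: "step m m2" "step\<^sup>*\<^sup>* m2 k" using k(1) by (metis converse_rtranclpE)
      show ?thesis
      proof (cases "m1 = m2")
        case True
        then show ?thesis using unique m2(2) k(2) by blast
      next
        case False
        then obtain m3 where m3: "step m1 m3" "step m2 m3" using step_diamond m1 m2(1) by blast
        have "weight m3 < weight m" using step_weight[OF m1] step_weight[OF m3(1)] by simp
        then obtain k3 where k3: "step\<^sup>*\<^sup>* m3 k3" "irreducible_mon k3" using less by blast
        have "k3 = k1" using unique converse_rtranclp_into_rtranclp[of step, OF m3(1) k3(1)] k3(2) by blast
        moreover have "k3 = k"
          using less[OF step_weight[OF m2(1)]] converse_rtranclp_into_rtranclp[of step, OF m3(2) k3(1)] k3(2) m2(2) k(2)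
          by blast
        ultimately show ?thesis by simp
      qed
    qed
    moreover have "step\<^sup>*\<^sup>* m k1" using m1 k1(1) by (rule converse_rtranclp_into_rtranclp)
    ultimately show ?thesis using k1(2) by blast
  qed
qed

definition normal_form :: "(nat \<Rightarrow>\<^sub>0 nat) \<Rightarrow> nat \<Rightarrow>\<^sub>0 nat" where
  "normal_form m = (THE k. step\<^sup>*\<^sup>* m k \<and> irreducible_mon k)"

lemma normal_form: "step\<^sup>*\<^sup>* m (normal_form m)" "irreducible_mon (normal_form m)"
  using theI'[OF ex1_normal_form[of m]] by (auto simp: normal_form_def)

lemma normal_form_eqI: "step\<^sup>*\<^sup>* m k \<Longrightarrow> irreducible_mon k \<Longrightarrow> normal_form m = k"
  unfolding normal_form_def by (rule the1_equality[OF ex1_normal_form]) simp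

lemma normal_form_irreducible: "irreducible_mon m \<Longrightarrow> normal_form m = m"
  by (rule normal_form_eqI) auto

lemma normal_form_step: "step m k \<Longrightarrow> normal_form m = normal_form k"
  by (rule normal_form_eqI[OF converse_rtranclp_into_rtranclp[of step, OF _ normal_form(1)] normal_form(2)])

lemma weight_normal_form: "weight (normal_form m) \<le> weight m"
proof -
  have "weight k \<le> weight m" if "step\<^sup>*\<^sup>* m k" for k
    using that by induction (auto dest: step_weight)
  then show ?thesis using normal_form(1) by blast
qed

definition normal_form_poly :: "'k::comm_ring_1 mpoly \<Rightarrow> 'k mpoly" where
  "normal_form_poly p = (\<Sum>m\<in>keys p. Poly_Mapping.single (normal_form m) (lookup p m))"

lemma normal_form_poly_single [simp]:
  "normal_form_poly (Poly_Mapping.single m c) = Poly_Mapping.single (normal_form m) c"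
  by (simp add: normal_form_poly_def)

lemma normal_form_poly_zero [simp]: "normal_form_poly 0 = 0"
  by (simp add: normal_form_poly_def)

lemma normal_form_poly_add: "normal_form_poly (p + q) = normal_form_poly p + normal_form_poly q"
  unfolding normal_form_poly_def by (rule setsum_keys_plus_distrib) (auto simp: single_add)

lemma normal_form_poly_diff: "normal_form_poly (p - q) = normal_form_poly p - normal_form_poly q"
  using normal_form_poly_add[of "p - q" q] by simp

lemma normal_form_poly_sum: "normal_form_poly (sum f X) = (\<Sum>x\<in>X. normal_form_poly (f x))"
  by (induction X rule: infinite_finite_induct) (auto simp: normal_form_poly_add)

lemma keys_normal_form_poly:
  assumes "m \<in> keys (normal_form_poly p)"
  shows "irreducible_mon m"
proof (rule ccontr)
  assume "\<not> irreducible_mon m"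
  then have "lookup (normal_form_poly p) m = 0"
    unfolding normal_form_poly_def lookup_sum lookup_single
    by (intro sum.neutral) (metis normal_form(2) when_simps(2))
  then show False using assms by (simp add: in_keys_iff)
qed

lemma normal_form_poly_rule:
  assumes "a \<in> I"
  shows "normal_form_poly (q * (mon (lhs a) - mon (rhs a))) = 0"
proof (induction q rule: mpoly_additive_induct)
  case (single m c)
  have "step (m + lhs a) (m + rhs a)" using assms by (auto simp: step_def ac_simps)
  then show ?case
    by (simp add: right_diff_distrib single_mult_mon normal_form_poly_diff normal_form_step)
qed (simp_all add: distrib_right normal_form_poly_add)

text \<open>
  If \<open>stat\<close> separates the two terms of a binomial in this way, the term of \<open>v\<close> with the
  largest value of \<open>stat\<close> survives in the normal form of the product.
\<close>

lemma binomial_multiple_zero: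
  fixes v :: "'k::comm_ring_1 mpoly" and stat :: "(nat \<Rightarrow>\<^sub>0 nat) \<Rightarrow> nat"
  assumes zero: "normal_form_poly (v * (mon M1 - mon M2)) = 0"
    and irr: "\<And>m. m \<in> keys v \<Longrightarrow> irreducible_mon (m + M1)"
    and stat1: "\<And>m. stat (m + M1) = stat m + d"
    and stat2: "\<And>m. m \<in> keys v \<Longrightarrow> stat (normal_form (m + M2)) < stat m + d"
  shows "v = 0"
proof (rule ccontr)
  assume "v \<noteq> 0"
  then have "keys v \<noteq> {}" by (auto simp: in_keys_iff intro: poly_mapping_eqI)
  then have "Max (stat ` keys v) \<in> stat ` keys v" by (intro Max_in) auto
  then obtain m0 where m0: "m0 \<in> keys v" "stat m0 = Max (stat ` keys v)" by auto
  then have max: "stat m \<le> stat m0" if "m \<in> keys v" for m using that by auto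
  have "v * (mon M1 - mon M2) = (\<Sum>m\<in>keys v. Poly_Mapping.single m (lookup v m)) * (mon M1 - mon M2)"
    by (simp only: mpoly_eq_sum_single[symmetric])
  also have "\<dots> = (\<Sum>m\<in>keys v. Poly_Mapping.single (m + M1) (lookup v m) - Poly_Mapping.single (m + M2) (lookup v m))"
    by (simp add: sum_distrib_right right_diff_distrib single_mult_mon sum_subtractf)
  finally have "(\<Sum>m\<in>keys v. Poly_Mapping.single (m + M1) (lookup v m) - Poly_Mapping.single (normal_form (m + M2)) (lookup v m)) = 0"
    using zero by (simp add: normal_form_poly_sum normal_form_poly_diff normal_form_irreducible[OF irr] cong: sum.cong)
  then have "0 = lookup (\<Sum>m\<in>keys v. Poly_Mapping.single (m + M1) (lookup v m) - Poly_Mapping.single (normal_form (m + M2)) (lookup v m)) (m0 + M1)"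
    by simp
  also have "\<dots> = (\<Sum>m\<in>keys v. if m = m0 then lookup v m else 0)"
    unfolding lookup_sum
  proof (rule sum.cong[OF refl])
    fix m assume m: "m \<in> keys v"
    have "normal_form (m + M2) \<noteq> m0 + M1"
      using stat2[OF m] max[OF m] stat1[of m0] by auto
    then show "lookup (Poly_Mapping.single (m + M1) (lookup v m) - Poly_Mapping.single (normal_form (m + M2)) (lookup v m)) (m0 + M1)
      = (if m = m0 then lookup v m else 0)"
      by (auto simp: lookup_minus lookup_single when_def)
  qed
  also have "\<dots> = lookup v m0" using m0(1) by simp
  finally show False using m0(1) by (simp add: in_keys_iff)
qed

end

section \<open>The relations of the Rees algebra of an odd cycle\<close>

text \<open>
  The variable \<open>n + j\<close> stands for \<open>u\<^sub>j s\<close>, and \<open>u\<^sub>j\<close> is the product of all variables except those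
  with indices \<open>j - 2\<close> and \<open>j - 1\<close>. In the numbering \<open>X\<^sub>a = var (x_index a)\<close>,
  \<open>Y\<^sub>a = var (y_index a)\<close>, with \<open>a\<close> modulo \<open>n\<close>, the generator \<open>Y\<^sub>a\<close> therefore misses \<open>X\<^sub>a\<close> and
  \<open>X\<^sub>a\<^sub>+\<^sub>1\<close>, and \<open>X\<^sub>a Y\<^sub>a = X\<^sub>a\<^sub>+\<^sub>2 Y\<^sub>a\<^sub>+\<^sub>1\<close>. The parameter \<open>K\<close> fixes the coefficient field, which gives
  the ideals below a definite type.
\<close>

locale odd_cycle =
  fixes n :: nat and K :: "'k::field itself"
  assumes n_gt_1: "n > 1" and odd_n: "odd n"
begin

definition x_index :: "nat \<Rightarrow> nat" where "x_index a = (a + n - 2) mod n"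

definition y_index :: "nat \<Rightarrow> nat" where "y_index a = n + a mod n"

definition lhs :: "nat \<Rightarrow> nat \<Rightarrow>\<^sub>0 nat" where
  "lhs a = expo (x_index a) + expo (y_index a)"

definition rhs :: "nat \<Rightarrow> nat \<Rightarrow>\<^sub>0 nat" where
  "rhs a = expo (x_index (a + 2)) + expo (y_index (a + 1))"

definition rel :: "nat \<Rightarrow> 'k mpoly" where
  "rel a = mon (lhs a) - mon (rhs a)"

text \<open>
  The regular sequence starts with the relation of index \<open>1\<close>; the relation of index \<open>0\<close> is the
  generator that it leaves out.
\<close>

abbreviation rels :: "nat \<Rightarrow> 'k mpoly" where
  "rels i \<equiv> rel (Suc i)"

definition half :: nat where "half = (n - 1) div 2"

lemma n_half: "n = 2 * half + 1" using odd_n by (auto simp: half_def elim!: oddE)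

lemma half_pos: "half > 0" using n_half n_gt_1 by simp

lemma n_ge_3: "n \<ge> 3" using n_half half_pos by simp

lemma x_index_less: "x_index a < n" using n_gt_1 by (simp add: x_index_def)

lemma y_index_bounds: "n \<le> y_index a" "y_index a < 2 * n" using n_gt_1 by (auto simp: y_index_def)

lemma index_less: "x_index a < 2 * n" "y_index a < 2 * n"
  using x_index_less[of a] y_index_bounds[of a] by auto

lemma x_neq_y [simp]: "x_index a \<noteq> y_index b" "y_index b \<noteq> x_index a"
  using x_index_less[of a] y_index_bounds(1)[of b] by auto

lemma x_index_periodic: "x_index (a + n) = x_index a"
  using n_gt_1 by (simp add: x_index_def) (metis Nat.add_diff_assoc2 Suc_leI mod_add_self2 numeral_2_eq_2 trans_le_add2)

lemma y_index_periodic: "y_index (a + n) = y_index a"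
  by (simp add: y_index_def)

lemma x_index_n: "x_index n = x_index 0" "x_index (Suc n) = x_index 1"
  using x_index_periodic[of 0] x_index_periodic[of 1] by simp_all

lemma y_index_n: "y_index n = y_index 0" using y_index_periodic[of 0] by simp

lemma x_index_eq_iff: "a < n \<Longrightarrow> b < n \<Longrightarrow> x_index a = x_index b \<longleftrightarrow> a = b"
proof -
  have *: "x_index a = (if a < 2 then a + n - 2 else a - 2)" if "a < n" for a
  proof (cases "a < 2")
    case True
    then show ?thesis using that n_ge_3 by (simp add: x_index_def)
  next
    case False
    then have eq: "a + n - 2 = (a - 2) + n" by simp
    have "(a - 2 + n) mod n = (a - 2) mod n" by (rule mod_add_self2)
    also have "\<dots> = a - 2" by (rule mod_less) (use that in simp)
    finally show ?thesis using False by (simp only: x_index_def eq if_False)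
  qed
  show "a < n \<Longrightarrow> b < n \<Longrightarrow> ?thesis" using n_ge_3 by (simp add: *) linarith
qed

lemma y_index_eq_iff: "a < n \<Longrightarrow> b < n \<Longrightarrow> y_index a = y_index b \<longleftrightarrow> a = b"
  by (simp add: y_index_def)

lemma mon_dvd_lhs: "mon_dvd (lhs a) m \<longleftrightarrow> x_index a \<in> keys m \<and> y_index a \<in> keys m"
proof
  assume "mon_dvd (lhs a) m"
  then show "x_index a \<in> keys m \<and> y_index a \<in> keys m"
    by (auto simp: mon_dvd_def lhs_def keys_plus_nat)
next
  assume "x_index a \<in> keys m \<and> y_index a \<in> keys m"
  then show "mon_dvd (lhs a) m" unfolding lhs_def by (intro mon_dvd_add_expo) (auto simp: mon_dvd_expo)
qed

text \<open>The weight \<open>n - a\<close> of \<open>Y\<^sub>a\<close>, for \<open>1 \<le> a < n\<close>, makes \<open>X\<^sub>a Y\<^sub>a\<close> the leading term of the relation.\<close>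

definition var_weight :: "nat \<Rightarrow> nat" where "var_weight j = (if n < j then 2 * n - j else 0)"

definition weight :: "(nat \<Rightarrow>\<^sub>0 nat) \<Rightarrow> nat" where
  "weight m = (\<Sum>j<2 * n. var_weight j * lookup m j)"

lemma weight_plus: "weight (m + k) = weight m + weight k"
  by (simp add: weight_def lookup_add distrib_left sum.distrib)

lemma weight_expo: "j < 2 * n \<Longrightarrow> weight (expo j) = var_weight j"
  by (simp add: weight_def lookup_single when_def if_distrib[of "\<lambda>x. _ * x"] cong: if_cong)

lemma weight_rhs_less:
  assumes "1 \<le> a" "a \<le> n - 1"
  shows "weight (rhs a) < weight (lhs a)"
proof -
  have x: "var_weight (x_index b) = 0" for b
    using x_index_less[of b] by (simp add: var_weight_def)
  have "var_weight (y_index a) = n - a"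
    using assms by (auto simp: var_weight_def y_index_def)
  moreover have "var_weight (y_index (a + 1)) = n - a - 1"
  proof (cases "a + 1 = n")
    case True
    then show ?thesis by (simp add: y_index_n var_weight_def y_index_def)
  next
    case False
    then have "a + 1 < n" using assms n_gt_1 by simp
    then show ?thesis by (auto simp: var_weight_def y_index_def)
  qed
  ultimately show ?thesis using assms n_gt_1
    by (simp add: lhs_def rhs_def weight_plus weight_expo index_less x)
qed

lemma rewriting: "i \<le> n - 1 \<Longrightarrow> monomial_rewriting {Suc 0..i} lhs rhs weight"
proof
  fix a b m assume i: "i \<le> n - 1" and ab: "a \<in> {Suc 0..i}" "b \<in> {Suc 0..i}" "a \<noteq> b" "mon_dvd (lhs a) m" "mon_dvd (lhs b) m"
  then have "a < n" "b < n" using n_gt_1 by auto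
  then have "x_index b \<noteq> x_index a" "y_index b \<noteq> y_index a"
    using ab(3) by (auto simp: x_index_eq_iff y_index_eq_iff)
  moreover have "x_index b \<in> keys m" "y_index b \<in> keys m" using ab(5) by (auto simp: mon_dvd_lhs)
  moreover have "mon_dvd (lhs a) m" using ab by blast
  ultimately have "mon_dvd (lhs a + expo (x_index b) + expo (y_index b)) m"
    by (intro mon_dvd_add_expo) (auto simp: lhs_def keys_plus_nat)
  then show "mon_dvd (lhs a + lhs b) m" by (simp add: lhs_def[of b] add.assoc)
qed (auto simp: weight_plus weight_rhs_less)

end

interpretation mpolys: unital_subring "mpolys N :: 'k::comm_ring_1 mpoly set" for N
  by unfold_locales (simp_all add: mpolys_diff mpolys_mult)

lemma keys_subset_of_sum: "(\<And>i. i \<in> I \<Longrightarrow> keys (f i) \<subseteq> A) \<Longrightarrow> keys (sum f I :: nat \<Rightarrow>\<^sub>0 nat) \<subseteq> A"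
  by (induction I rule: infinite_finite_induct) (auto simp: keys_plus_nat)

context odd_cycle
begin

abbreviation R :: "'k mpoly set" where "R \<equiv> mpolys (2 * n)"

definition C :: "nat \<Rightarrow> 'k mpoly set" where
  "C i = unital_subring.partial_ideal (mpolys (2 * n)) rels i"

lemma keys_lhs_rhs: "keys (lhs a) \<subseteq> {..<2 * n}" "keys (rhs a) \<subseteq> {..<2 * n}"
  using index_less by (auto simp: lhs_def rhs_def keys_plus_nat)

lemma rel_in_R: "rel a \<in> R"
  unfolding rel_def by (intro mpolys_diff single_in_mpolys keys_lhs_rhs)

lemma ideal_C: "mpolys.is_ideal (2 * n) (C i :: 'k mpoly set)"
  unfolding C_def by (rule mpolys.is_ideal_partial_ideal) (rule rel_in_R)

lemmas C_closed = mpolys.is_idealD[OF ideal_C]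

lemma C_trans: "p - q \<in> C i \<Longrightarrow> q - r \<in> C i \<Longrightarrow> p - r \<in> C i"
  using C_closed(4)[of "p - q" i "q - r"] by simp

lemma C_sym: "p - q \<in> C i \<Longrightarrow> q - p \<in> C i"
  using C_closed(6)[of "p - q" i] by simp

lemma rel_in_C:
  assumes "1 \<le> a" "a \<le> i"
  shows "rel a \<in> C i"
  using mpolys.gen_in_partial_ideal[of i rels "2 * n" "a - 1"] assms rel_in_R unfolding C_def by fastforce

lemma C_move:
  assumes "1 \<le> a" "a \<le> i" "keys r \<subseteq> {..<2 * n}"
  shows "mon (lhs a + r) - mon (rhs a + r) \<in> C i"
proof -
  have "mon r * rel a \<in> C i" by (intro C_closed(5) rel_in_C assms single_in_mpolys)
  then show ?thesis by (simp add: rel_def right_diff_distrib mult_single add.commute)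
qed

lemma C_mon_add:
  assumes "mon m - mon k \<in> C i" "keys r \<subseteq> {..<2 * n}"
  shows "mon (m + r) - mon (k + r) \<in> C i"
proof -
  have "mon r * (mon m - mon k) \<in> C i" by (intro C_closed(5) assms single_in_mpolys)
  then show ?thesis by (simp add: right_diff_distrib mult_single add.commute)
qed

text \<open>
  Rewriting steps are congruences modulo \<open>C i\<close>, and the normal form map kills the generators of
  \<open>C i\<close>. So \<open>C i\<close> is the kernel of the normal form map of the first \<open>i\<close> rules.
\<close>

context
  fixes i :: nat
  assumes i: "i \<le> n - 1"
begin

interpretation monomial_rewriting "{Suc 0..i}" lhs rhs weight by (rule rewriting[OF i])

lemma steps_in_C:
  assumes "step\<^sup>*\<^sup>* m k" "keys m \<subseteq> {..<2 * n}"
  shows "keys k \<subseteq> {..<2 * n} \<and> mon m - mon k \<in> (C i :: 'k mpoly set)"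
  using assms
proof (induction rule: rtranclp_induct)
  case base
  then show ?case using C_closed(2) by simp
next
  case (step k l)
  then obtain a r where a: "1 \<le> a" "a \<le> i" "k = lhs a + r" "l = rhs a + r" by (auto simp: step_def)
  have r: "keys r \<subseteq> {..<2 * n}" using step a(3) by (auto simp: keys_plus_nat)
  have "mon k - mon l \<in> (C i :: 'k mpoly set)" unfolding a(3,4) by (rule C_move[OF a(1,2) r])
  then show ?case using step r keys_lhs_rhs C_trans by (auto simp: a(4) keys_plus_nat)
qed

lemma normal_form_in_C:
  assumes "keys m \<subseteq> {..<2 * n}"
  shows "keys (normal_form m) \<subseteq> {..<2 * n}"
    "mon m - mon (normal_form m) \<in> (C i :: 'k mpoly set)"
  using steps_in_C[OF normal_form(1) assms] by auto

lemma normal_form_poly_in_R: "p \<in> R \<Longrightarrow> normal_form_poly p \<in> R"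
  unfolding normal_form_poly_def
  by (intro mpolys_sum single_in_mpolys normal_form_in_C(1)) (rule keys_in_mpolys)

lemma diff_normal_form_poly_in_C:
  assumes "p \<in> R"
  shows "p - normal_form_poly p \<in> C i"
  using assms
proof (induction rule: mpolys_additive_induct)
  case (single m c)
  have "const c * (mon m - mon (normal_form m)) \<in> C i"
    by (intro C_closed(5) normal_form_in_C single const_in_mpolys)
  then show ?case by (simp add: const_def right_diff_distrib mult_single)
next
  case (add p q)
  have "(p + q) - normal_form_poly (p + q) = (p - normal_form_poly p) + (q - normal_form_poly q)"
    by (simp add: normal_form_poly_add)
  also have "\<dots> \<in> C i" by (intro C_closed(4) add.IH)
  finally show ?case .
qed (simp add: C_closed(2))

lemma normal_form_poly_C:
  assumes "p \<in> C i"
  shows "normal_form_poly p = 0"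
proof -
  have "normal_form_poly p = 0" if "p \<in> C j" "j \<le> i" for p and j
    using that
  proof (induction j arbitrary: p)
    case (Suc j)
    obtain p' q where "p = p' + q * rels j" "p' \<in> C j"
      using Suc.prems(1) unfolding C_def by (rule mpolys.partial_ideal_SucE)
    moreover have "normal_form_poly (q * rels j) = 0"
      unfolding rel_def using Suc.prems(2) by (intro normal_form_poly_rule) simp
    ultimately show ?case using Suc by (simp add: normal_form_poly_add)
  qed (simp add: C_def)
  then show ?thesis using assms by blast
qed

lemma normal_form_eqI_C:
  assumes "mon m - mon k \<in> (C i :: 'k mpoly set)" "irreducible_mon k"
  shows "normal_form m = k"
proof -
  have "mon (normal_form m) - mon (normal_form k) = (0 :: 'k mpoly)"
    using normal_form_poly_C[OF assms(1)] by (simp add: normal_form_poly_diff)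
  then have "mon (normal_form m) = (mon k :: 'k mpoly)" by (simp add: normal_form_irreducible[OF assms(2)])
  then show ?thesis by (metis keys_single singleton_inject zero_neq_one)
qed

end

text \<open>
  If \<open>q\<close> is in normal form for the first \<open>i\<close> rules, then so is its product with the leading term
  \<open>X\<^sub>i\<^sub>+\<^sub>1 Y\<^sub>i\<^sub>+\<^sub>1\<close> of the next relation, which is coprime to the left-hand sides. The other term of the
  relation has smaller weight, so it cannot cancel the part of largest weight.
\<close>

lemma rels_regular:
  assumes i: "i < n - 1" and q: "q \<in> R" and zero: "rels i * q \<in> C i"
  shows "q \<in> (C i :: 'k mpoly set)"
proof -
  have i': "i \<le> n - 1" using i by simp
  interpret monomial_rewriting "{Suc 0..i}" lhs rhs weight by (rule rewriting[OF i'])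
  define q' where "q' = normal_form_poly q"
  have qq': "q - q' \<in> C i" unfolding q'_def by (rule diff_normal_form_poly_in_C[OF i' q])
  have "rels i * q' = rels i * q - rels i * (q - q')" by (simp add: algebra_simps)
  then have "rels i * q' \<in> C i" using C_closed(3)[OF zero C_closed(5)[OF qq' rel_in_R]] by simp
  then have "q' * (mon (lhs (Suc i)) - mon (rhs (Suc i))) \<in> C i" by (simp add: rel_def mult.commute)
  then have zero': "normal_form_poly (q' * (mon (lhs (Suc i)) - mon (rhs (Suc i)))) = 0"
    by (rule normal_form_poly_C[OF i'])
  have "q' = 0"
  proof (rule binomial_multiple_zero[OF zero'])
    fix m assume "m \<in> keys q'"
    then have irr: "irreducible_mon m" unfolding q'_def by (rule keys_normal_form_poly)
    show "irreducible_mon (m + lhs (Suc i))"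
      unfolding irreducible_mon_def mon_dvd_lhs
    proof
      fix a assume a: "a \<in> {Suc 0..i}"
      then have "a < n" "Suc i < n" "a \<noteq> Suc i" using i by auto
      then have "x_index a \<noteq> x_index (Suc i)" "y_index a \<noteq> y_index (Suc i)"
        by (simp_all add: x_index_eq_iff y_index_eq_iff)
      moreover have "\<not> (x_index a \<in> keys m \<and> y_index a \<in> keys m)"
        using irr a unfolding irreducible_mon_def mon_dvd_lhs by blast
      ultimately show "\<not> (x_index a \<in> keys (m + lhs (Suc i)) \<and> y_index a \<in> keys (m + lhs (Suc i)))"
        by (auto simp: keys_plus_nat lhs_def)
    qed
  next
    show "weight (m + lhs (Suc i)) = weight m + weight (lhs (Suc i))" for m by (rule weight_plus)
  next
    fix m assume "m \<in> keys q'"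
    have "weight (normal_form (m + rhs (Suc i))) \<le> weight m + weight (rhs (Suc i))"
      using weight_normal_form[of "m + rhs (Suc i)"] by (simp add: weight_plus)
    also have "\<dots> < weight m + weight (lhs (Suc i))" using weight_rhs_less[of "Suc i"] i by simp
    finally show "weight (normal_form (m + rhs (Suc i))) < weight m + weight (lhs (Suc i))" .
  qed
  then show ?thesis using qq' by simp
qed

section \<open>The ideal linked to the relations\<close>

definition evens :: "nat \<Rightarrow> nat \<Rightarrow>\<^sub>0 nat" where "evens j = (\<Sum>i<j. expo (y_index (2 * i + 2)))"

definition odds :: "nat \<Rightarrow> nat \<Rightarrow>\<^sub>0 nat" where "odds j = (\<Sum>i<j. expo (y_index (2 * i + 1)))"

lemma evens_Suc: "evens (Suc j) = evens j + expo (y_index (2 * j + 2))" by (simp add: evens_def)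

lemma odds_Suc: "odds (Suc j) = odds j + expo (y_index (2 * j + 1))" by (simp add: odds_def)

lemma evens_0 [simp]: "evens 0 = 0" and odds_0 [simp]: "odds 0 = 0"
  by (simp_all add: evens_def odds_def)

lemma keys_evens: "keys (evens j) = {y_index (2 * i + 2) | i. i < j}"
  by (induction j) (auto simp: evens_Suc keys_plus_nat less_Suc_eq)

lemma keys_odds: "keys (odds j) = {y_index (2 * i + 1) | i. i < j}"
  by (induction j) (auto simp: odds_Suc keys_plus_nat less_Suc_eq)

lemma keys_evens_odds: "keys (evens j) \<subseteq> {..<2 * n}" "keys (odds j) \<subseteq> {..<2 * n}"
  using index_less by (auto simp: keys_evens keys_odds)

lemma keys_expo: "keys (expo (x_index a)) \<subseteq> {..<2 * n}" "keys (expo (y_index a)) \<subseteq> {..<2 * n}"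
  using index_less by auto

lemmas keys_bounds = keys_plus_nat Un_least keys_evens_odds keys_expo keys_lhs_rhs

text \<open>
  Rewriting \<open>X\<^sub>2\<^sub>i Y\<^sub>2\<^sub>i\<close> to \<open>X\<^sub>2\<^sub>i\<^sub>+\<^sub>2 Y\<^sub>2\<^sub>i\<^sub>+\<^sub>1\<close> repeatedly turns \<open>Y\<^sub>1 Y\<^sub>2 Y\<^sub>4 ... Y\<^sub>2\<^sub>j\<close> into
  \<open>Y\<^sub>1 Y\<^sub>3 ... Y\<^sub>2\<^sub>j\<^sub>+\<^sub>1\<close>.
\<close>

lemma even_chain:
  assumes "2 * j \<le> n - 1"
  shows "mon (expo (x_index 2) + expo (y_index 1) + evens j) -
    mon (expo (x_index (2 * j + 2)) + odds (Suc j)) \<in> C (n - 1)"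
  using assms
proof (induction j)
  case 0
  then show ?case by (simp add: odds_def C_closed(2) flip: numeral_2_eq_2)
next
  case (Suc j)
  let ?y = "expo (y_index (2 * j + 2))"
  have 1: "mon (expo (x_index 2) + expo (y_index 1) + evens j + ?y) -
      mon (expo (x_index (2 * j + 2)) + odds (Suc j) + ?y) \<in> C (n - 1)"
    using Suc by (intro C_mon_add keys_expo) simp
  have eq: "expo (x_index (2 * j + 2)) + odds (Suc j) + ?y = lhs (2 * j + 2) + odds (Suc j)"
    by (simp add: lhs_def ac_simps)
  have eq': "expo (x_index (2 * Suc j + 2)) + odds (Suc (Suc j)) = rhs (2 * j + 2) + odds (Suc j)"
    by (simp add: rhs_def odds_Suc[of "Suc j"] ac_simps numeral_eq_Suc)
  have "mon (expo (x_index (2 * j + 2)) + odds (Suc j) + ?y) -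
      mon (expo (x_index (2 * Suc j + 2)) + odds (Suc (Suc j))) \<in> C (n - 1)"
    unfolding eq eq' using Suc.prems by (intro C_move keys_evens_odds) auto
  from C_trans[OF 1 this] show ?case by (simp only: evens_Suc add.assoc)
qed

text \<open>
  Here the relations are used backwards, from \<open>X\<^sub>2\<^sub>i\<^sub>+\<^sub>1 Y\<^sub>2\<^sub>i\<close> to \<open>X\<^sub>2\<^sub>i\<^sub>-\<^sub>1 Y\<^sub>2\<^sub>i\<^sub>-\<^sub>1\<close>.
\<close>

lemma odd_chain:
  assumes "2 * j + 1 \<le> n"
  shows "mon (expo (x_index (2 * j + 1)) + evens j) - mon (expo (x_index 1) + odds j) \<in> C (n - 1)"
  using assms
proof (induction j)
  case 0
  then show ?case by (simp add: C_closed(2))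
next
  case (Suc j)
  let ?y = "expo (y_index (2 * j + 1))"
  have 1: "mon (expo (x_index (2 * j + 1)) + evens j + ?y) - mon (expo (x_index 1) + odds j + ?y) \<in> C (n - 1)"
    using Suc by (intro C_mon_add keys_expo) simp
  have eq: "expo (x_index (2 * j + 1)) + evens j + ?y = lhs (2 * j + 1) + evens j"
    by (simp add: lhs_def ac_simps)
  have eq': "expo (x_index (2 * Suc j + 1)) + evens (Suc j) = rhs (2 * j + 1) + evens j"
    by (simp add: rhs_def evens_Suc ac_simps numeral_eq_Suc)
  have "mon (expo (x_index (2 * j + 1)) + evens j + ?y) -
      mon (expo (x_index (2 * Suc j + 1)) + evens (Suc j)) \<in> C (n - 1)"
    unfolding eq eq' using Suc.prems by (intro C_move keys_evens_odds) auto
  from C_trans[OF C_sym[OF this] 1] show ?case by (simp only: odds_Suc add.assoc)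
qed

text \<open>
  The ideal \<open>C + (X\<^sub>1, Y\<^sub>2 Y\<^sub>4 ... Y\<^sub>n\<^sub>-\<^sub>1)\<close>; it turns out to be the ideal \<open>C : J\<close> linked to \<open>J\<close>.
\<close>

definition linked :: "'k mpoly set" where
  "linked = {p \<in> R. \<exists>\<alpha>\<in>R. \<exists>\<beta>\<in>R. p - (\<alpha> * mon (expo (x_index 1)) + \<beta> * mon (evens half)) \<in> C (n - 1)}"

lemma x1_in_R: "mon (expo (x_index 1)) \<in> R" by (intro single_in_mpolys keys_expo)

lemma h_in_R: "mon (evens half) \<in> R" by (intro single_in_mpolys keys_evens_odds)

lemma linked_add:
  assumes "p \<in> linked" "q \<in> linked"
  shows "p + q \<in> linked"
proof -
  obtain \<alpha> \<beta> \<alpha>' \<beta>' where *: "p \<in> R" "q \<in> R" "\<alpha> \<in> R" "\<beta> \<in> R" "\<alpha>' \<in> R" "\<beta>' \<in> R"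
    "p - (\<alpha> * mon (expo (x_index 1)) + \<beta> * mon (evens half)) \<in> C (n - 1)"
    "q - (\<alpha>' * mon (expo (x_index 1)) + \<beta>' * mon (evens half)) \<in> C (n - 1)"
    using assms by (auto simp: linked_def)
  have "p + q - ((\<alpha> + \<alpha>') * mon (expo (x_index 1)) + (\<beta> + \<beta>') * mon (evens half)) =
    (p - (\<alpha> * mon (expo (x_index 1)) + \<beta> * mon (evens half))) +
    (q - (\<alpha>' * mon (expo (x_index 1)) + \<beta>' * mon (evens half)))"
    by (simp add: algebra_simps)
  also have "\<dots> \<in> C (n - 1)" using * by (intro C_closed(4))
  finally have "p + q - ((\<alpha> + \<alpha>') * mon (expo (x_index 1)) + (\<beta> + \<beta>') * mon (evens half)) \<in> C (n - 1)" .
  then show ?thesis using * unfolding linked_def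
    by (intro CollectI conjI bexI[of _ "\<alpha> + \<alpha>'"] bexI[of _ "\<beta> + \<beta>'"] mpolys_add)
qed

lemma linked_mult:
  assumes "p \<in> linked" "r \<in> R"
  shows "r * p \<in> linked"
proof -
  obtain \<alpha> \<beta> where *: "p \<in> R" "\<alpha> \<in> R" "\<beta> \<in> R"
    "p - (\<alpha> * mon (expo (x_index 1)) + \<beta> * mon (evens half)) \<in> C (n - 1)"
    using assms by (auto simp: linked_def)
  have "r * p - ((r * \<alpha>) * mon (expo (x_index 1)) + (r * \<beta>) * mon (evens half)) =
    r * (p - (\<alpha> * mon (expo (x_index 1)) + \<beta> * mon (evens half)))"
    by (simp add: algebra_simps)
  also have "\<dots> \<in> C (n - 1)" using * assms(2) by (intro C_closed(5))
  finally have "r * p - ((r * \<alpha>) * mon (expo (x_index 1)) + (r * \<beta>) * mon (evens half)) \<in> C (n - 1)" .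
  then show ?thesis using * assms(2) unfolding linked_def
    by (intro CollectI conjI bexI[of _ "r * \<alpha>"] bexI[of _ "r * \<beta>"] mpolys_mult)
qed

lemma C_subset_linked: "C (n - 1) \<subseteq> linked"
  using C_closed(1) unfolding linked_def
  by (auto intro!: bexI[of _ 0])

lemma x1_linked: "mon (expo (x_index 1)) \<in> linked"
  unfolding linked_def
  by (intro CollectI conjI x1_in_R, rule bexI[of _ 1], rule bexI[of _ 0]) (simp_all add: C_closed(2))

lemma h_linked: "mon (evens half) \<in> linked"
  unfolding linked_def
  by (intro CollectI conjI h_in_R, rule bexI[of _ 0], rule bexI[of _ 1]) (simp_all add: C_closed(2))

lemma linked_sum: "(\<And>i. i \<in> I \<Longrightarrow> f i \<in> linked) \<Longrightarrow> sum f I \<in> linked"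
  by (induction I rule: infinite_finite_induct)
    (auto intro: linked_add subsetD[OF C_subset_linked] C_closed(2))

text \<open>
  The products \<open>X\<^sub>a\<^sub>+\<^sub>1 X\<^sub>a Y\<^sub>a\<close> telescope, so the sum of all \<open>X\<^sub>a\<^sub>+\<^sub>1 (X\<^sub>a Y\<^sub>a - X\<^sub>a\<^sub>+\<^sub>2 Y\<^sub>a\<^sub>+\<^sub>1)\<close> around the
  cycle is zero.
\<close>

lemma x1_rel0: "mon (expo (x_index 1)) * rel 0 \<in> C (n - 1)"
proof -
  define T where "T a = (mon (expo (x_index (a + 1)) + expo (x_index a) + expo (y_index a)) :: 'k mpoly)" for a
  have T: "mon (expo (x_index (a + 1))) * rel a = T a - T (Suc a)" for a
    by (simp add: T_def rel_def lhs_def rhs_def right_diff_distrib mult_single ac_simps)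
  have "(\<Sum>a<n. mon (expo (x_index (a + 1))) * rel a) = T 0 - T n"
    unfolding T by (rule sum_lessThan_telescope')
  also have "T n = T 0" by (simp add: T_def x_index_n y_index_n)
  finally have sum0: "(\<Sum>a<n. mon (expo (x_index (a + 1))) * rel a) = (0 :: 'k mpoly)" by simp
  have "{..<n} = insert 0 {1..<n}" using n_gt_1 by auto
  then have "(\<Sum>a<n. mon (expo (x_index (a + 1))) * rel a) =
     mon (expo (x_index 1)) * rel 0 + (\<Sum>a\<in>{1..<n}. mon (expo (x_index (a + 1))) * rel a :: 'k mpoly)"
    by simp
  then have "mon (expo (x_index 1)) * rel 0 = - (\<Sum>a\<in>{1..<n}. mon (expo (x_index (a + 1))) * rel a :: 'k mpoly)"
    using sum0 by (simp add: add_eq_0_iff2)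
  also have "\<dots> \<in> C (n - 1)"
    by (intro C_closed(6) mpolys.ideal_sum[OF ideal_C] C_closed(5) rel_in_C single_in_mpolys keys_expo) auto
  finally show ?thesis .
qed

text \<open>
  The odd chain applies to the term \<open>X\<^sub>0 Y\<^sub>0\<close> of the relation because \<open>X\<^sub>0 = X\<^sub>n\<close> and \<open>n\<close> is odd, the
  even chain applies to \<open>X\<^sub>2 Y\<^sub>1\<close>, and both end in \<open>X\<^sub>1 Y\<^sub>0 Y\<^sub>1 Y\<^sub>3 ... Y\<^sub>n\<^sub>-\<^sub>2\<close>.
\<close>

lemma h_rel0: "mon (evens half) * rel 0 \<in> C (n - 1)"
proof -
  let ?y = "expo (y_index 0)"
  have x: "x_index (2 * half + 1) = x_index 0" using x_index_n n_half by simp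
  have 1: "mon (expo (x_index 0) + evens half + ?y) - mon (expo (x_index 1) + odds half + ?y) \<in> C (n - 1)"
    using odd_chain[of half] n_half unfolding x by (intro C_mon_add keys_expo) simp
  have 2: "mon (expo (x_index 2) + expo (y_index 1) + evens half) -
      mon (expo (x_index (2 * half + 2)) + odds (Suc half)) \<in> C (n - 1)"
    using n_half by (intro even_chain) simp
  have eq: "expo (x_index (2 * half + 2)) + odds (Suc half) = expo (x_index 1) + odds half + ?y"
    using x_index_n y_index_n n_half by (simp add: odds_Suc add.assoc)
  from C_trans[OF 1 C_sym[OF 2[unfolded eq]]] show ?thesis
    by (simp add: rel_def lhs_def rhs_def right_diff_distrib mult_single ac_simps numeral_2_eq_2)
qed

lemma linked_rel0:
  assumes "p \<in> linked"
  shows "p * rel 0 \<in> C (n - 1)"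
proof -
  obtain \<alpha> \<beta> where *: "\<alpha> \<in> R" "\<beta> \<in> R"
    "p - (\<alpha> * mon (expo (x_index 1)) + \<beta> * mon (evens half)) \<in> C (n - 1)"
    using assms by (auto simp: linked_def)
  have "p * rel 0 = rel 0 * (p - (\<alpha> * mon (expo (x_index 1)) + \<beta> * mon (evens half))) +
    (\<alpha> * (mon (expo (x_index 1)) * rel 0) + \<beta> * (mon (evens half) * rel 0))"
    by (simp add: algebra_simps)
  also have "\<dots> \<in> C (n - 1)"
    by (intro C_closed(4) C_closed(5) * rel_in_R x1_rel0 h_rel0)
  finally show ?thesis .
qed

text \<open>
  The monomials that the odd chains and the two generators put into the linked ideal.
\<close>

definition linked_mon :: "(nat \<Rightarrow>\<^sub>0 nat) \<Rightarrow> bool" where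
  "linked_mon m \<longleftrightarrow> (\<exists>j<half. mon_dvd (expo (x_index (2 * j + 1)) + evens j) m) \<or> mon_dvd (evens half) m"

lemma linked_mon_in_linked:
  assumes "linked_mon m" "keys m \<subseteq> {..<2 * n}"
  shows "mon m \<in> linked"
  using assms(1) unfolding linked_mon_def
proof
  assume "mon_dvd (evens half) m"
  then obtain r where r: "m = evens half + r" by (auto simp: mon_dvd_def)
  then have "mon r \<in> R" using assms(2) by (intro single_in_mpolys) (auto simp: keys_plus_nat)
  then have "mon r * mon (evens half) \<in> linked" by (intro linked_mult h_linked)
  then show ?thesis by (simp add: mult_single r add.commute)
next
  assume "\<exists>j<half. mon_dvd (expo (x_index (2 * j + 1)) + evens j) m"
  then obtain j r where j: "j < half" and r: "m = expo (x_index (2 * j + 1)) + evens j + r"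
    by (auto simp: mon_dvd_def)
  have kr: "keys r \<subseteq> {..<2 * n}" using assms(2) by (auto simp: r keys_plus_nat)
  have "mon m - mon (expo (x_index 1) + odds j + r) \<in> C (n - 1)"
    unfolding r using j n_half by (intro C_mon_add odd_chain kr) simp
  moreover have "mon (odds j + r) * mon (expo (x_index 1)) \<in> linked"
    using kr keys_evens_odds by (intro linked_mult x1_linked single_in_mpolys) (auto simp: keys_plus_nat)
  moreover have "mon (odds j + r) * mon (expo (x_index 1)) = (mon (expo (x_index 1) + odds j + r) :: 'k mpoly)"
    by (simp add: mult_single ac_simps)
  ultimately have "(mon m - mon (expo (x_index 1) + odds j + r)) + mon (expo (x_index 1) + odds j + r) \<in> linked"
    using C_subset_linked by (intro linked_add) auto
  then show "mon m \<in> linked" by simp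
qed

lemma mon_dvd_evens:
  assumes "\<And>i. i < l \<Longrightarrow> y_index (2 * i + 2) \<in> keys m" "2 * l < n"
  shows "mon_dvd (evens l) m"
  using assms
proof (induction l)
  case (Suc l)
  have "y_index (2 * l + 2) \<notin> keys (evens l)"
    using Suc.prems(2) by (auto simp: keys_evens y_index_eq_iff)
  then show ?case unfolding evens_Suc using Suc by (intro mon_dvd_add_expo) auto
qed (simp add: mon_dvd_0)

text \<open>
  An irreducible monomial \<open>m\<close> outside the linked ideal is divisible by \<open>Y\<^sub>2 Y\<^sub>4 ... Y\<^sub>2\<^sub>l\<close> for some
  \<open>l\<close> but not by \<open>Y\<^sub>2\<^sub>l\<^sub>+\<^sub>2\<close>. The chain of rewriting steps from \<open>X\<^sub>2 Y\<^sub>1 m\<close> uses up these factors and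
  stops before the rule with index \<open>n - 1\<close>, the only one that creates \<open>Y\<^sub>0\<close>.
\<close>

lemma normal_form_outside_linked:
  assumes irr: "monomial_rewriting.irreducible_mon {Suc 0..n - 1} lhs m"
    and not_linked: "\<not> linked_mon m" and keys_m: "keys m \<subseteq> {..<2 * n}"
  shows "lookup (monomial_rewriting.normal_form {Suc 0..n - 1} lhs rhs (m + rhs 0)) (y_index 0) = lookup m (y_index 0)"
proof -
  interpret monomial_rewriting "{Suc 0..n - 1}" lhs rhs weight by (rule rewriting) simp
  have irr': "\<not> (x_index a \<in> keys m \<and> y_index a \<in> keys m)" if "a \<in> {Suc 0..n - 1}" for a
    using irr that unfolding irreducible_mon_def mon_dvd_lhs by blast
  have "\<exists>l. l < half \<and> y_index (2 * l + 2) \<notin> keys m"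
  proof (rule ccontr)
    assume "\<not> ?thesis"
    then have "mon_dvd (evens half) m" using n_half by (intro mon_dvd_evens) auto
    then show False using not_linked by (simp add: linked_mon_def)
  qed
  then obtain l where l: "l < half" "y_index (2 * l + 2) \<notin> keys m"
    and least: "\<And>i. i < l \<Longrightarrow> y_index (2 * i + 2) \<in> keys m"
    using exists_least_iff[of "\<lambda>l. l < half \<and> y_index (2 * l + 2) \<notin> keys m"] by (meson less_trans)
  have dvd: "mon_dvd (evens i) m" if "i \<le> l" for i
    using that l(1) n_half least by (intro mon_dvd_evens) auto
  obtain r where r: "m = evens l + r" using dvd[of l] by (auto simp: mon_dvd_def)
  define k where "k = expo (x_index (2 * l + 2)) + odds (Suc l) + r"
  have kr: "keys r \<subseteq> {..<2 * n}" "keys r \<subseteq> keys m" using keys_m by (auto simp: r keys_plus_nat)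
  have "mon (expo (x_index 2) + expo (y_index 1) + evens l + r) - mon k \<in> (C (n - 1) :: 'k mpoly set)"
    unfolding k_def using l(1) n_half by (intro C_mon_add even_chain kr) simp
  moreover have "expo (x_index 2) + expo (y_index 1) + evens l + r = m + rhs 0"
    by (simp add: r rhs_def ac_simps numeral_2_eq_2)
  ultimately have mk: "mon (m + rhs 0) - mon k \<in> (C (n - 1) :: 'k mpoly set)" by simp
  have "irreducible_mon k"
    unfolding irreducible_mon_def mon_dvd_lhs
  proof (intro ballI notI, elim conjE)
    fix a assume a: "a \<in> {Suc 0..n - 1}" and x: "x_index a \<in> keys k" and y: "y_index a \<in> keys k"
    have an: "a < n" using a n_gt_1 by auto
    have x': "x_index a \<in> keys m \<or> a = 2 * l + 2"
      using x kr(2) an l(1) n_half by (auto simp: k_def keys_plus_nat keys_odds x_index_eq_iff)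
    have y': "y_index a \<in> keys m \<or> (\<exists>i\<le>l. a = 2 * i + 1)"
      using y kr(2) an l(1) n_half by (auto simp: k_def keys_plus_nat keys_odds y_index_eq_iff less_Suc_eq_le)
    show False
    proof (cases "\<exists>i\<le>l. a = 2 * i + 1")
      case True
      then obtain i where i: "i \<le> l" "a = 2 * i + 1" by blast
      then have "x_index (2 * i + 1) \<in> keys m" using x' by presburger
      then have "mon_dvd (evens i + expo (x_index (2 * i + 1))) m"
        using dvd[OF i(1)] by (intro mon_dvd_add_expo) (auto simp: keys_evens)
      then show False using not_linked i(1) l(1) by (auto simp: linked_mon_def add.commute)
    next
      case False
      then have "y_index a \<in> keys m" using y' by blast
      then show False using x' irr'[OF a] l(2) by auto
    qed
  qed
  then have "normal_form (m + rhs 0) = k" using normal_form_eqI_C[OF _ mk] by simp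
  moreover have "lookup k (y_index 0) = lookup m (y_index 0)"
  proof -
    have "y_index 0 \<notin> keys (evens l)" "y_index 0 \<notin> keys (odds (Suc l))"
      using l(1) n_half n_gt_1 by (auto simp: keys_evens keys_odds y_index_eq_iff)
    then show ?thesis by (simp add: k_def r lookup_add lookup_single in_keys_iff)
  qed
  ultimately show ?thesis by simp
qed

text \<open>
  Terms in the linked ideal can be removed from the normal form of \<open>v\<close>. On the remaining terms,
  multiplication by \<open>X\<^sub>0 Y\<^sub>0\<close> preserves irreducibility and raises the exponent of \<open>Y\<^sub>0\<close>, while
  multiplication by \<open>X\<^sub>2 Y\<^sub>1\<close> and reduction leaves that exponent unchanged.
\<close>

lemma colon_rel0:
  assumes v: "v \<in> R" and zero: "v * rel 0 \<in> C (n - 1)"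
  shows "v \<in> linked"
proof -
  have le: "n - 1 \<le> n - 1" by simp
  interpret monomial_rewriting "{Suc 0..n - 1}" lhs rhs weight by (rule rewriting) simp
  define v' where "v' = normal_form_poly v"
  have v'R: "v' \<in> R" unfolding v'_def by (rule normal_form_poly_in_R[OF le v])
  define part where "part X = (\<Sum>m\<in>keys v' \<inter> X. Poly_Mapping.single m (lookup v' m))" for X
  define w where "w = part {m. \<not> linked_mon m}"
  have lookup_part: "lookup (part X) m = (if m \<in> X then lookup v' m else 0)" for X m
    unfolding part_def lookup_sum lookup_single by (auto simp: when_def in_keys_iff sum.delta')
  have "v' = part {m. linked_mon m} + w"
    unfolding w_def by (rule poly_mapping_eqI) (simp add: lookup_add lookup_part)
  moreover have "part {m. linked_mon m} \<in> linked"
    unfolding part_def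
  proof (rule linked_sum)
    fix m assume m: "m \<in> keys v' \<inter> {m. linked_mon m}"
    then have "const (lookup v' m) * mon m \<in> linked"
      using keys_in_mpolys[OF v'R] by (intro linked_mult linked_mon_in_linked const_in_mpolys) auto
    then show "Poly_Mapping.single m (lookup v' m) \<in> linked" by (simp add: const_def mult_single)
  qed
  moreover have "v - v' \<in> linked"
    using diff_normal_form_poly_in_C[OF le v] C_subset_linked unfolding v'_def by blast
  ultimately have vw: "v - w \<in> linked"
    using linked_add[of "v - v'" "part {m. linked_mon m}"] by (simp add: algebra_simps)
  have lookup_w: "lookup w m = (if linked_mon m then 0 else lookup v' m)" for m
    by (simp add: w_def lookup_part)
  have "w * rel 0 = v * rel 0 - (v - w) * rel 0" by (simp add: algebra_simps)
  also have "\<dots> \<in> C (n - 1)" by (intro C_closed(3) zero linked_rel0 vw)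
  finally have zero': "normal_form_poly (w * (mon (lhs 0) - mon (rhs 0))) = 0"
    unfolding rel_def by (rule normal_form_poly_C[OF le])
  have "w = 0"
  proof (rule binomial_multiple_zero[OF zero'])
    fix m assume m: "m \<in> keys w"
    then have m': "m \<in> keys v'" "\<not> linked_mon m" by (auto simp: in_keys_iff lookup_w split: if_splits)
    have irr: "irreducible_mon m" using m'(1) unfolding v'_def by (rule keys_normal_form_poly)
    show "irreducible_mon (m + lhs 0)"
      unfolding irreducible_mon_def mon_dvd_lhs
    proof
      fix a assume a: "a \<in> {Suc 0..n - 1}"
      then have "a < n" "0 < n" "a \<noteq> 0" using n_gt_1 by auto
      then have "x_index a \<noteq> x_index 0" "y_index a \<noteq> y_index 0"
        by (simp_all add: x_index_eq_iff y_index_eq_iff del: x_index_eq_iff[of _ 0])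
      moreover have "\<not> (x_index a \<in> keys m \<and> y_index a \<in> keys m)"
        using irr a unfolding irreducible_mon_def mon_dvd_lhs by blast
      ultimately show "\<not> (x_index a \<in> keys (m + lhs 0) \<and> y_index a \<in> keys (m + lhs 0))"
        by (auto simp: keys_plus_nat lhs_def)
    qed
  next
    show "lookup (m + lhs 0) (y_index 0) = lookup m (y_index 0) + 1" for m
      by (simp add: lookup_add lhs_def lookup_single)
  next
    fix m assume "m \<in> keys w"
    then have m': "m \<in> keys v'" "\<not> linked_mon m" by (auto simp: in_keys_iff lookup_w split: if_splits)
    have irr: "irreducible_mon m" using m'(1) unfolding v'_def by (rule keys_normal_form_poly)
    have "lookup (normal_form (m + rhs 0)) (y_index 0) = lookup m (y_index 0)"
      by (rule normal_form_outside_linked[OF irr m'(2) keys_in_mpolys[OF v'R m'(1)]])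
    then show "lookup (normal_form (m + rhs 0)) (y_index 0) < lookup m (y_index 0) + 1" by simp
  qed
  then show ?thesis using vw by simp
qed

end

section \<open>Evaluation\<close>

locale algebra_map =
  fixes \<iota> :: "'k::comm_ring_1 \<Rightarrow> 'r::comm_ring_1"
  assumes map_add: "\<iota> (a + b) = \<iota> a + \<iota> b" and map_mult: "\<iota> (a * b) = \<iota> a * \<iota> b" and map_one: "\<iota> 1 = 1"
begin

lemma map_zero: "\<iota> 0 = 0" using map_add[of 0 0] by simp

lemma evaluate_zero [simp]: "evaluate \<iota> g 0 = 0" by (simp add: evaluate_def)

lemma evaluate_single:
  "evaluate \<iota> g (Poly_Mapping.single m c) = \<iota> c * (\<Prod>i\<in>keys m. g i ^ lookup m i)"
  by (simp add: evaluate_def map_zero)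

lemma evaluate_add: "evaluate \<iota> g (p + q) = evaluate \<iota> g p + evaluate \<iota> g q"
  unfolding evaluate_def by (rule setsum_keys_plus_distrib) (auto simp: map_zero map_add distrib_right)

lemma evaluate_diff: "evaluate \<iota> g (p - q) = evaluate \<iota> g p - evaluate \<iota> g q"
  using evaluate_add[of g "p - q" q] by simp

lemma evaluate_sum: "evaluate \<iota> g (sum f X) = (\<Sum>x\<in>X. evaluate \<iota> g (f x))"
  by (induction X rule: infinite_finite_induct) (auto simp: evaluate_add)

lemma prod_powers_superset:
  fixes g :: "nat \<Rightarrow> 'r"
  assumes "finite A" "keys m \<subseteq> A"
  shows "(\<Prod>i\<in>keys m. g i ^ lookup m i) = (\<Prod>i\<in>A. g i ^ lookup m i)"
  using assms by (intro prod.mono_neutral_left) (auto simp: in_keys_iff)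

lemma prod_powers_add:
  fixes g :: "nat \<Rightarrow> 'r"
  shows "(\<Prod>i\<in>keys (m + k). g i ^ lookup (m + k) i) =
    (\<Prod>i\<in>keys m. g i ^ lookup m i) * (\<Prod>i\<in>keys k. g i ^ lookup k i)"
  using prod_powers_superset[of "keys m \<union> keys k" m g] prod_powers_superset[of "keys m \<union> keys k" k g]
  by (simp add: keys_plus_nat lookup_add power_add prod.distrib)

lemma evaluate_mult: "evaluate \<iota> g (p * q) = evaluate \<iota> g p * evaluate \<iota> g q"
proof (induction p rule: mpoly_additive_induct)
  case (single m c)
  show ?case
  proof (induction q rule: mpoly_additive_induct)
    case (single k d)
    then show ?case
      by (simp add: mult_single evaluate_single prod_powers_add map_mult ac_simps)
  qed (simp_all add: distrib_left evaluate_add)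
qed (simp_all add: distrib_right evaluate_add)

lemma evaluate_var: "evaluate \<iota> g (var i) = g i"
  by (simp add: var_def evaluate_single map_one)

lemma evaluate_const: "evaluate \<iota> g (const c) = \<iota> c"
  by (simp add: const_def evaluate_single)

lemma evaluate_one: "evaluate \<iota> g 1 = 1"
  using evaluate_const[of g 1] by (simp add: const_def map_one)

end

global_interpretation coeffs: algebra_map "\<lambda>c :: 'k::comm_ring_1. [:const c:]"
  by unfold_locales (simp_all add: const_def single_add mult_single one_pCons mult.commute)

lemma path_monomial_eq: "path_monomial n t j = mon (\<Sum>i<t. expo ((j + i) mod n))"
  unfolding path_monomial_def by (induction t) (simp_all add: var_def mult_single)

lemma poly_monom_mon_eq_iff:
  "Polynomial.monom (mon m) d = (Polynomial.monom (mon k) e :: 'k::field mpoly poly) \<longleftrightarrow> m = k \<and> d = e"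
proof
  assume eq: "Polynomial.monom (mon m) d = (Polynomial.monom (mon k) e :: 'k mpoly poly)"
  have "(mon m :: 'k mpoly) \<noteq> 0" by (metis lookup_single_eq lookup_zero zero_neq_one)
  then have "d = e" using arg_cong[OF eq, of "\<lambda>p. Polynomial.coeff p d"] by (auto split: if_splits)
  then have "(mon m :: 'k mpoly) = mon k" using eq by (simp add: monom_eq_iff)
  then have "m = k" by (metis keys_single singleton_inject zero_neq_one)
  with \<open>d = e\<close> show "m = k \<and> d = e" by simp
qed simp

text \<open>
  The sign pattern of the difference of the \<open>Y\<close>-exponents of two irreducible monomials with the
  same image: entries alternate in sign and do not grow, so that the sums of the entries \<open>2 i\<close> and
  \<open>2 i + 1\<close> are nonnegative. As the total is zero, the entries of each such pair cancel, and the
  first zero has an even index.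
\<close>

lemma alternating_sequence:
  fixes s :: "nat \<Rightarrow> int"
  assumes pos: "s 0 > 0"
    and down: "\<And>a. a < 2 * h \<Longrightarrow> s (Suc a) > 0 \<Longrightarrow> s (Suc a) + s a \<le> 0"
    and up: "\<And>a. a < 2 * h \<Longrightarrow> s (Suc a) < 0 \<Longrightarrow> s (Suc a) + s a \<ge> 0"
    and sum: "(\<Sum>a<2 * h + 1. s a) = 0"
  shows "\<exists>j<h. s (2 * j + 2) = 0 \<and> (\<forall>i\<le>j. s (2 * i + 1) < 0)"
proof -
  have odd: "s (2 * i + 1) \<le> 0 \<and> s (2 * i) + s (2 * i + 1) \<ge> 0" if "i < h" "s (2 * i) \<ge> 0" for i
    using down[of "2 * i"] up[of "2 * i"] that by force
  have even: "s (2 * i) \<ge> 0" if "i \<le> h" for i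
    using that
  proof (induction i)
    case (Suc i)
    then have "s (2 * i + 1) \<le> 0" using odd by simp
    then show ?case using up[of "2 * i + 1"] Suc.prems by force
  qed (use pos in simp)
  have "(\<Sum>a<2 * h + 1. s a) = s (2 * h) + (\<Sum>i<h. s (2 * i) + s (2 * i + 1))"
    by (induction h) auto
  moreover have nonneg: "\<And>i. i < h \<Longrightarrow> s (2 * i) + s (2 * i + 1) \<ge> 0" using odd even by simp
  moreover have "(\<Sum>i<h. s (2 * i) + s (2 * i + 1)) \<ge> 0" using nonneg by (intro sum_nonneg) auto
  ultimately have z: "s (2 * h) = 0" "(\<Sum>i<h. s (2 * i) + s (2 * i + 1)) = 0"
    using sum even[of h] by linarith+
  have pair: "s (2 * i + 1) = - s (2 * i)" if "i < h" for i
    using z(2) nonneg that sum_nonneg_eq_0_iff[of "{..<h}" "\<lambda>i. s (2 * i) + s (2 * i + 1)"] by force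
  define l where "l = (LEAST l. s (2 * l) = 0)"
  have l: "s (2 * l) = 0" unfolding l_def by (rule LeastI[of "\<lambda>l. s (2 * l) = 0" h]) (rule z(1))
  have lh: "l \<le> h" unfolding l_def by (rule Least_le) (rule z(1))
  have nz: "s (2 * i) \<noteq> 0" if "i < l" for i using not_less_Least[of i "\<lambda>l. s (2 * l) = 0"] that by (simp add: l_def)
  have "l \<noteq> 0" using l pos by (metis less_irrefl mult_0_right)
  then obtain j where j: "l = Suc j" by (cases l) auto
  have "s (2 * i + 1) < 0" if "i \<le> j" for i
    using pair[of i] even[of i] nz[of i] that j lh by force
  then show ?thesis using l lh j by (intro exI[of _ j]) auto
qed

context odd_cycle
begin

section \<open>The presentation of the Rees algebra\<close>

abbreviation gens :: "'k mpoly poly list" where "gens \<equiv> rees_generators n (n - 2)"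

abbreviation ev :: "'k mpoly \<Rightarrow> 'k mpoly poly" where
  "ev \<equiv> evaluate (\<lambda>c. [:const c:]) ((!) gens)"

definition path_exponent :: "nat \<Rightarrow> nat \<Rightarrow>\<^sub>0 nat" where
  "path_exponent j = (\<Sum>i<n - 2. expo ((j + i) mod n))"

lemma length_gens [simp]: "length gens = 2 * n" by (simp add: rees_generators_def)

lemma gens_nth:
  "i < n \<Longrightarrow> gens ! i = Polynomial.monom (mon (expo i)) 0"
  "j < n \<Longrightarrow> gens ! (n + j) = Polynomial.monom (mon (path_exponent j)) 1"
  by (auto simp: rees_generators_def nth_append var_def monom_0 path_monomial_eq path_exponent_def)

definition y_degree :: "(nat \<Rightarrow>\<^sub>0 nat) \<Rightarrow> nat" where
  "y_degree m = (\<Sum>j<n. lookup m (n + j))"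

definition x_exponent :: "(nat \<Rightarrow>\<^sub>0 nat) \<Rightarrow> nat \<Rightarrow> nat" where
  "x_exponent m i = lookup m i + (\<Sum>j<n. lookup m (n + j) * lookup (path_exponent j) i)"

definition x_image :: "(nat \<Rightarrow>\<^sub>0 nat) \<Rightarrow> nat \<Rightarrow>\<^sub>0 nat" where
  "x_image m = (\<Sum>i<n. Poly_Mapping.single i (x_exponent m i))"

lemma lookup_x_image: "i < n \<Longrightarrow> lookup (x_image m) i = x_exponent m i"
  by (simp add: x_image_def lookup_sum lookup_single when_def)

lemma lookup_x_image_ge: "n \<le> i \<Longrightarrow> lookup (x_image m) i = 0"
  by (simp add: x_image_def lookup_sum lookup_single when_def)

lemma keys_path_exponent: "keys (path_exponent j) \<subseteq> {..<n}"
  unfolding path_exponent_def using n_gt_1 by (intro keys_subset_of_sum) auto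

lemma x_image_eqI:
  assumes "keys k \<subseteq> {..<n}" "\<And>i. i < n \<Longrightarrow> x_exponent m i = lookup k i"
  shows "x_image m = k"
proof (rule poly_mapping_eqI)
  fix i
  show "lookup (x_image m) i = lookup k i"
  proof (cases "i < n")
    case False
    then have "i \<notin> keys k" using assms(1) by auto
    then show ?thesis using False by (simp add: lookup_x_image_ge in_keys_iff)
  qed (simp add: lookup_x_image assms(2))
qed

lemma x_image_add: "x_image (m + k) = x_image m + x_image k"
  by (auto simp: x_image_def x_exponent_def lookup_add distrib_right sum.distrib single_add algebra_simps)

lemma y_degree_add: "y_degree (m + k) = y_degree m + y_degree k"
  by (simp add: y_degree_def lookup_add sum.distrib)

lemma image_of_x: "i < n \<Longrightarrow> x_image (expo i) = expo i" "i < n \<Longrightarrow> y_degree (expo i) = 0"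
  by (auto simp: y_degree_def x_exponent_def lookup_single when_def intro!: x_image_eqI)

lemma image_of_y:
  assumes "j < n"
  shows "x_image (expo (n + j)) = path_exponent j" "y_degree (expo (n + j)) = 1"
proof -
  have sum: "(\<Sum>k<n. lookup (expo (n + j)) (n + k) * f k) = f j" for f :: "nat \<Rightarrow> nat"
  proof -
    have "(\<Sum>k<n. lookup (expo (n + j)) (n + k) * f k) = (\<Sum>k<n. if k = j then f k else 0)"
      by (intro sum.cong) (auto simp: lookup_single when_def)
    then show ?thesis using assms by simp
  qed
  show "x_image (expo (n + j)) = path_exponent j"
    by (rule x_image_eqI[OF keys_path_exponent], unfold x_exponent_def sum) (simp add: lookup_single)
  show "y_degree (expo (n + j)) = 1"
    using sum[of "\<lambda>_. 1"] unfolding y_degree_def mult_1_right .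
qed

lemma ev_mon:
  assumes "keys m \<subseteq> {..<2 * n}"
  shows "ev (mon m) = Polynomial.monom (mon (x_image m)) (y_degree m)"
  using assms
proof (induction "monomial_degree m" arbitrary: m rule: less_induct)
  case less
  show ?case
  proof (cases "m = 0")
    case True
    then show ?thesis
      by (simp add: coeffs.evaluate_one x_image_def x_exponent_def y_degree_def monom_0 one_pCons)
  next
    case False
    then obtain i where i: "i \<in> keys m" by (metis all_not_in_conv in_keys_iff lookup_zero poly_mapping_eqI)
    then obtain r where r: "m = expo i + r" using mon_dvd_expo[of i m] by (auto simp: mon_dvd_def)
    have "monomial_degree r < monomial_degree m" by (simp add: r monomial_degree_add)
    moreover have "keys r \<subseteq> {..<2 * n}" using less.prems by (auto simp: r keys_plus_nat)
    ultimately have IH: "ev (mon r) = Polynomial.monom (mon (x_image r)) (y_degree r)" using less.hyps by blast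
    have "i < 2 * n" using i less.prems by auto
    then have gi: "gens ! i = Polynomial.monom (mon (x_image (expo i))) (y_degree (expo i))"
      using gens_nth(1)[of i] gens_nth(2)[of "i - n"] image_of_x[of i] image_of_y[of "i - n"]
      by (cases "i < n") auto
    have "ev (mon m) = ev (mon (expo i) * mon r)" by (simp add: r mult_single)
    also have "\<dots> = gens ! i * ev (mon r)"
      using coeffs.evaluate_var[of "(!) gens" i] by (simp add: coeffs.evaluate_mult var_def)
    also have "\<dots> = Polynomial.monom (mon (x_image m)) (y_degree m)"
      unfolding IH gi by (simp add: mult_monom mult_single r x_image_add y_degree_add)
    finally show ?thesis .
  qed
qed

lemma ev_mon_eq_iff:
  assumes "keys m \<subseteq> {..<2 * n}" "keys k \<subseteq> {..<2 * n}"
  shows "ev (mon m) = ev (mon k) \<longleftrightarrow> x_image m = x_image k \<and> y_degree m = y_degree k"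
  by (simp add: ev_mon assms poly_monom_mon_eq_iff)

lemma path_exponent_complement:
  "path_exponent a + expo (x_index a) + expo (x_index (a + 1)) = (\<Sum>i<n. expo i)"
proof -
  have n: "Suc (Suc (n - 2)) = n" using n_ge_3 by simp
  have "a + n - 2 = a + (n - 2)" "a + 1 + n - 2 = a + Suc (n - 2)" using n_ge_3 by linarith+
  then have x: "x_index a = (a + (n - 2)) mod n" "x_index (a + 1) = (a + Suc (n - 2)) mod n"
    by (simp_all only: x_index_def)
  have "path_exponent a + expo (x_index a) + expo (x_index (a + 1)) = (\<Sum>i<Suc (Suc (n - 2)). expo ((a + i) mod n))"
    by (simp only: path_exponent_def x sum.lessThan_Suc)
  also have "\<dots> = (\<Sum>i<n. expo ((a + i) mod n))" by (simp only: n)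
  also have "\<dots> = (\<Sum>i<n. expo i)"
  proof (rule sum.reindex_bij_betw)
    have "inj_on (\<lambda>i. (a + i) mod n) {..<n}"
    proof (rule inj_onI)
      fix i j assume ij: "i \<in> {..<n}" "j \<in> {..<n}" "(a + i) mod n = (a + j) mod n"
      then have "[a + i = a + j] (mod n)" by (simp add: cong_def)
      then have "[i = j] (mod n)" by (simp add: cong_add_lcancel_nat)
      then show "i = j" using ij by (simp add: cong_def)
    qed
    moreover have "(\<lambda>i. (a + i) mod n) ` {..<n} \<subseteq> {..<n}" using n_gt_1 by auto
    ultimately show "bij_betw (\<lambda>i. (a + i) mod n) {..<n} {..<n}"
      by (simp add: bij_betw_def endo_inj_surj)
  qed
  finally show ?thesis .
qed

lemma path_exponent_mod: "path_exponent (a mod n) = path_exponent a"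
  by (simp add: path_exponent_def mod_simps)

lemma image_of_y_index: "x_image (expo (y_index a)) = path_exponent a" "y_degree (expo (y_index a)) = 1"
  using image_of_y[of "a mod n"] n_gt_1 by (simp_all add: y_index_def path_exponent_mod)

lemma ev_rel: "ev (rel a) = 0"
proof -
  have image: "x_image (lhs a) = path_exponent a + expo (x_index a)"
    "x_image (rhs a) = path_exponent (a + 1) + expo (x_index (a + 2))"
    by (simp_all add: lhs_def rhs_def x_image_add image_of_y_index image_of_x x_index_less add.commute)
  have "path_exponent (a + 1) + expo (x_index (a + 1)) + expo (x_index (a + 2)) = (\<Sum>i<n. expo i)"
    using path_exponent_complement[of "a + 1"] by simp
  then have "path_exponent a + expo (x_index a) + expo (x_index (a + 1)) =
      path_exponent (a + 1) + expo (x_index (a + 2)) + expo (x_index (a + 1))"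
    unfolding path_exponent_complement by (simp only: ac_simps)
  then have "x_image (lhs a) + expo (x_index (a + 1)) = x_image (rhs a) + expo (x_index (a + 1))"
    unfolding image .
  then have "x_image (lhs a) = x_image (rhs a)" by simp
  moreover have "y_degree (lhs a) = y_degree (rhs a)"
    by (simp add: lhs_def rhs_def y_degree_add image_of_y_index image_of_x x_index_less)
  ultimately have "ev (mon (lhs a)) = ev (mon (rhs a))" using ev_mon_eq_iff keys_lhs_rhs by blast
  then show ?thesis by (simp add: rel_def coeffs.evaluate_diff)
qed

lemma ev_C: "p \<in> C i \<Longrightarrow> ev p = 0"
  unfolding C_def
proof (induction i arbitrary: p)
  case (Suc i)
  obtain p' q where "p = p' + q * rels i" "p' \<in> mpolys.partial_ideal (2 * n) rels i"
    using Suc.prems by (rule mpolys.partial_ideal_SucE)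
  then show ?case using Suc.IH by (simp add: coeffs.evaluate_add coeffs.evaluate_mult ev_rel)
qed simp

text \<open>
  \<open>Y\<^sub>b\<close> contributes \<open>1\<close> to the exponent of every variable except \<open>X\<^sub>b\<close> and \<open>X\<^sub>b\<^sub>+\<^sub>1\<close>.
\<close>

lemma x_exponent_x_index:
  assumes "1 \<le> a" "a \<le> n"
  shows "x_exponent m (x_index a) + lookup m (y_index a) + lookup m (y_index (a - 1)) =
    lookup m (x_index a) + y_degree m"
proof -
  have one: "lookup (path_exponent j) i + (if x_index j = i then 1 else 0) + (if x_index (j + 1) = i then 1 else 0) = 1"
    if "i < n" for i j
    using arg_cong[OF path_exponent_complement[of j], of "\<lambda>p. lookup p i"] that
    by (auto simp: lookup_add lookup_sum lookup_single when_def split: if_splits)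
  let ?i = "x_index a"
  have "y_degree m = (\<Sum>j<n. lookup m (n + j) * (lookup (path_exponent j) ?i +
      (if x_index j = ?i then 1 else 0) + (if x_index (j + 1) = ?i then 1 else 0)))"
    by (simp only: y_degree_def one[OF x_index_less] mult_1_right)
  also have "\<dots> = (\<Sum>j<n. lookup m (n + j) * lookup (path_exponent j) ?i) +
      (\<Sum>j<n. if x_index j = ?i then lookup m (n + j) else 0) +
      (\<Sum>j<n. if x_index (j + 1) = ?i then lookup m (n + j) else 0)"
    by (simp add: distrib_left sum.distrib if_distrib[of "\<lambda>x. _ * x"] cong: if_cong)
  also have "(\<Sum>j<n. if x_index j = ?i then lookup m (n + j) else 0) = lookup m (y_index a)"
  proof -
    have "x_index j = x_index a \<longleftrightarrow> j = a mod n" if "j < n" for j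
      using assms that x_index_eq_iff[of j a] x_index_eq_iff[of j 0] n_gt_1 x_index_n by (cases "a = n") auto
    then have "(\<Sum>j<n. if x_index j = ?i then lookup m (n + j) else 0) = (\<Sum>j<n. if j = a mod n then lookup m (n + j) else 0)"
      by (intro sum.cong) auto
    then show ?thesis using n_gt_1 by (simp add: y_index_def)
  qed
  also have "(\<Sum>j<n. if x_index (j + 1) = ?i then lookup m (n + j) else 0) = lookup m (y_index (a - 1))"
  proof -
    have "x_index (j + 1) = x_index a \<longleftrightarrow> j = a - 1" if "j < n" for j
      using assms that x_index_eq_iff[of "j + 1" a] x_index_eq_iff[of 0 a] x_index_eq_iff[of "j + 1" 0]
        n_gt_1 x_index_n by (cases "a = n"; cases "j + 1 = n") auto
    then have "(\<Sum>j<n. if x_index (j + 1) = ?i then lookup m (n + j) else 0) = (\<Sum>j<n. if j = a - 1 then lookup m (n + j) else 0)"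
      by (intro sum.cong) auto
    then show ?thesis using assms n_gt_1 by (simp add: y_index_def)
  qed
  finally show ?thesis by (simp add: x_exponent_def)
qed

lemma mon_dvd_odds:
  assumes "\<And>i. i < l \<Longrightarrow> y_index (2 * i + 1) \<in> keys m" "2 * l < n"
  shows "mon_dvd (odds l) m"
  using assms
proof (induction l)
  case (Suc l)
  have "y_index (2 * l + 1) \<notin> keys (odds l)"
    using Suc.prems(2) by (auto simp: keys_odds y_index_eq_iff)
  then show ?case unfolding odds_Suc using Suc by (intro mon_dvd_add_expo) auto
qed (simp add: mon_dvd_0)

definition presentation_ideal :: "'k mpoly set" where
  "presentation_ideal = {p + q * rel 0 | p q. p \<in> C (n - 1) \<and> q \<in> R}"

lemma presentation_idealI: "p \<in> C (n - 1) \<Longrightarrow> q \<in> R \<Longrightarrow> x = p + q * rel 0 \<Longrightarrow> x \<in> presentation_ideal"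
  by (auto simp: presentation_ideal_def)

lemma ideal_presentation: "mpolys.is_ideal (2 * n) presentation_ideal"
  unfolding mpolys.is_ideal_def
proof (intro conjI ballI)
  show "presentation_ideal \<subseteq> R"
    unfolding presentation_ideal_def using C_closed(1) rel_in_R by (auto intro!: mpolys_add mpolys_mult)
  show "0 \<in> presentation_ideal"
    by (rule presentation_idealI[of 0 0]) (auto simp: C_closed(2))
next
  fix x y assume "x \<in> presentation_ideal" "y \<in> presentation_ideal"
  then obtain p q p' q' where "x = p + q * rel 0" "y = p' + q' * rel 0"
    "p \<in> C (n - 1)" "p' \<in> C (n - 1)" "q \<in> R" "q' \<in> R" by (auto simp: presentation_ideal_def)
  then show "x - y \<in> presentation_ideal"
    by (intro presentation_idealI[of "p - p'" "q - q'"] C_closed(3) mpolys_diff) (auto simp: algebra_simps)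
next
  fix x r assume "x \<in> presentation_ideal" and r: "r \<in> R"
  then obtain p q where "x = p + q * rel 0" "p \<in> C (n - 1)" "q \<in> R" by (auto simp: presentation_ideal_def)
  then show "r * x \<in> presentation_ideal"
    using r by (intro presentation_idealI[of "r * p" "r * q"] C_closed(5) mpolys_mult) (auto simp: algebra_simps)
qed

lemmas presentation_closed = mpolys.is_idealD[OF ideal_presentation]

lemma C_subset_presentation: "C (n - 1) \<subseteq> presentation_ideal"
  using presentation_idealI[of _ 0] by auto

lemma presentation_trans:
  "p - q \<in> presentation_ideal \<Longrightarrow> q - r \<in> presentation_ideal \<Longrightarrow> p - r \<in> presentation_ideal"
  using presentation_closed(4)[of "p - q" "q - r"] by simp

lemma presentation_sym: "p - q \<in> presentation_ideal \<Longrightarrow> q - p \<in> presentation_ideal"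
  using presentation_closed(6)[of "p - q"] by simp

lemma ev_presentation: "p \<in> presentation_ideal \<Longrightarrow> ev p = 0"
  by (auto simp: presentation_ideal_def coeffs.evaluate_add coeffs.evaluate_mult ev_rel ev_C)

lemma exponent_difference:
  assumes "x_image m = x_image m'" "y_degree m = y_degree m'" "a < n"
  shows "int (lookup m (x_index (Suc a))) - int (lookup m' (x_index (Suc a))) =
    (int (lookup m (y_index (Suc a))) - int (lookup m' (y_index (Suc a)))) +
    (int (lookup m (y_index a)) - int (lookup m' (y_index a)))"
proof -
  have "x_exponent m (x_index (Suc a)) = x_exponent m' (x_index (Suc a))"
    using lookup_x_image[OF x_index_less] assms(1) by metis
  then show ?thesis
    using x_exponent_x_index[of "Suc a" m] x_exponent_x_index[of "Suc a" m'] assms(2,3) by simp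
qed

lemma irreducible_exponents:
  assumes "monomial_rewriting.irreducible_mon {Suc 0..n - 1} lhs m" "a < n - 1"
  shows "lookup m (x_index (Suc a)) = 0 \<or> lookup m (y_index (Suc a)) = 0"
proof -
  interpret monomial_rewriting "{Suc 0..n - 1}" lhs rhs weight by (rule rewriting) simp
  show ?thesis using assms unfolding irreducible_mon_def mon_dvd_lhs by (force simp: in_keys_iff)
qed

text \<open>
  For irreducible monomials with the same image, the exponents of \<open>X\<^sub>a\<close> force the differences of the
  exponents of \<open>Y\<^sub>a\<close> to alternate in sign. The divisor of \<open>m'\<close> that this yields ends an even chain,
  so it is congruent to a multiple of \<open>X\<^sub>2 Y\<^sub>1\<close> and then, by the relation of index \<open>0\<close>, of \<open>Y\<^sub>0\<close>.
\<close>

lemma irreducible_same_image: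
  assumes irr: "monomial_rewriting.irreducible_mon {Suc 0..n - 1} lhs m" "monomial_rewriting.irreducible_mon {Suc 0..n - 1} lhs m'"
    and image: "x_image m = x_image m'" "y_degree m = y_degree m'"
    and pos: "lookup m (y_index 0) > lookup m' (y_index 0)"
  shows "\<exists>j. 2 * j \<le> n - 1 \<and> mon_dvd (expo (x_index (2 * j + 2)) + odds (Suc j)) m'"
proof -
  define s where "s a = int (lookup m (y_index a)) - int (lookup m' (y_index a))" for a
  note x_diff = exponent_difference[OF image, folded s_def]
  note not_both = irreducible_exponents
  have "\<exists>j<half. s (2 * j + 2) = 0 \<and> (\<forall>i\<le>j. s (2 * i + 1) < 0)"
  proof (rule alternating_sequence)
    show "s 0 > 0" using pos by (simp add: s_def)
    show "s (Suc a) + s a \<le> 0" if "a < 2 * half" "s (Suc a) > 0" for a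
      using that x_diff[of a] not_both[OF irr(1), of a] n_half by (auto simp: s_def)
    show "s (Suc a) + s a \<ge> 0" if "a < 2 * half" "s (Suc a) < 0" for a
      using that x_diff[of a] not_both[OF irr(2), of a] n_half by (auto simp: s_def)
    have "(\<Sum>a<n. s a) = int (y_degree m) - int (y_degree m')"
      by (simp add: s_def y_degree_def y_index_def sum_subtractf)
    then show "(\<Sum>a<2 * half + 1. s a) = 0" using image(2) n_half by simp
  qed
  then obtain j where j: "j < half" "s (2 * j + 2) = 0" "\<And>i. i \<le> j \<Longrightarrow> s (2 * i + 1) < 0" by blast
  have "mon_dvd (odds (Suc j)) m'"
    using j n_half by (intro mon_dvd_odds) (force simp: s_def in_keys_iff less_Suc_eq_le)+
  moreover have "x_index (2 * j + 2) \<in> keys m'"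
    using x_diff[of "2 * j + 1"] j(2) j(3)[of j] j(1) n_half by (auto simp: in_keys_iff)
  moreover have "x_index (2 * j + 2) \<notin> keys (odds (Suc j))" by (auto simp: keys_odds)
  ultimately have "mon_dvd (odds (Suc j) + expo (x_index (2 * j + 2))) m'" by (intro mon_dvd_add_expo)
  then show ?thesis using j(1) n_half by (intro exI[of _ j]) (auto simp: add.commute)
qed

lemma irreducible_same_image_eq:
  assumes irr: "monomial_rewriting.irreducible_mon {Suc 0..n - 1} lhs m" "monomial_rewriting.irreducible_mon {Suc 0..n - 1} lhs m'"
    and image: "x_image m = x_image m'" "y_degree m = y_degree m'"
    and keys_m: "keys m \<subseteq> {..<2 * n}" "keys m' \<subseteq> {..<2 * n}"
    and eq: "lookup m (y_index 0) = lookup m' (y_index 0)"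
  shows "m = m'"
proof -
  define s where "s a = int (lookup m (y_index a)) - int (lookup m' (y_index a))" for a
  note x_diff = exponent_difference[OF image, folded s_def]
  note not_both = irreducible_exponents
  have s0: "s a = 0" if "a < n" for a
    using that
  proof (induction a)
    case (Suc a)
    then have "a < n" "a < n - 1" by auto
    then show ?case
      using Suc x_diff[of a] not_both[OF irr(1), of a] not_both[OF irr(2), of a] by (auto simp: s_def)
  qed (simp add: s_def eq)
  have sn: "s a = 0" if "a \<le> n" for a
    using s0[of a] s0[of 0] that n_gt_1 y_index_n by (cases "a = n") (auto simp: s_def)
  have "lookup m (y_index a) = lookup m' (y_index a)" if "a < n" for a using s0[OF that] by (simp add: s_def)
  then have y: "lookup m (n + j) = lookup m' (n + j)" if "j < n" for j using that by (simp add: y_index_def)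
  have x: "lookup m i = lookup m' i" if i: "i < n" for i
  proof -
    obtain a where a: "a < n" "x_index (Suc a) = i"
    proof (cases "i + 1 < n")
      case True
      moreover have "Suc (i + 1) + n - 2 = i + n" by simp
      ultimately show ?thesis using that[of "i + 1"] i unfolding x_index_def by simp
    next
      case False
      then have "Suc 0 + n - 2 = i" "0 < n" using i n_ge_3 by auto
      then show ?thesis using that[of 0] i unfolding x_index_def by simp
    qed
    then show ?thesis using x_diff[of a] sn[of a] sn[of "Suc a"] by simp
  qed
  show ?thesis
  proof (rule poly_mapping_eqI)
    fix i
    show "lookup m i = lookup m' i"
    proof (cases "i < 2 * n")
      case True
      then show ?thesis using x[of i] y[of "i - n"] by (cases "i < n") auto
    next
      case False
      then have "i \<notin> keys m" "i \<notin> keys m'" using keys_m by auto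
      then show ?thesis by (simp add: in_keys_iff)
    qed
  qed
qed

text \<open>
  Induction on the degree in the \<open>Y\<^sub>a\<close>. Both monomials may be replaced by their normal forms. If these
  differ, one is divisible by \<open>Y\<^sub>0\<close> and the other is congruent to a multiple of \<open>Y\<^sub>0\<close>; the factor \<open>Y\<^sub>0\<close> can
  be cancelled because exponents add up in the image.
\<close>

lemma same_image_presentation:
  assumes "keys m \<subseteq> {..<2 * n}" "keys m' \<subseteq> {..<2 * n}" "x_image m = x_image m'" "y_degree m = y_degree m'"
  shows "mon m - mon m' \<in> presentation_ideal"
  using assms
proof (induction "y_degree m" arbitrary: m m' rule: less_induct)
  case less
  interpret monomial_rewriting "{Suc 0..n - 1}" lhs rhs weight by (rule rewriting) simp
  have le: "n - 1 \<le> n - 1" by simp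
  define M where "M = normal_form m"
  define M' where "M' = normal_form m'"
  have keysM: "keys M \<subseteq> {..<2 * n}" "keys M' \<subseteq> {..<2 * n}"
    unfolding M_def M'_def by (intro normal_form_in_C(1)[OF le] less.prems)+
  have mM: "mon m - mon M \<in> C (n - 1)" "mon m' - mon M' \<in> C (n - 1)"
    unfolding M_def M'_def by (intro normal_form_in_C(2)[OF le] less.prems)+
  have image_C: "x_image k = x_image l \<and> y_degree k = y_degree l"
    if "mon k - mon l \<in> presentation_ideal" "keys k \<subseteq> {..<2 * n}" "keys l \<subseteq> {..<2 * n}" for k l
  proof -
    have "ev (mon k) = ev (mon l)" using ev_presentation[OF that(1)] by (simp add: coeffs.evaluate_diff)
    then show ?thesis using ev_mon_eq_iff[OF that(2,3)] by blast
  qed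
  have mM': "mon m - mon M \<in> presentation_ideal" "mon m' - mon M' \<in> presentation_ideal"
    using mM C_subset_presentation by auto
  have imM: "x_image m = x_image M" "y_degree m = y_degree M" "x_image m' = x_image M'" "y_degree m' = y_degree M'"
    using image_C[OF mM'(1) less.prems(1) keysM(1)] image_C[OF mM'(2) less.prems(2) keysM(2)] by simp_all
  have irr: "irreducible_mon M" "irreducible_mon M'" unfolding M_def M'_def by (rule normal_form(2))+
  have main: "mon k - mon k' \<in> presentation_ideal"
    if irr: "irreducible_mon k" "irreducible_mon k'" and keys_k: "keys k \<subseteq> {..<2 * n}" "keys k' \<subseteq> {..<2 * n}"
      and im: "x_image k = x_image k'" "y_degree k = y_degree k'" and deg: "y_degree k = y_degree m"
      and pos: "lookup k (y_index 0) > lookup k' (y_index 0)" for k k'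
  proof -
    obtain j where j: "2 * j \<le> n - 1" "mon_dvd (expo (x_index (2 * j + 2)) + odds (Suc j)) k'"
      using irreducible_same_image[OF irr im pos] by blast
    obtain r where r: "k' = expo (x_index (2 * j + 2)) + odds (Suc j) + r" using j(2) by (auto simp: mon_dvd_def)
    have kr: "keys r \<subseteq> {..<2 * n}" using keys_k by (auto simp: r keys_plus_nat)
    have chain: "mon (expo (x_index 2) + expo (y_index 1) + evens j + r) - mon k' \<in> C (n - 1)"
      unfolding r by (intro C_mon_add even_chain j kr)
    have eq: "expo (x_index 2) + expo (y_index 1) + evens j + r = rhs 0 + (evens j + r)"
      by (simp add: rhs_def ac_simps numeral_2_eq_2)
    have 1: "mon k' - mon (rhs 0 + (evens j + r)) \<in> presentation_ideal"
      by (rule subsetD[OF C_subset_presentation C_sym[OF chain[unfolded eq]]])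
    have "mon (evens j + r) * rel 0 \<in> presentation_ideal"
      using kr keys_evens_odds
      by (intro presentation_idealI[of 0 "mon (evens j + r)"] single_in_mpolys) (auto simp: C_closed(2) keys_plus_nat)
    then have "mon (lhs 0 + (evens j + r)) - mon (rhs 0 + (evens j + r)) \<in> presentation_ideal"
      by (simp add: rel_def right_diff_distrib mult_single add.commute)
    from presentation_trans[OF 1 presentation_sym[OF this]]
    have 2: "mon k' - mon (lhs 0 + (evens j + r)) \<in> presentation_ideal" .
    define N where "N = expo (x_index 0) + (evens j + r)"
    have N: "lhs 0 + (evens j + r) = expo (y_index 0) + N" by (simp add: N_def lhs_def ac_simps)
    have keysN: "keys N \<subseteq> {..<2 * n}" unfolding N_def using kr by (simp add: keys_bounds index_less)
    have "y_index 0 \<in> keys k" using pos by (simp add: in_keys_iff)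
    then obtain N0 where N0: "k = expo (y_index 0) + N0" using mon_dvd_expo[of "y_index 0" k] by (auto simp: mon_dvd_def)
    have keysN0: "keys N0 \<subseteq> {..<2 * n}" using keys_k by (auto simp: N0 keys_plus_nat)
    have "x_image k' = x_image (expo (y_index 0) + N) \<and> y_degree k' = y_degree (expo (y_index 0) + N)"
      using 2 keys_k keysN keys_expo by (intro image_C) (auto simp: N keys_plus_nat)
    then have "x_image N0 = x_image N" "y_degree N0 = y_degree N"
      using im by (simp_all add: N0 x_image_add y_degree_add)
    moreover have "y_degree N0 < y_degree m" using deg by (simp add: N0 y_degree_add image_of_y_index)
    ultimately have "mon N0 - mon N \<in> presentation_ideal" using less.hyps keysN keysN0 by blast
    then have "mon (expo (y_index 0)) * (mon N0 - mon N) \<in> presentation_ideal"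
      by (intro presentation_closed(5) single_in_mpolys keys_expo)
    then have "mon k - mon (lhs 0 + (evens j + r)) \<in> presentation_ideal"
      by (simp add: right_diff_distrib mult_single N N0)
    then show ?thesis by (rule presentation_trans[OF _ presentation_sym[OF 2]])
  qed
  have im: "x_image M = x_image M'" "y_degree M = y_degree M'"
    using less.prems(3,4) unfolding imM .
  have deg: "y_degree M = y_degree m" "y_degree M' = y_degree m"
    using imM(2) im(2) by simp_all
  have MM': "mon M - mon M' \<in> presentation_ideal"
  proof (cases "lookup M (y_index 0)" "lookup M' (y_index 0)" rule: linorder_cases)
    case less
    from main[OF irr(2,1) keysM(2,1) im[symmetric] deg(2) this]
    show ?thesis by (rule presentation_sym)
  next
    case equal
    from irreducible_same_image_eq[OF irr im keysM this] show ?thesis by (simp add: presentation_closed(2))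
  next
    case greater
    from main[OF irr keysM im deg(1) this] show ?thesis .
  qed
  show ?case
    by (rule presentation_trans[OF presentation_trans[OF mM'(1) MM'] presentation_sym[OF mM'(2)]])
qed

lemma ev_single:
  assumes "keys m \<subseteq> {..<2 * n}"
  shows "ev (Poly_Mapping.single m c) = Polynomial.monom (Poly_Mapping.single (x_image m) c) (y_degree m)"
proof -
  have "ev (const c * mon m) = [:const c:] * Polynomial.monom (mon (x_image m)) (y_degree m)"
    using assms by (simp add: coeffs.evaluate_mult coeffs.evaluate_const ev_mon)
  then show ?thesis by (simp add: const_def mult_single smult_monom)
qed

lemma lookup_coeff_ev:
  assumes "p \<in> R"
  shows "lookup (Polynomial.coeff (ev p) d) x = (\<Sum>m\<in>keys p. if x_image m = x \<and> y_degree m = d then lookup p m else 0)"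
proof -
  have "ev (\<Sum>m\<in>keys p. Poly_Mapping.single m (lookup p m)) = (\<Sum>m\<in>keys p. ev (Poly_Mapping.single m (lookup p m)))"
    by (rule coeffs.evaluate_sum)
  then have "ev p = (\<Sum>m\<in>keys p. ev (Poly_Mapping.single m (lookup p m)))"
    by (simp only: mpoly_eq_sum_single[symmetric])
  also have "\<dots> = (\<Sum>m\<in>keys p. Polynomial.monom (Poly_Mapping.single (x_image m) (lookup p m)) (y_degree m))"
    by (intro sum.cong refl ev_single keys_in_mpolys[OF assms])
  finally have "Polynomial.coeff (ev p) d = (\<Sum>m\<in>keys p. if y_degree m = d then Poly_Mapping.single (x_image m) (lookup p m) else 0)"
    by (simp add: coeff_sum)
  then show ?thesis by (auto simp: lookup_sum lookup_single when_def intro!: sum.cong)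
qed

text \<open>The kernel of a map that sends monomials to monomials is spanned by differences of monomials.\<close>

lemma kernel_ev:
  assumes "p \<in> R"
  shows "ev p = 0 \<longleftrightarrow> p \<in> presentation_ideal"
proof
  assume "ev p = 0"
  with assms show "p \<in> presentation_ideal"
  proof (induction "card (keys p)" arbitrary: p rule: less_induct)
    case less
    show ?case
    proof (cases "p = 0")
      case False
      then have "keys p \<noteq> {}" by (auto simp: in_keys_iff intro: poly_mapping_eqI)
      then obtain m where m: "m \<in> keys p" by blast
      have "\<exists>m'\<in>keys p. m' \<noteq> m \<and> x_image m' = x_image m \<and> y_degree m' = y_degree m"
      proof (rule ccontr)
        assume "\<not> ?thesis"
        then have "(\<Sum>k\<in>keys p. if x_image k = x_image m \<and> y_degree k = y_degree m then lookup p k else 0) =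
          (\<Sum>k\<in>keys p. if k = m then lookup p k else 0)"
          by (intro sum.cong) auto
        also have "\<dots> = lookup p m" using m by simp
        finally have "lookup p m = 0" using lookup_coeff_ev[OF less.prems(1), of "y_degree m" "x_image m"] less.prems(2) by simp
        then show False using m by (simp add: in_keys_iff)
      qed
      then obtain m' where m': "m' \<in> keys p" "m' \<noteq> m" "x_image m' = x_image m" "y_degree m' = y_degree m" by blast
      have km: "keys m \<subseteq> {..<2 * n}" "keys m' \<subseteq> {..<2 * n}" using keys_in_mpolys[OF less.prems(1)] m m'(1) by auto
      define q where "q = const (lookup p m) * (mon m - mon m')"
      have q: "q \<in> presentation_ideal"
        unfolding q_def using m' km by (intro presentation_closed(5) same_image_presentation const_in_mpolys) auto
      have lookup_q: "lookup (p - q) k = (if k = m then 0 else if k = m' then lookup p m' + lookup p m else lookup p k)" for k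
        using m'(2) by (auto simp: q_def const_def right_diff_distrib mult_single lookup_minus lookup_single when_def)
      have "keys (p - q) \<subseteq> keys p - {m}"
        using m'(1) by (auto simp: in_keys_iff lookup_q split: if_splits)
      then have "card (keys (p - q)) \<le> card (keys p - {m})" by (intro card_mono) auto
      also have "\<dots> < card (keys p)" by (rule card_Diff1_less) (simp_all add: m)
      finally have "card (keys (p - q)) < card (keys p)" .
      moreover have "p - q \<in> R" using less.prems(1) q presentation_closed(1) by (intro mpolys_diff) auto
      moreover have "ev (p - q) = 0" using less.prems(2) ev_presentation[OF q] by (simp add: coeffs.evaluate_diff)
      ultimately have "p - q \<in> presentation_ideal" using less.hyps by blast
      then show ?thesis using presentation_closed(4)[OF _ q] by force
    qed (simp add: presentation_closed(2))
  qed
qed (rule ev_presentation)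

lemma relation_ideal_eq: "relation_ideal (\<lambda>c. [:const c:]) gens = presentation_ideal"
  using kernel_ev presentation_closed(1) by (auto simp: relation_ideal_def)

end

section \<open>Rings of polynomials as structures\<close>

lemma ring_on_simps [simp]:
  "carrier (ring_on S) = S" "x \<otimes>\<^bsub>ring_on S\<^esub> y = x * y" "\<one>\<^bsub>ring_on S\<^esub> = 1"
  "\<zero>\<^bsub>ring_on S\<^esub> = 0" "x \<oplus>\<^bsub>ring_on S\<^esub> y = x + y"
  by (simp_all add: ring_on_def)

context unital_subring
begin

lemma cring_ring_on: "cring (ring_on P)"
proof (rule cringI)
  show "abelian_group (ring_on P)"
  proof (rule abelian_groupI)
    show "\<exists>y\<in>carrier (ring_on P). y \<oplus>\<^bsub>ring_on P\<^esub> x = \<zero>\<^bsub>ring_on P\<^esub>" if "x \<in> carrier (ring_on P)" for x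
      using that uminus_mem[of x] by (auto intro: bexI[of _ "- x"])
  qed (auto simp: add_mem add.assoc add.commute)
  show "Group.comm_monoid (ring_on P)"
    by (rule comm_monoidI) (auto simp: mult_mem mult.assoc mult.commute)
qed (auto simp: distrib_right)

lemma a_inv_ring_on:
  assumes "x \<in> P"
  shows "\<ominus>\<^bsub>ring_on P\<^esub> x = - x"
proof -
  interpret cring "ring_on P" by (rule cring_ring_on)
  show ?thesis using assms uminus_mem[OF assms] by (intro minus_equality) auto
qed

lemma ideal_ring_on:
  assumes "is_ideal I"
  shows "ideal I (ring_on P)"
proof (rule idealI)
  show "ring (ring_on P)" using cring_ring_on by (rule cring.axioms(1))
  show "subgroup I (add_monoid (ring_on P))"
  proof
    show "inv\<^bsub>add_monoid (ring_on P)\<^esub> x \<in> I" if "x \<in> I" for x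
      using that is_idealD(1)[OF assms] is_idealD(6)[OF assms that] a_inv_ring_on[of x]
      by (auto simp: a_inv_def)
  qed (use is_idealD[OF assms] in auto)
qed (use is_idealD(5)[OF assms] in \<open>auto simp: mult.commute\<close>)

lemma primeideal_ring_on:
  assumes I: "is_ideal I" and one: "1 \<notin> I"
    and prime: "\<And>x y. x \<in> P \<Longrightarrow> y \<in> P \<Longrightarrow> x * y \<in> I \<Longrightarrow> x \<in> I \<or> y \<in> I"
  shows "primeideal I (ring_on P)"
  by (rule primeidealI[OF ideal_ring_on[OF I] cring_ring_on]) (use one prime in auto)

lemma primeideal_ring_onD:
  assumes "primeideal I (ring_on P)"
  shows "I \<subseteq> P" "0 \<in> I" "x \<in> I \<Longrightarrow> y \<in> I \<Longrightarrow> x + y \<in> I" "x \<in> I \<Longrightarrow> p \<in> P \<Longrightarrow> p * x \<in> I" "1 \<notin> I"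
    "x \<in> P \<Longrightarrow> y \<in> P \<Longrightarrow> x * y \<in> I \<Longrightarrow> x \<in> I \<or> y \<in> I"
proof -
  interpret primeideal I "ring_on P" by fact
  show "I \<subseteq> P" using a_subset by simp
  show "0 \<in> I" using additive_subgroup.zero_closed[OF is_additive_subgroup] by simp
  show "x \<in> I \<Longrightarrow> y \<in> I \<Longrightarrow> x + y \<in> I" using additive_subgroup.a_closed[OF is_additive_subgroup, of x y] by simp
  show "x \<in> I \<Longrightarrow> p \<in> P \<Longrightarrow> p * x \<in> I" using I_l_closed[of x p] by simp
  show "1 \<notin> I" using one_imp_carrier I_notcarr by auto
  show "x \<in> P \<Longrightarrow> y \<in> P \<Longrightarrow> x * y \<in> I \<Longrightarrow> x \<in> I \<or> y \<in> I" using I_prime[of x y] by simp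
qed

lemma power_mem: "x \<in> P \<Longrightarrow> x ^ k \<in> P"
  by (induction k) (auto intro: mult_mem)

end

section \<open>Chains of primes and algebraic dependence\<close>

fun power_product :: "'r::comm_ring_1 list \<Rightarrow> nat list \<Rightarrow> 'r" where
  "power_product (x # xs) (e # es) = x ^ e * power_product xs es"
| "power_product _ _ = 1"

lemma (in unital_subring) power_product_mem: "set xs \<subseteq> P \<Longrightarrow> power_product xs es \<in> P"
  by (induction xs es rule: power_product.induct) (auto intro: mult_mem power_mem)

text \<open>
  In a polynomial relation modulo the first prime of the chain, the lowest power of the first
  element can be cancelled because that element is not in the first prime; modulo the second
  prime the other terms with this element vanish, and the remaining relation has one element
  less. In the end a nonzero constant would be in a prime.
\<close>

lemma chain_algebraically_independent:
  fixes P :: "'r::comm_ring_1 set" and \<iota> :: "'k::field \<Rightarrow> 'r"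
  assumes P: "unital_subring P" and \<iota>: "algebra_map \<iota>" "range \<iota> \<subseteq> P"
    and primes: "\<And>i. i \<le> length xs \<Longrightarrow> primeideal (p i) (ring_on P)"
    and chain: "\<And>i. i < length xs \<Longrightarrow> p i \<subseteq> p (Suc i) \<and> xs ! i \<in> p (Suc i) - p i"
    and E: "finite E" "\<And>e. e \<in> E \<Longrightarrow> length e = length xs" "e0 \<in> E" "c e0 \<noteq> 0"
  shows "(\<Sum>e\<in>E. \<iota> (c e) * power_product xs e) \<notin> p 0"
  using primes chain E
proof (induction xs arbitrary: p E c e0)
  case Nil
  interpret unital_subring P by (rule P)
  interpret algebra_map \<iota> by (rule \<iota>(1))
  have p0: "primeideal (p 0) (ring_on P)" using Nil by simp
  have "E = {[]}" using Nil by auto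
  then have "(\<Sum>e\<in>E. \<iota> (c e) * power_product [] e) = \<iota> (c [])" "c [] \<noteq> 0" using Nil by auto
  moreover have "\<iota> (c []) \<notin> p 0"
  proof
    assume "\<iota> (c []) \<in> p 0"
    then have "\<iota> (inverse (c [])) * \<iota> (c []) \<in> p 0"
      by (rule primeideal_ring_onD(4)[OF p0]) (use \<iota>(2) in auto)
    then have "1 \<in> p 0" using \<open>c [] \<noteq> 0\<close> by (simp add: map_one flip: map_mult)
    then show False using primeideal_ring_onD(5)[OF p0] by blast
  qed
  ultimately show ?case by simp
next
  case (Cons x xs)
  interpret unital_subring P by (rule P)
  interpret algebra_map \<iota> by (rule \<iota>(1))
  have p0: "primeideal (p 0) (ring_on P)" and p1: "primeideal (p (Suc 0)) (ring_on P)"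
    using Cons.prems(1)[of 0] Cons.prems(1)[of "Suc 0"] by auto
  have x: "x \<notin> p 0" "x \<in> p (Suc 0)" "p 0 \<subseteq> p (Suc 0)" using Cons.prems(2)[of 0] by auto
  have nthP: "(x # xs) ! i \<in> P" if "i < length (x # xs)" for i
    using Cons.prems(2)[OF that] primeideal_ring_onD(1)[OF Cons.prems(1)[of "Suc i"]] that by auto
  have xsP: "x \<in> P" "set xs \<subseteq> P"
    using nthP[of 0] nthP[of "Suc i" for i] by (auto simp: in_set_conv_nth)
  have \<iota>P: "\<iota> a \<in> P" for a using \<iota>(2) by auto
  define E0 where "E0 = {e\<in>E. c e \<noteq> 0}"
  define k where "k = Min (hd ` E0)"
  have E0: "finite E0" "E0 \<noteq> {}" "E0 \<subseteq> E" using Cons.prems(3,5,6) by (auto simp: E0_def)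
  have k: "k \<in> hd ` E0" "\<And>e. e \<in> E0 \<Longrightarrow> k \<le> hd e" unfolding k_def using E0 by auto
  have decomp: "hd e # tl e = e" "length (tl e) = length xs" if "e \<in> E0" for e
  proof -
    have "length e = Suc (length xs)" using Cons.prems(4)[OF subsetD[OF E0(3) that]] by simp
    then show "hd e # tl e = e" "length (tl e) = length xs" by (cases e; simp)+
  qed
  define E1 where "E1 = {e\<in>E0. hd e = k}"
  define rest where "rest = (\<Sum>e\<in>E0 - E1. \<iota> (c e) * (x ^ (hd e - k - 1) * power_product xs (tl e)))"
  define lower where "lower = (\<Sum>e\<in>E1. \<iota> (c e) * power_product xs (tl e))"
  have E1: "finite E1" "E1 \<subseteq> E0" using E0(1) by (auto simp: E1_def)
  have restP: "rest \<in> P" and lowerP: "lower \<in> P"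
    unfolding rest_def lower_def using xsP by (auto intro!: sum_mem mult_mem \<iota>P power_mem power_product_mem)
  have "(\<Sum>e\<in>E. \<iota> (c e) * power_product (x # xs) e) = (\<Sum>e\<in>E0. \<iota> (c e) * power_product (x # xs) e)"
    using Cons.prems(3) by (intro sum.mono_neutral_right) (auto simp: E0_def map_zero)
  also have "\<dots> = (\<Sum>e\<in>E0. x ^ k * (\<iota> (c e) * (x ^ (hd e - k) * power_product xs (tl e))))"
  proof (rule sum.cong[OF refl])
    fix e assume e: "e \<in> E0"
    have "power_product (x # xs) (hd e # tl e) = x ^ hd e * power_product xs (tl e)" by simp
    then have "power_product (x # xs) e = x ^ hd e * power_product xs (tl e)"
      unfolding decomp(1)[OF e] .
    also have "x ^ hd e = x ^ k * x ^ (hd e - k)" using k(2)[OF e] by (simp flip: power_add)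
    finally show "\<iota> (c e) * power_product (x # xs) e = x ^ k * (\<iota> (c e) * (x ^ (hd e - k) * power_product xs (tl e)))"
      by (simp add: ac_simps)
  qed
  also have "\<dots> = x ^ k * (\<Sum>e\<in>E0. \<iota> (c e) * (x ^ (hd e - k) * power_product xs (tl e)))"
    by (simp add: sum_distrib_left)
  also have "(\<Sum>e\<in>E0. \<iota> (c e) * (x ^ (hd e - k) * power_product xs (tl e))) =
     (\<Sum>e\<in>E0 - E1. \<iota> (c e) * (x ^ (hd e - k) * power_product xs (tl e))) +
     (\<Sum>e\<in>E1. \<iota> (c e) * (x ^ (hd e - k) * power_product xs (tl e)))"
    by (rule sum.subset_diff[OF E1(2) E0(1)])
  also have "(\<Sum>e\<in>E1. \<iota> (c e) * (x ^ (hd e - k) * power_product xs (tl e))) = lower"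
    unfolding lower_def by (intro sum.cong) (auto simp: E1_def)
  also have "(\<Sum>e\<in>E0 - E1. \<iota> (c e) * (x ^ (hd e - k) * power_product xs (tl e))) = rest * x"
    unfolding rest_def sum_distrib_right
  proof (rule sum.cong[OF refl])
    fix e assume "e \<in> E0 - E1"
    then have "k < hd e" using k(2) by (force simp: E1_def)
    then have "hd e - k = Suc (hd e - k - 1)" by simp
    then have "x ^ (hd e - k) = x ^ (hd e - k - 1) * x" by (metis power_Suc2)
    then show "\<iota> (c e) * (x ^ (hd e - k) * power_product xs (tl e)) =
      \<iota> (c e) * (x ^ (hd e - k - 1) * power_product xs (tl e)) * x" by (simp add: ac_simps)
  qed
  finally have total: "(\<Sum>e\<in>E. \<iota> (c e) * power_product (x # xs) e) = x ^ k * (rest * x + lower)" .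
  have "lower \<notin> p (Suc 0)"
  proof -
    have inj: "inj_on tl E1"
    proof (rule inj_onI)
      fix e e' assume e: "e \<in> E1" "e' \<in> E1" "tl e = tl e'"
      then have "hd e = hd e'" "e \<in> E0" "e' \<in> E0" by (auto simp: E1_def)
      then have "e = hd e' # tl e'" using decomp(1)[of e] e(3) by simp
      then show "e = e'" using decomp(1)[OF \<open>e' \<in> E0\<close>] by simp
    qed
    obtain e1 where e1: "e1 \<in> E1" using k(1) by (auto simp: E1_def)
    have ck: "c (k # tl e) = c e" if "e \<in> E1" for e
      using decomp(1)[of e] that by (auto simp: E1_def)
    have "lower = (\<Sum>e\<in>tl ` E1. \<iota> (c (k # e)) * power_product xs e)"
      unfolding lower_def by (subst sum.reindex[OF inj]) (simp add: ck)
    moreover have "(\<Sum>e\<in>tl ` E1. \<iota> (c (k # e)) * power_product xs e) \<notin> (\<lambda>i. p (Suc i)) 0"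
    proof (rule Cons.IH[where c = "\<lambda>e. c (k # e)"])
      show "primeideal (p (Suc i)) (ring_on P)" if "i \<le> length xs" for i using Cons.prems(1) that by simp
      show "p (Suc i) \<subseteq> p (Suc (Suc i)) \<and> xs ! i \<in> p (Suc (Suc i)) - p (Suc i)" if "i < length xs" for i
        using Cons.prems(2)[of "Suc i"] that by simp
      show "finite (tl ` E1)" using E1(1) by simp
      show "length e = length xs" if "e \<in> tl ` E1" for e using that decomp(2) E1(2) by auto
      show "tl e1 \<in> tl ` E1" using e1 by simp
      show "c (k # tl e1) \<noteq> 0" using ck[OF e1] e1 E1(2) by (auto simp: E0_def)
    qed
    ultimately show ?thesis by simp
  qed
  show ?case
  proof
    assume "(\<Sum>e\<in>E. \<iota> (c e) * power_product (x # xs) e) \<in> p 0"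
    then have prod: "x ^ k * (rest * x + lower) \<in> p 0" by (simp add: total)
    have pow: "x ^ i \<notin> p 0" for i
    proof (induction i)
      case (Suc i)
      then show ?case using primeideal_ring_onD(6)[OF p0 xsP(1) power_mem[OF xsP(1)], of i] x(1) by auto
    qed (use primeideal_ring_onD(5)[OF p0] in simp)
    have "rest * x + lower \<in> p 0"
      using primeideal_ring_onD(6)[OF p0 _ _ prod] pow xsP restP lowerP
      by (auto intro: power_mem add_mem mult_mem)
    then have 1: "rest * x + lower \<in> p (Suc 0)" using x(3) by auto
    have "(- rest) * x \<in> p (Suc 0)"
      by (rule primeideal_ring_onD(4)[OF p1 x(2)]) (rule uminus_mem[OF restP])
    from primeideal_ring_onD(3)[OF p1 1 this] have "lower \<in> p (Suc 0)" by simp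
    then show False using \<open>lower \<notin> p (Suc 0)\<close> by blast
  qed
qed

text \<open>
  Elimination: an equation in which the unknown \<open>e0\<close> occurs is solved for \<open>e0\<close>, which leaves a system
  with one unknown and one equation less.
\<close>

lemma underdetermined_system:
  fixes A :: "'e \<Rightarrow> 'b \<Rightarrow> 'k::field"
  assumes "finite B" "finite E" "card B < card E"
  shows "\<exists>c. (\<exists>e\<in>E. c e \<noteq> 0) \<and> (\<forall>b\<in>B. (\<Sum>e\<in>E. c e * A e b) = 0)"
  using assms
proof (induction B arbitrary: E A rule: finite_induct)
  case empty
  then have "E \<noteq> {}" by auto
  then show ?case by (intro exI[of _ "\<lambda>_. 1"]) auto
next
  case (insert b B)
  show ?case
  proof (cases "\<forall>e\<in>E. A e b = 0")
    case True
    have "card B < card E" using insert.prems(2) insert.hyps by simp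
    then obtain c where "\<exists>e\<in>E. c e \<noteq> 0" "\<forall>b\<in>B. (\<Sum>e\<in>E. c e * A e b) = 0"
      using insert.IH[OF insert.prems(1)] by blast
    then show ?thesis using True by (intro exI[of _ c]) simp
  next
    case False
    then obtain e0 where e0: "e0 \<in> E" "A e0 b \<noteq> 0" by blast
    define A' where "A' e b' = A e b' - A e b / A e0 b * A e0 b'" for e b'
    have "card B < card (E - {e0})" using insert.prems insert.hyps e0(1) by simp
    then obtain c' where c': "\<exists>e\<in>E - {e0}. c' e \<noteq> 0" "\<forall>b'\<in>B. (\<Sum>e\<in>E - {e0}. c' e * A' e b') = 0"
      using insert.IH[of "E - {e0}" A'] insert.prems(1) by auto
    define c where "c e = (if e = e0 then - (\<Sum>e\<in>E - {e0}. c' e * A e b) / A e0 b else c' e)" for e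
    have split: "(\<Sum>e\<in>E. c e * A e b') = (\<Sum>e\<in>E - {e0}. c' e * A e b') - (\<Sum>e\<in>E - {e0}. c' e * A e b) / A e0 b * A e0 b'" for b'
    proof -
      have "(\<Sum>e\<in>E. c e * A e b') = c e0 * A e0 b' + (\<Sum>e\<in>E - {e0}. c e * A e b')"
        by (rule sum.remove[OF insert.prems(1) e0(1)])
      also have "(\<Sum>e\<in>E - {e0}. c e * A e b') = (\<Sum>e\<in>E - {e0}. c' e * A e b')"
        by (intro sum.cong) (auto simp: c_def)
      finally show ?thesis by (simp add: c_def)
    qed
    have "(\<Sum>e\<in>E. c e * A e b') = 0" if "b' \<in> insert b B" for b'
    proof (cases "b' = b")
      case True
      then show ?thesis using e0(2) by (simp add: split)
    next
      case False
      then have "(\<Sum>e\<in>E - {e0}. c' e * A' e b') = 0" using c'(2) that by blast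
      then show ?thesis
        by (simp add: split A'_def right_diff_distrib sum_subtractf sum_distrib_right sum_divide_distrib mult.assoc)
    qed
    moreover have "\<exists>e\<in>E. c e \<noteq> 0" using c'(1) by (auto simp: c_def)
    ultimately show ?thesis by blast
  qed
qed

lemma monomial_degree_mult_bound:
  assumes "\<And>m. m \<in> keys p \<Longrightarrow> monomial_degree m \<le> a" "\<And>m. m \<in> keys q \<Longrightarrow> monomial_degree m \<le> b"
    "m \<in> keys (p * (q :: 'k::comm_ring_1 mpoly))"
  shows "monomial_degree m \<le> a + b"
proof -
  obtain k l where "m = k + l" "k \<in> keys p" "l \<in> keys q" using assms(3) keys_mult[of p q] by blast
  then show ?thesis using assms(1)[of k] assms(2)[of l] by (simp add: monomial_degree_add)
qed

lemma monomial_degree_power_bound: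
  assumes "\<And>m. m \<in> keys p \<Longrightarrow> monomial_degree m \<le> a" "m \<in> keys ((p :: 'k::comm_ring_1 mpoly) ^ e)"
  shows "monomial_degree m \<le> e * a"
  using assms(2)
proof (induction e arbitrary: m)
  case 0
  then show ?case by (simp add: monomial_degree_def split: if_splits)
next
  case (Suc e)
  then show ?case using monomial_degree_mult_bound[of p a "p ^ e" "e * a" m] assms(1) by simp
qed

lemma monomial_degree_power_product_bound:
  assumes "\<And>q m. q \<in> set qs \<Longrightarrow> m \<in> keys q \<Longrightarrow> monomial_degree m \<le> D"
    "\<And>e. e \<in> set es \<Longrightarrow> e \<le> M" "m \<in> keys (power_product qs es :: 'k::comm_ring_1 mpoly)"
  shows "monomial_degree m \<le> length qs * (M * D)"
  using assms
proof (induction qs es arbitrary: m rule: power_product.induct)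
  case (1 x xs e es)
  have "monomial_degree k \<le> M * D" if "k \<in> keys (x ^ e)" for k
  proof -
    have "monomial_degree k \<le> e * D" using 1(2) that by (intro monomial_degree_power_bound[of x D k e]) auto
    also have "\<dots> \<le> M * D" using 1(3)[of e] by (intro mult_right_mono) auto
    finally show ?thesis .
  qed
  moreover have "monomial_degree k \<le> length xs * (M * D)" if "k \<in> keys (power_product xs es)" for k
    by (rule 1(1)) (use 1(2,3) that in auto)
  ultimately have "monomial_degree m \<le> M * D + length xs * (M * D)"
    using 1(4) by (intro monomial_degree_mult_bound[of "x ^ e" "M * D" "power_product xs es" _ m]) auto
  then show ?case by simp
qed (simp_all add: monomial_degree_def split: if_splits)

lemma (in algebra_map) evaluate_power: "evaluate \<iota> g (p ^ k) = evaluate \<iota> g p ^ k"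
  by (induction k) (simp_all add: evaluate_one evaluate_mult)

lemma (in algebra_map) evaluate_power_product:
  "evaluate \<iota> g (power_product qs es) = power_product (map (evaluate \<iota> g) qs) es"
  by (induction qs es rule: power_product.induct) (simp_all add: evaluate_one evaluate_mult evaluate_power)

lemma lookup_const_mult: "lookup (const c * p) x = c * lookup p x"
  using lookup_single_mult_add[of 0 c p x] by (simp add: const_def)

context odd_cycle
begin

section \<open>The Rees algebra and its dimension\<close>

lemma ev_of_x_polynomial:
  assumes "f \<in> mpolys n"
  shows "ev f = [:f:]"
  using assms
proof (induction rule: mpolys_additive_induct)
  case (single m c)
  have "lookup m (n + j) = 0" for j using single by (auto simp: in_keys_iff)
  then have "x_image m = m" "y_degree m = 0"
    using single by (auto simp: y_degree_def x_exponent_def intro!: x_image_eqI)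
  moreover have "keys m \<subseteq> {..<2 * n}" using single by auto
  ultimately show ?case by (simp add: ev_single monom_0)
qed (simp_all add: coeffs.evaluate_add)

lemma unital_image: "unital_subring (ev ` R)"
proof
  show "0 \<in> ev ` R" by (rule image_eqI[of _ _ 0]) simp_all
  show "1 \<in> ev ` R" by (rule image_eqI[of _ _ 1]) (simp_all add: coeffs.evaluate_one)
  show "p - q \<in> ev ` R" if "p \<in> ev ` R" "q \<in> ev ` R" for p q
    using that by (auto simp: mpolys_diff simp flip: coeffs.evaluate_diff)
  show "p * q \<in> ev ` R" if "p \<in> ev ` R" "q \<in> ev ` R" for p q
    using that by (auto simp: mpolys_mult simp flip: coeffs.evaluate_mult)
qed

interpretation image: unital_subring "ev ` R" by (rule unital_image)

lemma mpolys_n_subset: "mpolys n \<subseteq> (R :: 'k mpoly set)" by (rule mpolys_mono) simp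

lemma path_monomial_in: "path_monomial n (n - 2) j \<in> mpolys n"
  using keys_path_exponent[of j] by (auto simp: path_monomial_eq path_exponent_def intro: single_in_mpolys)

lemma ev_y: "j < n \<Longrightarrow> ev (var (n + j)) = Polynomial.monom (path_monomial n (n - 2) j) 1"
  by (simp add: coeffs.evaluate_var gens_nth(2) path_monomial_eq path_exponent_def)

lemma monom_in_image:
  assumes "f \<in> cycle_path_ideal n (n - 2)"
  shows "f \<in> mpolys n \<and> Polynomial.monom f 1 \<in> ev ` R"
proof -
  define A where "A = {f \<in> (mpolys n :: 'k mpoly set). Polynomial.monom f 1 \<in> ev ` R}"
  have "mpolys.is_ideal n A"
    unfolding mpolys.is_ideal_def
  proof (intro conjI ballI)
    show "A \<subseteq> mpolys n" by (auto simp: A_def)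
    show "0 \<in> A" using image.zero_mem by (simp add: A_def)
    show "x - y \<in> A" if "x \<in> A" "y \<in> A" for x y
      using that image.diff_mem by (auto simp: A_def mpolys_diff simp flip: diff_monom)
    show "p * x \<in> A" if "x \<in> A" "p \<in> mpolys n" for p x
    proof -
      have "ev p * Polynomial.monom x 1 \<in> ev ` R"
      proof (rule image.mult_mem)
        show "ev p \<in> ev ` R" using that(2) mpolys_n_subset by (intro imageI) auto
        show "Polynomial.monom x 1 \<in> ev ` R" using that(1) unfolding A_def by blast
      qed
      then have "[:p:] * Polynomial.monom x 1 \<in> ev ` R" unfolding ev_of_x_polynomial[OF that(2)] .
      then show ?thesis using that by (simp add: A_def mpolys_mult smult_monom)
    qed
  qed
  then have "ideal A (ring_on (mpolys n))" by (rule mpolys.ideal_ring_on)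
  moreover have "path_monomial n (n - 2) ` {..<n} \<subseteq> A"
  proof
    fix f :: "'k mpoly" assume "f \<in> path_monomial n (n - 2) ` {..<n}"
    then obtain j where j: "j < n" "f = path_monomial n (n - 2) j" by auto
    have "ev (var (n + j)) \<in> ev ` R" using j(1) by (intro imageI var_in_mpolys) simp
    then show "f \<in> A" using ev_y[OF j(1)] path_monomial_in by (simp add: A_def j(2))
  qed
  moreover have "ring (ring_on (mpolys n :: 'k mpoly set))"
    using mpolys.cring_ring_on by (rule cring.axioms(1))
  ultimately have "cycle_path_ideal n (n - 2) \<subseteq> A"
    unfolding cycle_path_ideal_def by (intro ring.genideal_minimal)
  then show ?thesis using assms by (auto simp: A_def)
qed

lemma path_monomial_in_ideal: "j < n \<Longrightarrow> path_monomial n (n - 2) j \<in> (cycle_path_ideal n (n - 2) :: 'k mpoly set)"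
proof -
  have "ring (ring_on (mpolys n :: 'k mpoly set))"
    using mpolys.cring_ring_on by (rule cring.axioms(1))
  then have "path_monomial n (n - 2) ` {..<n} \<subseteq> (cycle_path_ideal n (n - 2) :: 'k mpoly set)"
    unfolding cycle_path_ideal_def using path_monomial_in by (intro ring.genideal_self) auto
  then show "j < n \<Longrightarrow> ?thesis" by auto
qed

lemma rees_algebra_eq_image: "rees_algebra (mpolys n) (cycle_path_ideal n (n - 2)) = ev ` R"
proof
  define H :: "'k mpoly poly set" where
    "H = {[:f:] | f. f \<in> mpolys n} \<union> {Polynomial.monom f 1 | f. f \<in> cycle_path_ideal n (n - 2)}"
  define G where "G = generate_ring (ring_on UNIV) H"
  interpret univ: unital_subring "UNIV :: 'k mpoly poly set" by unfold_locales auto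
  have G: "rees_algebra (mpolys n) (cycle_path_ideal n (n - 2)) = G"
    by (simp add: rees_algebra_def G_def H_def)
  have H: "H \<subseteq> ev ` R"
  proof
    fix h assume "h \<in> H"
    then consider f where "h = [:f:]" "f \<in> mpolys n" | f where "h = Polynomial.monom f 1" "f \<in> cycle_path_ideal n (n - 2)"
      by (auto simp: H_def)
    then show "h \<in> ev ` R"
    proof cases
      case 1
      then have "h = ev f" using ev_of_x_polynomial by simp
      then show ?thesis using 1(2) mpolys_n_subset by auto
    next
      case 2
      then show ?thesis using monom_in_image by blast
    qed
  qed
  have "h \<in> ev ` R" if "h \<in> G" for h
    using that unfolding G_def
  proof induction
    case (a_inv h)
    then show ?case using univ.a_inv_ring_on[of h] image.uminus_mem H by auto
  qed (use H image.add_mem image.mult_mem image.one_mem in auto)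
  then show "rees_algebra (mpolys n) (cycle_path_ideal n (n - 2)) \<subseteq> ev ` R" unfolding G by blast
  have incl: "h \<in> G" if "h \<in> H" for h using that unfolding G_def by (rule generate_ring.incl)
  have one: "1 \<in> G" using generate_ring.one[of "ring_on UNIV" H] by (simp add: G_def)
  have add: "x + y \<in> G" if "x \<in> G" "y \<in> G" for x y
    using generate_ring.eng_add[of x "ring_on UNIV" H y] that by (simp add: G_def)
  have mult: "x * y \<in> G" if "x \<in> G" "y \<in> G" for x y
    using generate_ring.eng_mult[of x "ring_on UNIV" H y] that by (simp add: G_def)
  have const: "[:const c:] \<in> G" for c by (intro incl) (auto simp: H_def)
  have gens: "gens ! i \<in> G" if "i < 2 * n" for i
  proof (cases "i < n")
    case True
    have "[:var i:] \<in> G" using True by (intro incl) (auto simp: H_def var_in_mpolys)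
    then show ?thesis using gens_nth(1)[OF True] by (simp add: monom_0 var_def)
  next
    case False
    have "Polynomial.monom (path_monomial n (n - 2) (i - n)) 1 \<in> G"
      using False that path_monomial_in_ideal[of "i - n"] by (intro incl) (auto simp: H_def)
    then show ?thesis using False that gens_nth(2)[of "i - n"] by (simp add: path_monomial_eq path_exponent_def)
  qed
  have pow: "x ^ k \<in> G" if "x \<in> G" for x k by (induction k) (auto intro: one mult that)
  have prod: "(\<Prod>i\<in>A. gens ! i ^ f i) \<in> G" if "finite A" "A \<subseteq> {..<2 * n}" for A f
    using that by (induction A rule: finite_induct) (auto intro!: one mult pow gens)
  have "ev p \<in> G" if "p \<in> R" for p
    using that
  proof (induction rule: mpolys_additive_induct)
    case zero
    have "[:const 0:] \<in> G" by (rule const)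
    then have "0 \<in> G" by (simp add: const_def)
    then show ?case by simp
  next
    case (single m c)
    then show ?case by (auto simp: coeffs.evaluate_single simp del: mult_pCons_left intro!: mult const prod)
  qed (auto simp: coeffs.evaluate_add intro: add)
  then show "ev ` R \<subseteq> rees_algebra (mpolys n) (cycle_path_ideal n (n - 2))" unfolding G by blast
qed

text \<open>
  Primes that contain the kernel of a surjective ring homomorphism correspond to primes of its image.
\<close>

lemma primeideal_image:
  assumes T: "mpolys.is_ideal (2 * n) T" and sub: "presentation_ideal \<subseteq> T" and one: "1 \<notin> T"
    and prime: "\<And>p q. p \<in> R \<Longrightarrow> q \<in> R \<Longrightarrow> p * q \<in> T \<Longrightarrow> p \<in> T \<or> q \<in> T"
  shows "primeideal (ev ` T) (ring_on (ev ` R))"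
proof -
  have pull: "p \<in> T" if pT: "ev p \<in> ev ` T" and pR: "p \<in> R" for p
  proof -
    obtain t where t: "t \<in> T" "ev p = ev t" using pT by auto
    then have "p - t \<in> presentation_ideal"
      using kernel_ev[of "p - t"] mpolys.is_idealD(1)[OF T] pR by (auto simp: coeffs.evaluate_diff mpolys_diff)
    then have "(p - t) + t \<in> T" using sub t(1) by (intro mpolys.is_idealD(4)[OF T]) auto
    then show ?thesis by simp
  qed
  show ?thesis
  proof (rule image.primeideal_ring_on)
    show "image.is_ideal (ev ` T)"
      unfolding image.is_ideal_def
    proof (intro conjI ballI)
      show "ev ` T \<subseteq> ev ` R" using mpolys.is_idealD(1)[OF T] by auto
      show "0 \<in> ev ` T" using mpolys.is_idealD(2)[OF T] by (intro image_eqI[of _ _ 0]) auto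
      show "x - y \<in> ev ` T" if "x \<in> ev ` T" "y \<in> ev ` T" for x y
        using that mpolys.is_idealD(3)[OF T] by (auto simp flip: coeffs.evaluate_diff)
      show "p * x \<in> ev ` T" if "x \<in> ev ` T" "p \<in> ev ` R" for p x
        using that mpolys.is_idealD(5)[OF T] by (auto simp flip: coeffs.evaluate_mult)
    qed
    show "1 \<notin> ev ` T" using pull[of 1] one by (auto simp: coeffs.evaluate_one)
    show "x \<in> ev ` T \<or> y \<in> ev ` T" if xy: "x \<in> ev ` R" "y \<in> ev ` R" "x * y \<in> ev ` T" for x y
    proof -
      obtain p q where pq: "p \<in> R" "q \<in> R" "x = ev p" "y = ev q" using xy(1,2) by auto
      then have "p * q \<in> T" using xy(3) by (intro pull) (auto simp: coeffs.evaluate_mult mpolys_mult)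
      then show ?thesis using prime[OF pq(1,2)] pq(3,4) by auto
    qed
  qed
qed

text \<open>The ideal of \<open>R\<close> generated by the variables with index below \<open>t\<close>.\<close>

definition variable_ideal :: "nat \<Rightarrow> 'k mpoly set" where
  "variable_ideal t = {p \<in> R. \<forall>m\<in>keys p. \<exists>i\<in>keys m. i < t}"

definition kill_variables :: "nat \<Rightarrow> 'k mpoly \<Rightarrow> 'k mpoly" where
  "kill_variables t p = (\<Sum>m\<in>keys p. if \<exists>i\<in>keys m. i < t then 0 else Poly_Mapping.single m (lookup p m))"

lemma kill_variables_single:
  "kill_variables t (Poly_Mapping.single m c) = (if \<exists>i\<in>keys m. i < t then 0 else Poly_Mapping.single m c)"
  by (simp add: kill_variables_def)

lemma kill_variables_add: "kill_variables t (p + q) = kill_variables t p + kill_variables t q"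
  unfolding kill_variables_def by (rule setsum_keys_plus_distrib) (auto simp: single_add)

lemma kill_variables_zero [simp]: "kill_variables t 0 = 0" by (simp add: kill_variables_def)

lemma kill_variables_mult: "kill_variables t (p * q) = kill_variables t p * kill_variables t q"
proof (induction p rule: mpoly_additive_induct)
  case (single m c)
  show ?case
  proof (induction q rule: mpoly_additive_induct)
    case (single k d)
    then show ?case by (auto simp: mult_single kill_variables_single keys_plus_nat)
  qed (simp_all add: distrib_left kill_variables_add)
qed (simp_all add: distrib_right kill_variables_add)

lemma lookup_kill_variables:
  "lookup (kill_variables t p) m = (if \<exists>i\<in>keys m. i < t then 0 else lookup p m)"
proof -
  have "lookup (kill_variables t p) m = (\<Sum>k\<in>keys p. if k = m then (if \<exists>i\<in>keys m. i < t then 0 else lookup p m) else 0)"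
    unfolding kill_variables_def lookup_sum by (intro sum.cong) (auto simp: lookup_single when_def)
  then show ?thesis by (auto simp: in_keys_iff)
qed

lemma variable_ideal_iff: "p \<in> R \<Longrightarrow> p \<in> variable_ideal t \<longleftrightarrow> kill_variables t p = 0"
proof -
  assume p: "p \<in> R"
  have "kill_variables t p = 0 \<longleftrightarrow> (\<forall>m. lookup (kill_variables t p) m = 0)"
    using poly_mapping_eqI[of "kill_variables t p" 0] by auto
  also have "\<dots> \<longleftrightarrow> (\<forall>m\<in>keys p. \<exists>i\<in>keys m. i < t)"
    unfolding lookup_kill_variables
  proof (intro iffI ballI allI)
    fix m assume "\<forall>m. (if \<exists>i\<in>keys m. i < t then 0 else lookup p m) = 0" "m \<in> keys p"
    then have "(if \<exists>i\<in>keys m. i < t then 0 else lookup p m) = 0" "lookup p m \<noteq> 0"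
      by (simp_all add: in_keys_iff)
    then show "\<exists>i\<in>keys m. i < t" by presburger
  next
    fix m assume "\<forall>m\<in>keys p. \<exists>i\<in>keys m. i < t"
    then show "(if \<exists>i\<in>keys m. i < t then 0 else lookup p m) = 0"
      using in_keys_iff[of m p] by auto
  qed
  finally show ?thesis using p unfolding variable_ideal_def by blast
qed

lemma kill_variables_diff: "kill_variables t (p - q) = kill_variables t p - kill_variables t q"
  using kill_variables_add[of t "p - q" q] by simp

lemma ideal_variable_ideal: "mpolys.is_ideal (2 * n) (variable_ideal t)"
  unfolding mpolys.is_ideal_def
proof (intro conjI ballI)
  show sub: "variable_ideal t \<subseteq> R" by (auto simp: variable_ideal_def)
  show "0 \<in> variable_ideal t" by (simp add: variable_ideal_def)
  show "x - y \<in> variable_ideal t" if "x \<in> variable_ideal t" "y \<in> variable_ideal t" for x y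
  proof -
    have R: "x \<in> R" "y \<in> R" using that sub by auto
    show ?thesis
      using that variable_ideal_iff[OF R(1)] variable_ideal_iff[OF R(2)] variable_ideal_iff[OF mpolys_diff[OF R]]
      by (simp add: kill_variables_diff)
  qed
  show "p * x \<in> variable_ideal t" if "x \<in> variable_ideal t" "p \<in> R" for p x
  proof -
    have R: "x \<in> R" using that sub by auto
    show ?thesis
      using that variable_ideal_iff[OF R] variable_ideal_iff[OF mpolys_mult[OF that(2) R]]
      by (simp add: kill_variables_mult)
  qed
qed

lemma rel_in_variable_ideal: "n \<le> t \<Longrightarrow> rel a \<in> variable_ideal t"
  unfolding rel_def
proof (intro mpolys.is_idealD(3)[OF ideal_variable_ideal])
  assume t: "n \<le> t"
  have *: "mon (expo (x_index b) + expo (y_index c)) \<in> variable_ideal t" for b c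
    using t x_index_less[of b] index_less keys_bounds
    by (auto simp: variable_ideal_def keys_plus_nat intro!: single_in_mpolys bexI[of _ "x_index b"])
  show "mon (lhs a) \<in> variable_ideal t" "mon (rhs a) \<in> variable_ideal t"
    unfolding lhs_def rhs_def by (rule *)+
qed

lemma C_subset_variable_ideal:
  assumes "n \<le> t"
  shows "C i \<subseteq> variable_ideal t"
  unfolding C_def
proof (induction i)
  case 0
  then show ?case using mpolys.is_idealD(2)[OF ideal_variable_ideal] by simp
next
  case (Suc i)
  show ?case
  proof
    fix p assume "p \<in> mpolys.partial_ideal (2 * n) rels (Suc i)"
    then obtain p' q where "p = p' + q * rels i" "p' \<in> mpolys.partial_ideal (2 * n) rels i" "q \<in> R"
      by (rule mpolys.partial_ideal_SucE)
    then show "p \<in> variable_ideal t"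
      using Suc.IH rel_in_variable_ideal[OF assms]
      by (auto intro!: mpolys.is_idealD(4)[OF ideal_variable_ideal] mpolys.is_idealD(5)[OF ideal_variable_ideal])
  qed
qed

lemma presentation_subset_variable_ideal: "n \<le> t \<Longrightarrow> presentation_ideal \<subseteq> variable_ideal t"
  using C_subset_variable_ideal rel_in_variable_ideal
  by (auto simp: presentation_ideal_def intro!: mpolys.is_idealD(4)[OF ideal_variable_ideal]
      mpolys.is_idealD(5)[OF ideal_variable_ideal])

lemma one_notin_variable_ideal: "1 \<notin> variable_ideal t"
  by (simp add: variable_ideal_def)

text \<open>
  Setting the first \<open>t\<close> variables to zero is a ring homomorphism into a domain, and it kills
  exactly this ideal.
\<close>

lemma primeideal_variable_ideal: "n \<le> t \<Longrightarrow> primeideal (ev ` variable_ideal t) (ring_on (ev ` R))"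
proof (rule primeideal_image[OF ideal_variable_ideal presentation_subset_variable_ideal one_notin_variable_ideal])
  fix p q :: "'k mpoly" assume "p \<in> R" "q \<in> R" "p * q \<in> variable_ideal t"
  then show "p \<in> variable_ideal t \<or> q \<in> variable_ideal t"
    using variable_ideal_iff[of "p * q" t] variable_ideal_iff[of p t] variable_ideal_iff[of q t]
    by (simp add: kill_variables_mult mpolys_mult)
qed

lemma primeideal_zero: "primeideal {0} (ring_on (ev ` R))"
  using image.is_ideal_zero by (rule image.primeideal_ring_on) auto

lemma var_in_variable_ideal: "i < 2 * n \<Longrightarrow> var i \<in> variable_ideal t \<longleftrightarrow> i < t"
  by (auto simp: variable_ideal_def var_in_mpolys) (auto simp: var_def)

lemma variable_ideal_image_strict:
  assumes "n \<le> t" "t < 2 * n"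
  shows "ev ` variable_ideal t \<subset> ev ` variable_ideal (Suc t)"
proof
  show "ev ` variable_ideal t \<subseteq> ev ` variable_ideal (Suc t)"
    unfolding variable_ideal_def using less_SucI by (intro image_mono) blast
  show "ev ` variable_ideal t \<noteq> ev ` variable_ideal (Suc t)"
  proof
    assume eq: "ev ` variable_ideal t = ev ` variable_ideal (Suc t)"
    have "ev (var t) \<in> ev ` variable_ideal (Suc t)" using assms by (intro imageI) (simp add: var_in_variable_ideal)
    then obtain r where r: "r \<in> variable_ideal t" "ev (var t) = ev r" using eq by auto
    have "var t - r \<in> R" using r(1) assms(2) by (intro mpolys_diff var_in_mpolys) (auto simp: variable_ideal_def)
    then have "var t - r \<in> variable_ideal t"
      using kernel_ev[of "var t - r"] presentation_subset_variable_ideal[OF assms(1)] r(2)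
      by (auto simp: coeffs.evaluate_diff)
    then have "(var t - r) + r \<in> variable_ideal t"
      using r(1) by (intro mpolys.is_idealD(4)[OF ideal_variable_ideal])
    then show False using assms by (simp add: var_in_variable_ideal)
  qed
qed

lemma zero_strict: "{0} \<subset> ev ` variable_ideal n"
proof
  show "{0} \<subseteq> ev ` variable_ideal n"
    using mpolys.is_idealD(2)[OF ideal_variable_ideal] by (auto intro!: image_eqI[of _ _ 0])
  have "ev (var 0) \<in> ev ` variable_ideal n" using n_gt_1 by (intro imageI) (simp add: var_in_variable_ideal)
  moreover have "ev (var 0) \<noteq> 0"
  proof -
    have "lookup (var 0 :: 'k mpoly) (expo 0) = 1" by (simp add: var_def)
    then have "(var 0 :: 'k mpoly) \<noteq> 0" by auto
    then show ?thesis using n_gt_1 ev_of_x_polynomial[of "var 0"] by (simp add: var_in_mpolys)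
  qed
  ultimately show "{0} \<noteq> ev ` variable_ideal n" by auto
qed

text \<open>
  Products of powers, with exponents below \<open>M\<close>, of \<open>n + 2\<close> elements: there are \<open>M\<^sup>n\<^sup>+\<^sup>2\<close> of them,
  and their coefficients lie in a box of size \<open>O(M\<^sup>n\<^sup>+\<^sup>1)\<close>.
\<close>

lemma algebraic_dependence:
  fixes qs :: "'k mpoly list"
  assumes qs: "set qs \<subseteq> R" "length qs = n + 2"
  shows "\<exists>E c e0. finite E \<and> (\<forall>e\<in>E. length e = n + 2) \<and> e0 \<in> E \<and> c e0 \<noteq> 0 \<and>
    (\<Sum>e\<in>E. [:const (c e):] * power_product (map ev qs) e) = 0"
proof -
  define D where "D = Max (insert 0 (\<Union>q\<in>set qs. monomial_degree ` keys q))"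
  have D: "monomial_degree m \<le> D" if "q \<in> set qs" "m \<in> keys q" for q m
    unfolding D_def by (rule Max_ge) (use that in auto)
  \<comment> \<open>This makes \<open>(B + 1)\<^sup>n\<^sup>+\<^sup>1 < M\<^sup>n\<^sup>+\<^sup>2\<close>, where \<open>B\<close> bounds the degrees of the products.\<close>
  define M where "M = ((n + 2) * D + 1) ^ (n + 1) + 1"
  define B where "B = (n + 2) * (M * D)"
  define E where "E = {e. set e \<subseteq> {..<M} \<and> length e = n + 2}"
  \<comment> \<open>A list codes a coefficient: the power of \<open>s\<close>, followed by the exponents of the variables.\<close>
  define Bx where "Bx = {b. set b \<subseteq> {..B} \<and> length b = n + 1}"
  define X where "X b = (\<Sum>i<n. Poly_Mapping.single i (b ! Suc i))" for b :: "nat list"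
  have "card Bx = (B + 1) ^ (n + 1)" unfolding Bx_def by (subst card_lists_length_eq) auto
  also have "\<dots> \<le> (M * ((n + 2) * D + 1)) ^ (n + 1)"
    by (intro power_mono) (auto simp: B_def M_def algebra_simps)
  also have "\<dots> = M ^ (n + 1) * ((n + 2) * D + 1) ^ (n + 1)" by (rule power_mult_distrib)
  also have "\<dots> < M ^ (n + 1) * M" by (intro mult_strict_left_mono) (auto simp: M_def)
  also have "\<dots> = M ^ (n + 2)" by simp
  also have "\<dots> = card E" unfolding E_def by (subst card_lists_length_eq) auto
  finally have card: "card Bx < card E" .
  have fin: "finite E" "finite Bx" unfolding E_def Bx_def by (auto intro: finite_lists_length_eq)
  define q where "q e = power_product qs e" for e
  have qR: "q e \<in> R" for e unfolding q_def using qs(1) by (rule mpolys.power_product_mem)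
  obtain c where c: "\<exists>e\<in>E. c e \<noteq> 0"
    "\<forall>b\<in>Bx. (\<Sum>e\<in>E. c e * lookup (Polynomial.coeff (ev (q e)) (b ! 0)) (X b)) = 0"
    using underdetermined_system[OF fin(2,1) card, of "\<lambda>e b. lookup (Polynomial.coeff (ev (q e)) (b ! 0)) (X b)"]
    by blast
  have deg: "monomial_degree m \<le> B" if "e \<in> E" "m \<in> keys (q e)" for e m
  proof -
    have "x \<le> M" if "x \<in> set e" for x using \<open>e \<in> E\<close> that by (auto simp: E_def)
    then have "monomial_degree m \<le> length qs * (M * D)"
      using D \<open>m \<in> keys (q e)\<close> unfolding q_def by (intro monomial_degree_power_product_bound[of qs D e M])
    then show ?thesis by (simp only: B_def qs(2))
  qed
  have "lookup (Polynomial.coeff (\<Sum>e\<in>E. [:const (c e):] * ev (q e)) d) x = 0" for d x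
  proof -
    have eq: "lookup (Polynomial.coeff (\<Sum>e\<in>E. [:const (c e):] * ev (q e)) d) x =
      (\<Sum>e\<in>E. c e * lookup (Polynomial.coeff (ev (q e)) d) x)"
      by (simp add: coeff_sum lookup_sum lookup_const_mult)
    show ?thesis
    proof (cases "\<exists>e\<in>E. lookup (Polynomial.coeff (ev (q e)) d) x \<noteq> 0")
      case True
      then obtain e where e: "e \<in> E" "lookup (Polynomial.coeff (ev (q e)) d) x \<noteq> 0" by blast
      have "\<exists>m\<in>keys (q e). x_image m = x \<and> y_degree m = d"
      proof (rule ccontr)
        assume "\<not> ?thesis"
        then have "(\<Sum>m\<in>keys (q e). if x_image m = x \<and> y_degree m = d then lookup (q e) m else 0) = 0"
          by (intro sum.neutral) auto
        then show False using e(2) unfolding lookup_coeff_ev[OF qR] by blast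
      qed
      then obtain m where m: "m \<in> keys (q e)" "x_image m = x" "y_degree m = d" by blast
      have mB: "monomial_degree m \<le> B" by (rule deg[OF e(1) m(1)])
      have km: "keys m \<subseteq> {..<2 * n}" by (rule keys_in_mpolys[OF qR m(1)])
      have total: "lookup m i + y_degree m \<le> monomial_degree m" if "i < n" for i
      proof -
        have "lookup m i + y_degree m = (\<Sum>j\<in>insert i ((+) n ` {..<n}). lookup m j)"
          using that by (subst sum.insert) (auto simp: y_degree_def sum.reindex)
        also have "\<dots> \<le> (\<Sum>j\<in>insert i ((+) n ` {..<n}) \<union> keys m. lookup m j)"
          by (intro sum_mono2) auto
        also have "\<dots> = monomial_degree m"
          unfolding monomial_degree_def by (intro sum.mono_neutral_right) (auto simp: in_keys_iff)
        finally show ?thesis .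
      qed
      have path_le: "lookup (path_exponent j) i \<le> 1" for i j
        using arg_cong[OF path_exponent_complement[of j], of "\<lambda>p. lookup p i"]
        by (auto simp: lookup_add lookup_sum lookup_single when_def split: if_splits)
      have "x_exponent m i \<le> lookup m i + y_degree m" for i
        unfolding x_exponent_def y_degree_def
        by (intro add_left_mono sum_mono) (use path_le mult_le_mono2 in fastforce)
      then have xB: "x_exponent m i \<le> B" if "i < n" for i using total[OF that] mB le_trans by blast
      define b where "b = y_degree m # map (x_exponent m) [0..<n]"
      have "y_degree m \<le> B" using total[of 0] mB n_gt_1 by simp
      then have "b \<in> Bx" using xB by (auto simp: b_def Bx_def)
      moreover have "X b = x" using m(2) by (simp add: X_def b_def x_image_def)
      moreover have "b ! 0 = d" using m(3) by (simp add: b_def)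
      ultimately show ?thesis unfolding eq using c(2) by blast
    next
      case False
      then show ?thesis unfolding eq by (intro sum.neutral) auto
    qed
  qed
  then have "(\<Sum>e\<in>E. [:const (c e):] * ev (q e)) = 0"
    by (intro poly_eqI poly_mapping_eqI) simp
  then have "(\<Sum>e\<in>E. [:const (c e):] * power_product (map ev qs) e) = 0"
    unfolding q_def coeffs.evaluate_power_product .
  then show ?thesis using c(1) fin(1) unfolding E_def by blast
qed

text \<open>
  The primes \<open>{0} \<subset> (X) \<subset> (X, Y\<^sub>0) \<subset> ...\<close> give the lower bound, where \<open>X\<close> stands for all the variables of
  the polynomial ring. A chain of length \<open>n + 2\<close> would contain \<open>n + 2\<close> algebraically independent elements.
\<close>

lemma krull_dim_image: "krull_dim (ring_on (ev ` R)) = enat (n + 1)"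
  unfolding krull_dim_def
proof (rule antisym)
  show "Sup {enat l | l. \<exists>p. (\<forall>i\<le>l. primeideal (p i) (ring_on (ev ` R))) \<and> (\<forall>i<l. p i \<subset> p (Suc i))} \<le> enat (n + 1)"
  proof (rule Sup_least)
    fix d assume "d \<in> {enat l | l. \<exists>p. (\<forall>i\<le>l. primeideal (p i) (ring_on (ev ` R))) \<and> (\<forall>i<l. p i \<subset> p (Suc i))}"
    then obtain l p where d: "d = enat l" and p: "\<And>i. i \<le> l \<Longrightarrow> primeideal (p i) (ring_on (ev ` R))"
      and chain: "\<And>i. i < l \<Longrightarrow> p i \<subset> p (Suc i)" by blast
    have "l \<le> n + 1"
    proof (rule ccontr)
      assume l: "\<not> l \<le> n + 1"
      have "\<exists>q. i < n + 2 \<longrightarrow> q \<in> R \<and> ev q \<in> p (Suc i) - p i" for i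
      proof (cases "i < n + 2")
        case True
        then have "i < l" using l by simp
        then obtain y where "y \<in> p (Suc i) - p i" using chain[of i] by blast
        moreover have "p (Suc i) \<subseteq> ev ` R" using image.primeideal_ring_onD(1)[OF p[of "Suc i"]] \<open>i < l\<close> by simp
        ultimately show ?thesis by blast
      qed blast
      then have "\<forall>i. \<exists>q. i < n + 2 \<longrightarrow> q \<in> R \<and> ev q \<in> p (Suc i) - p i" by blast
      then obtain q where q: "\<And>i. i < n + 2 \<Longrightarrow> q i \<in> R \<and> ev (q i) \<in> p (Suc i) - p i"
        unfolding choice_iff by blast
      define qs where "qs = map q [0..<n + 2]"
      have qs: "set qs \<subseteq> R" "length qs = n + 2" using q by (auto simp: qs_def)
      obtain E c e0 where E: "finite E" "\<And>e. e \<in> E \<Longrightarrow> length e = n + 2" "e0 \<in> E" "c e0 \<noteq> 0"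
        "(\<Sum>e\<in>E. [:const (c e):] * power_product (map ev qs) e) = 0"
        using algebraic_dependence[OF qs] by (elim exE conjE) simp
      have "(\<Sum>e\<in>E. [:const (c e):] * power_product (map ev qs) e) \<notin> p 0"
      proof (rule chain_algebraically_independent[OF unital_image coeffs.algebra_map_axioms])
        show "range (\<lambda>c. [:const c:]) \<subseteq> ev ` R"
        proof (rule image_subsetI)
          fix c
          show "[:const c:] \<in> ev ` R"
            using imageI[OF const_in_mpolys[of c "2 * n"], of ev] by (simp add: coeffs.evaluate_const)
        qed
        show "primeideal (p i) (ring_on (ev ` R))" if "i \<le> length (map ev qs)" for i
          using p that l by (simp add: qs(2))
        show "p i \<subseteq> p (Suc i) \<and> map ev qs ! i \<in> p (Suc i) - p i" if "i < length (map ev qs)" for i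
          using chain[of i] q[of i] that l by (auto simp: qs_def simp del: upt_Suc)
      qed (use E qs in auto)
      moreover have "0 \<in> p 0" using image.primeideal_ring_onD(2)[OF p[of 0]] by simp
      ultimately show False using E(5) by simp
    qed
    then show "d \<le> enat (n + 1)" by (simp add: d)
  qed
  show "enat (n + 1) \<le> Sup {enat l | l. \<exists>p. (\<forall>i\<le>l. primeideal (p i) (ring_on (ev ` R))) \<and> (\<forall>i<l. p i \<subset> p (Suc i))}"
  proof (rule Sup_upper, rule CollectI, intro exI conjI allI impI)
    let ?p = "\<lambda>i. if i = 0 then {0} else ev ` variable_ideal (n + (i - 1))"
    show "enat (n + 1) = enat (n + 1)" by simp
    show "primeideal (?p i) (ring_on (ev ` R))" for i
      using primeideal_zero primeideal_variable_ideal by simp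
    show "?p i \<subset> ?p (Suc i)" if "i < n + 1" for i
      using zero_strict variable_ideal_image_strict[of "n + (i - 1)"] that by (cases i) auto
  qed
qed

end

section \<open>From functions to matrices\<close>

definition entries_of :: "nat \<Rightarrow> 'r::zero vec \<Rightarrow> nat \<Rightarrow> 'r" where
  "entries_of r v = (\<lambda>i. if i < r then v $ i else 0)"

lemma vec_in_poly_vecs: "f \<in> cvecs (mpolys N) r \<Longrightarrow> vec r f \<in> poly_vecs N r"
  by (auto simp: cvecs_def poly_vecs_def)

lemma entries_of_in_cvecs: "v \<in> poly_vecs N r \<Longrightarrow> entries_of r v \<in> cvecs (mpolys N) r"
  by (auto simp: cvecs_def poly_vecs_def entries_of_def)

lemma vec_entries_of: "v \<in> carrier_vec r \<Longrightarrow> vec r (entries_of r v) = v"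
  by (auto simp: entries_of_def)

lemma poly_vecs_eq: "poly_vecs N r = vec r ` cvecs (mpolys N) r"
proof
  show "poly_vecs N r \<subseteq> vec r ` cvecs (mpolys N) r"
  proof
    fix v assume v: "v \<in> poly_vecs N r"
    then have "v = vec r (entries_of r v)" by (simp add: vec_entries_of poly_vecs_def)
    then show "v \<in> vec r ` cvecs (mpolys N) r" using entries_of_in_cvecs[OF v] by (rule image_eqI)
  qed
qed (auto intro: vec_in_poly_vecs)

lemma entries_of_vec: "f \<in> cvecs P r \<Longrightarrow> entries_of r (vec r f) = f"
  by (auto simp: entries_of_def cvecs_def)

lemma mat_mult_vec: "mat r c (\<lambda>(i, j). A i j) *\<^sub>v vec c f = vec r (mat_apply r c A f)"
  by (rule eq_vecI) (auto simp: scalar_prod_def mat_apply_def atLeast0LessThan intro!: sum.cong)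

lemma transpose_mat_of: "transpose_mat (mat r c (\<lambda>(i, j). A i j)) = mat c r (\<lambda>(i, j). A j i)"
  by (rule eq_matI) auto

lemma vec_mapply_eq_0: "vec r (mat_apply r c A f) = 0\<^sub>v r \<longleftrightarrow> mat_apply r c A f = (\<lambda>i. 0)"
  by (auto simp: vec_eq_iff fun_eq_iff mat_apply_def)

context free_resolution
begin

lemma coboundaries_zero: "coboundaries k {0} = dual_images k"
proof -
  have "v \<in> dual_images k" if "u \<in> dual_images k" "\<forall>j. v j - u j = 0" for u v
  proof -
    have "v = u" using that(2) by auto
    then show ?thesis using that(1) by simp
  qed
  then show ?thesis by (auto simp: coboundaries_def dual_images_cvecs)
qed

end

lemma matrix_generators_iff:
  fixes Z B :: "(nat \<Rightarrow> 'k::comm_ring_1 mpoly) set"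
  assumes Z: "Z \<subseteq> cvecs (mpolys N) r" and B: "B \<subseteq> cvecs (mpolys N) r"
  shows "(\<exists>G\<in>poly_mats N r t. (\<forall>j<t. col G j \<in> vec r ` Z) \<and>
      (\<forall>z\<in>vec r ` Z. \<exists>w\<in>poly_vecs N t. \<exists>y\<in>vec r ` B. z = G *\<^sub>v w + y)) \<longleftrightarrow>
    mpolys.generated_by N t Z B"
proof
  assume "\<exists>G\<in>poly_mats N r t. (\<forall>j<t. col G j \<in> vec r ` Z) \<and>
      (\<forall>z\<in>vec r ` Z. \<exists>w\<in>poly_vecs N t. \<exists>y\<in>vec r ` B. z = G *\<^sub>v w + y)"
  then obtain G where G: "G \<in> poly_mats N r t" "\<forall>j<t. col G j \<in> vec r ` Z"
      "\<forall>z\<in>vec r ` Z. \<exists>w\<in>poly_vecs N t. \<exists>y\<in>vec r ` B. z = G *\<^sub>v w + y" by blast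
  have dim: "G \<in> carrier_mat r t" using G(1) by (simp add: poly_mats_def)
  define Gf where "Gf j = entries_of r (col G j)" for j
  have GZ: "Gf j \<in> Z" if "j < t" for j
  proof -
    obtain f where f: "f \<in> Z" "col G j = vec r f" using G(2) \<open>j < t\<close> by blast
    have "Gf j = f" unfolding Gf_def f(2) by (rule entries_of_vec[OF subsetD[OF Z f(1)]])
    then show ?thesis using f(1) by simp
  qed
  have "\<exists>w\<in>cvecs (mpolys N) t. (\<lambda>i. z i - (\<Sum>j<t. w j * Gf j i)) \<in> B" if z: "z \<in> Z" for z
  proof -
    obtain w y where w: "w \<in> cvecs (mpolys N) t" "y \<in> B" "vec r z = G *\<^sub>v vec t w + vec r y"
    proof -
      have "vec r z \<in> vec r ` Z" using z by (rule imageI)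
      then obtain w' y' where "w' \<in> poly_vecs N t" "y' \<in> vec r ` B" "vec r z = G *\<^sub>v w' + y'"
        using G(3) by blast
      then show ?thesis using that unfolding poly_vecs_eq by auto
    qed
    have "z i - (\<Sum>j<t. w j * Gf j i) = y i" for i
    proof (cases "i < r")
      case True
      have "z i = (G *\<^sub>v vec t w + vec r y) $ i" using True w(3) by (metis index_vec)
      also have "\<dots> = (\<Sum>j<t. G $$ (i, j) * w j) + y i"
        using True dim by (simp add: scalar_prod_def atLeast0LessThan)
      also have "(\<Sum>j<t. G $$ (i, j) * w j) = (\<Sum>j<t. w j * Gf j i)"
        using True dim by (intro sum.cong) (auto simp: Gf_def entries_of_def)
      finally show ?thesis by simp
    next
      case False
      then have "z i = 0" "y i = 0"
        using cvecs_zero[OF subsetD[OF Z z]] cvecs_zero[OF subsetD[OF B w(2)]] by auto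
      then show ?thesis using False by (simp add: Gf_def entries_of_def)
    qed
    then have "(\<lambda>i. z i - (\<Sum>j<t. w j * Gf j i)) = y" by (rule ext)
    then show ?thesis using w(1,2) by (intro bexI[of _ w]) simp_all
  qed
  then show "mpolys.generated_by N t Z B"
    unfolding mpolys.generated_by_def using GZ by (intro exI[of _ Gf]) blast
next
  assume "mpolys.generated_by N t Z B"
  then obtain G where G: "\<forall>j<t. G j \<in> Z"
      "\<forall>z\<in>Z. \<exists>w\<in>cvecs (mpolys N) t. (\<lambda>i. z i - (\<Sum>j<t. w j * G j i)) \<in> B"
    unfolding mpolys.generated_by_def by blast
  define Gm where "Gm = mat r t (\<lambda>(i, j). G j i)"
  have "G j i \<in> mpolys N" if "j < t" for j i
    using cvecs_mem[OF subsetD[OF Z]] G(1) that by auto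
  then have 1: "Gm \<in> poly_mats N r t" by (auto simp: Gm_def poly_mats_def)
  have 2: "col Gm j = vec r (G j)" if "j < t" for j
    using that by (intro eq_vecI) (auto simp: Gm_def)
  have 3: "\<exists>w\<in>poly_vecs N t. \<exists>y\<in>vec r ` B. vec r z = Gm *\<^sub>v w + y" if z: "z \<in> Z" for z
  proof -
    obtain w where w: "w \<in> cvecs (mpolys N) t" "(\<lambda>i. z i - (\<Sum>j<t. w j * G j i)) \<in> B" using G(2) z by blast
    have "vec r z = Gm *\<^sub>v vec t w + vec r (\<lambda>i. z i - (\<Sum>j<t. w j * G j i))"
      unfolding Gm_def mat_mult_vec by (rule eq_vecI) (auto simp: mat_apply_def mult.commute)
    then show ?thesis using w by (intro bexI[of _ "vec t w"] bexI) (auto intro: vec_in_poly_vecs)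
  qed
  show "\<exists>G\<in>poly_mats N r t. (\<forall>j<t. col G j \<in> vec r ` Z) \<and>
      (\<forall>z\<in>vec r ` Z. \<exists>w\<in>poly_vecs N t. \<exists>y\<in>vec r ` B. z = G *\<^sub>v w + y)"
    using 1 2 3 G(1) by (intro bexI[of _ Gm]) auto
qed

context odd_cycle
begin

section \<open>Generators of the linked ideal\<close>

lemma C_no_linear_terms:
  assumes "p \<in> C i"
  shows "lookup p (expo k) = 0"
  using assms unfolding C_def
proof (induction i arbitrary: p)
  case (Suc i)
  obtain p' q where p: "p = p' + q * rels i" "p' \<in> mpolys.partial_ideal (2 * n) rels i"
    using Suc.prems by (rule mpolys.partial_ideal_SucE)
  have "lookup (mon l * q) (expo k) = 0" if "monomial_degree l = 2" for l
  proof (rule lookup_single_mult_not_dvd)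
    fix r
    have "monomial_degree (expo k) \<noteq> monomial_degree (l + r)" by (simp only: monomial_degree_add that) simp
    then show "expo k \<noteq> l + r" by metis
  qed
  then have "lookup (mon (lhs (Suc i)) * q) (expo k) = 0" "lookup (mon (rhs (Suc i)) * q) (expo k) = 0"
    by (simp_all add: lhs_def rhs_def monomial_degree_add)
  then have "lookup (q * rels i) (expo k) = 0"
    by (simp add: rel_def right_diff_distrib lookup_minus mult.commute)
  then show ?case using Suc.IH[OF p(2)] by (simp add: p(1) lookup_add)
qed simp

lemma C_lookup_evens:
  assumes "p \<in> C i"
  shows "lookup p (evens half) = 0"
proof -
  have "evens half \<notin> keys p"
  proof
    assume "evens half \<in> keys p"
    moreover have "p \<in> variable_ideal n" using assms C_subset_variable_ideal by blast
    ultimately obtain i where "i \<in> keys (evens half)" "i < n" by (auto simp: variable_ideal_def)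
    then show False using y_index_bounds(1) by (auto simp: keys_evens) (metis not_less)
  qed
  then show ?thesis by (simp add: in_keys_iff)
qed

text \<open>
  Suppose that \<open>z = \<alpha> X\<^sub>1 + \<beta> Y\<^sub>2 Y\<^sub>4 ... Y\<^sub>n\<^sub>-\<^sub>1\<close> generates both \<open>X\<^sub>1 = w z\<close> and \<open>Y\<^sub>2 Y\<^sub>4 ... Y\<^sub>n\<^sub>-\<^sub>1 = w' z\<close>
  modulo \<open>C (n - 1)\<close>. The second equation forces a constant term of \<open>\<beta>\<close>, the first one a constant term of \<open>w\<close>, and then
  \<open>w \<beta> Y\<^sub>2 Y\<^sub>4 ... Y\<^sub>n\<^sub>-\<^sub>1\<close> contributes a term to \<open>X\<^sub>1\<close> that nothing cancels.
\<close>

lemma linked_not_principal: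
  assumes z: "z \<in> linked" and w: "w \<in> R" "w' \<in> R"
    and x1: "mon (expo (x_index 1)) - w * z \<in> C (n - 1)" and h: "mon (evens half) - w' * z \<in> C (n - 1)"
  shows False
proof -
  let ?X = "mon (expo (x_index 1)) :: 'k mpoly" and ?H = "mon (evens half) :: 'k mpoly"
  obtain \<alpha> \<beta> where ab: "\<alpha> \<in> R" "\<beta> \<in> R" "z - (\<alpha> * ?X + \<beta> * ?H) \<in> C (n - 1)"
    using z by (auto simp: linked_def)
  have subst: "p - v * (\<alpha> * ?X + \<beta> * ?H) \<in> C (n - 1)" if "p - v * z \<in> C (n - 1)" "v \<in> R" for p v
  proof -
    have "(p - v * z) + v * (z - (\<alpha> * ?X + \<beta> * ?H)) \<in> C (n - 1)" using that ab(3) by (intro C_closed(4) C_closed(5))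
    then show ?thesis by (simp add: algebra_simps)
  qed
  have "y_index (2 * 0 + 2) \<in> keys (evens half)" using half_pos unfolding keys_evens by blast
  then have y2: "y_index 2 \<in> keys (evens half)" by (simp only: mult_0_right add_0)
  have XE: "lookup (?X * p) (evens half) = 0" for p
  proof (rule lookup_single_mult_not_dvd)
    fix r
    have "x_index 1 \<in> keys (expo (x_index 1) + r)" by (simp add: keys_plus_nat)
    moreover have "x_index 1 \<notin> keys (evens half)" by (auto simp: keys_evens)
    ultimately show "evens half \<noteq> expo (x_index 1) + r" by metis
  qed
  have HX: "lookup (?H * p) (expo (x_index 1)) = 0" for p
  proof (rule lookup_single_mult_not_dvd)
    fix r
    have "y_index 2 \<in> keys (evens half + r)" using y2 by (simp add: keys_plus_nat)
    moreover have "y_index 2 \<notin> keys (expo (x_index 1))" by simp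
    ultimately show "expo (x_index 1) \<noteq> evens half + r" by metis
  qed
  have XX: "lookup (?X * p) (expo (x_index 1)) = lookup p 0" for p
    using lookup_single_mult_add[of "expo (x_index 1)" 1 p 0] by simp
  have HE: "lookup (?H * p) (evens half) = lookup p 0" for p
    using lookup_single_mult_add[of "evens half" 1 p 0] by simp
  have split: "v * (\<alpha> * ?X + \<beta> * ?H) = ?X * (v * \<alpha>) + ?H * (v * \<beta>)" for v by (simp add: algebra_simps)
  have neq: "expo (x_index 1) \<noteq> evens half" using XE[of 1] by auto
  have "lookup (?H - w' * (\<alpha> * ?X + \<beta> * ?H)) (evens half) = 0"
    by (rule C_lookup_evens[OF subst[OF h w(2)]])
  then have "lookup w' 0 * lookup \<beta> 0 = 1"
    unfolding split lookup_minus lookup_add XE HE lookup_mult_zero by simp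
  moreover have "lookup (?X - w * (\<alpha> * ?X + \<beta> * ?H)) (expo (x_index 1)) = 0"
    by (rule C_no_linear_terms[OF subst[OF x1 w(1)]])
  then have "lookup w 0 * lookup \<alpha> 0 = 1"
    unfolding split lookup_minus lookup_add XX HX lookup_mult_zero by simp
  moreover have "lookup (?X - w * (\<alpha> * ?X + \<beta> * ?H)) (evens half) = 0"
    by (rule C_lookup_evens[OF subst[OF x1 w(1)]])
  then have "lookup w 0 * lookup \<beta> 0 = 0"
    unfolding split lookup_minus lookup_add XE HE lookup_mult_zero lookup_single_not_eq[OF neq] by simp
  ultimately show False by auto
qed

section \<open>The type\<close>

lemma C_span:
  assumes "p \<in> C i"
  shows "\<exists>w. (\<forall>j. w j \<in> R) \<and> p = (\<Sum>j<i. rels j * w j)"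
  using assms unfolding C_def
proof (induction i arbitrary: p)
  case 0
  then show ?case by (intro exI[of _ "\<lambda>_. 0"]) simp
next
  case (Suc i)
  obtain p' q where p: "p = p' + q * rels i" "p' \<in> mpolys.partial_ideal (2 * n) rels i" "q \<in> R"
    using Suc.prems by (rule mpolys.partial_ideal_SucE)
  obtain w where w: "\<forall>j. w j \<in> R" "p' = (\<Sum>j<i. rels j * w j)" using Suc.IH[OF p(2)] by blast
  have "(\<Sum>j<i. rels j * (w(i := q)) j) = (\<Sum>j<i. rels j * w j)" by (intro sum.cong) auto
  then show ?case using p w by (intro exI[of _ "w(i := q)"]) (simp add: mult.commute)
qed

lemma rel_in_presentation: "j < n \<Longrightarrow> rel j \<in> presentation_ideal"
proof (cases "j = 0")
  case True
  then show ?thesis by (intro presentation_idealI[of 0 1]) (auto simp: C_closed(2))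
next
  case False
  then show "j < n \<Longrightarrow> ?thesis" using rel_in_C[of j "n - 1"] C_subset_presentation by auto
qed

lemma presentation_ideal_span:
  "presentation_ideal = (\<lambda>w. \<Sum>j<n. rel j * w j) ` cvecs R n"
proof
  show "presentation_ideal \<subseteq> (\<lambda>w. \<Sum>j<n. rel j * w j) ` cvecs R n"
  proof
    fix x assume "x \<in> presentation_ideal"
    then obtain p q where pq: "x = p + q * rel 0" "p \<in> C (n - 1)" "q \<in> R" by (auto simp: presentation_ideal_def)
    obtain w where w: "\<forall>j. w j \<in> R" "p = (\<Sum>j<n - 1. rels j * w j)" using C_span[OF pq(2)] by blast
    define v where "v j = (if j = 0 then q else if j < n then w (j - 1) else 0)" for j
    have n: "n = Suc (n - 1)" using n_gt_1 by simp
    have "(\<Sum>j<n. rel j * v j) = rel 0 * v 0 + (\<Sum>j<n - 1. rel (Suc j) * v (Suc j))"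
      by (subst n) (rule sum.lessThan_Suc_shift)
    also have "(\<Sum>j<n - 1. rel (Suc j) * v (Suc j)) = p" unfolding w(2) by (intro sum.cong) (auto simp: v_def)
    finally have "x = (\<Sum>j<n. rel j * v j)" by (simp add: pq(1) v_def mult.commute add.commute)
    moreover have "v \<in> cvecs R n" using w(1) pq(3) n_gt_1 by (auto simp: v_def cvecs_def)
    ultimately show "x \<in> (\<lambda>w. \<Sum>j<n. rel j * w j) ` cvecs R n" by blast
  qed
  show "(\<lambda>w. \<Sum>j<n. rel j * w j) ` cvecs R n \<subseteq> presentation_ideal"
  proof
    fix x assume "x \<in> (\<lambda>w. \<Sum>j<n. rel j * w j) ` cvecs R n"
    then obtain w where w: "w \<in> cvecs R n" "x = (\<Sum>j<n. w j * rel j)" by (auto simp: mult.commute)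
    show "x \<in> presentation_ideal"
      unfolding w(2) using cvecs_mem[OF w(1)] rel_in_presentation
      by (intro mpolys.ideal_sum[OF ideal_presentation] presentation_closed(5)) auto
  qed
qed

lemma homogeneous_rel: "homogeneous 2 (rel j)"
proof -
  have deg: "monomial_degree (lhs j) = 2" "monomial_degree (rhs j) = 2"
    by (simp_all add: lhs_def rhs_def monomial_degree_add)
  have "homogeneous 2 (mon m :: 'k mpoly)" if "monomial_degree m = 2" for m
    using that by (simp add: homogeneous_def)
  then show ?thesis unfolding rel_def using deg by (intro homogeneous_diff) auto
qed

lemma regular_sequence_resolution:
  assumes "free_resolution R presentation_ideal b A"
  shows "resolution_regular_sequence R presentation_ideal b A rels (n - 1)"
proof -
  interpret free_resolution R presentation_ideal b A by fact
  show ?thesis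
  proof
    show "rels i \<in> presentation_ideal" if "i < n - 1" for i
      using rel_in_presentation[of "Suc i"] that by simp
    show "rels i \<in> R" for i by (rule rel_in_R)
    show "q \<in> mpolys.partial_ideal (2 * n) rels i"
      if "i < n - 1" "q \<in> R" "rels i * q \<in> mpolys.partial_ideal (2 * n) rels i" for i q
      using rels_regular[OF that(1,2)] that(3) unfolding C_def by blast
  qed
qed

text \<open>The top cohomology is the linked ideal modulo the regular sequence.\<close>

lemma generated_by_linked_iff:
  assumes res: "free_resolution R presentation_ideal b A" and b1: "b (Suc 0) = n"
    and A0: "\<And>j. j < n \<Longrightarrow> A 0 0 j = rel j"
  shows "mpolys.generated_by (2 * n) t (free_resolution.cocycles R b A (n - 1) {0})
      (free_resolution.coboundaries R b A (n - 1) {0}) \<longleftrightarrow>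
    (\<exists>G. (\<forall>j<t. G j \<in> linked) \<and> (\<forall>p\<in>linked. \<exists>w\<in>cvecs R t. p - (\<Sum>j<t. w j * G j) \<in> C (n - 1)))"
proof -
  interpret res: resolution_regular_sequence R presentation_ideal b A rels "n - 1"
    by (rule regular_sequence_resolution[OF res])
  define scalar where "scalar p = (\<lambda>i::nat. if i = 0 then p else 0)" for p :: "'k mpoly"
  have scalar0: "scalar p 0 = p" for p by (simp add: scalar_def)
  have cv: "scalar p \<in> cvecs R (b 0) \<longleftrightarrow> p \<in> R" for p
    by (auto simp: res.b0 cvecs_def scalar_def)
  have form: "v = scalar (v 0)" if "v \<in> cvecs R (b 0)" for v
  proof
    show "v i = scalar (v 0) i" for i using cvecs_zero[OF that, of i] by (cases i) (simp_all add: res.b0 scalar_def)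
  qed
  have dual0: "res.dual 0 (scalar p) j = (if j < n then rel j * p else 0)" for p j
    by (simp add: res.dual_def mat_apply_def res.b0 b1 A0 scalar0)
  have Z: "scalar p \<in> res.cocycles 0 (C (n - 1)) \<longleftrightarrow> p \<in> linked" for p
  proof
    assume "scalar p \<in> res.cocycles 0 (C (n - 1))"
    then have "p \<in> R" "res.dual 0 (scalar p) 0 \<in> C (n - 1)"
      by (simp_all add: res.cocycles_def cv)
    then show "p \<in> linked" using n_gt_1 by (intro colon_rel0) (auto simp: dual0 mult.commute)
  next
    assume p: "p \<in> linked"
    then have pR: "p \<in> R" by (simp add: linked_def)
    have "rel j * p \<in> C (n - 1)" if "j < n" for j
    proof (cases "j = 0")
      case True
      then show ?thesis using linked_rel0[OF p] by (simp add: mult.commute)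
    next
      case False
      then have "p * rel j \<in> C (n - 1)" using that pR by (intro C_closed(5) rel_in_C) auto
      then show ?thesis by (simp add: mult.commute)
    qed
    then show "scalar p \<in> res.cocycles 0 (C (n - 1))"
      using pR by (auto simp: res.cocycles_def dual0 cv C_closed(2))
  qed
  have Zform: "v = scalar (v 0)" if "v \<in> res.cocycles 0 (C (n - 1))" for v
    using that by (intro form) (simp add: res.cocycles_def)
  have B: "scalar p \<in> res.coboundaries 0 (C (n - 1)) \<longleftrightarrow> p \<in> C (n - 1)" for p
  proof -
    have "(\<forall>j. scalar p j \<in> C (n - 1)) \<longleftrightarrow> p \<in> C (n - 1)"
      by (auto simp: scalar_def C_closed(2))
    moreover have "scalar p \<in> cvecs R (b 0)" if "p \<in> C (n - 1)"
      using that C_closed(1) by (auto simp: cv)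
    ultimately show ?thesis by (auto simp: res.coboundaries_def)
  qed
  have lin: "(\<lambda>i. scalar p i - (\<Sum>j<t. w j * scalar (G j) i)) = scalar (p - (\<Sum>j<t. w j * G j))" for p w G
    by (auto simp: scalar_def fun_eq_iff)
  have "mpolys.generated_by (2 * n) t (res.cocycles 0 (C (n - 1))) (res.coboundaries 0 (C (n - 1))) \<longleftrightarrow>
    (\<exists>G. (\<forall>j<t. G j \<in> linked) \<and> (\<forall>p\<in>linked. \<exists>w\<in>cvecs R t. p - (\<Sum>j<t. w j * G j) \<in> C (n - 1)))"
  proof
    assume "mpolys.generated_by (2 * n) t (res.cocycles 0 (C (n - 1))) (res.coboundaries 0 (C (n - 1)))"
    then obtain G where G: "\<forall>j<t. G j \<in> res.cocycles 0 (C (n - 1))"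
      "\<forall>z\<in>res.cocycles 0 (C (n - 1)). \<exists>w\<in>cvecs R t. (\<lambda>i. z i - (\<Sum>j<t. w j * G j i)) \<in> res.coboundaries 0 (C (n - 1))"
      unfolding mpolys.generated_by_def by blast
    define g where "g j = G j 0" for j
    have Gg: "G j = scalar (g j)" if "j < t" for j using Zform G(1) that by (simp add: g_def)
    have "g j \<in> linked" if "j < t" for j
      using G(1)[rule_format, OF that] unfolding Gg[OF that] Z .
    moreover have "\<exists>w\<in>cvecs R t. p - (\<Sum>j<t. w j * g j) \<in> C (n - 1)" if p: "p \<in> linked" for p
    proof -
      obtain w where w: "w \<in> cvecs R t" "(\<lambda>i. scalar p i - (\<Sum>j<t. w j * G j i)) \<in> res.coboundaries 0 (C (n - 1))"
        using G(2) p Z by blast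
      have "(\<lambda>i. scalar p i - (\<Sum>j<t. w j * G j i)) = (\<lambda>i. scalar p i - (\<Sum>j<t. w j * scalar (g j) i))"
        using Gg by (intro ext arg_cong2[where f = "(-)"] sum.cong) auto
      also have "\<dots> = scalar (p - (\<Sum>j<t. w j * g j))" by (rule lin)
      finally have "scalar (p - (\<Sum>j<t. w j * g j)) \<in> res.coboundaries 0 (C (n - 1))" using w(2) by (simp only:)
      then show ?thesis using w(1) unfolding B by (rule bexI)
    qed
    ultimately show "\<exists>G. (\<forall>j<t. G j \<in> linked) \<and> (\<forall>p\<in>linked. \<exists>w\<in>cvecs R t. p - (\<Sum>j<t. w j * G j) \<in> C (n - 1))"
      by blast
  next
    assume "\<exists>G. (\<forall>j<t. G j \<in> linked) \<and> (\<forall>p\<in>linked. \<exists>w\<in>cvecs R t. p - (\<Sum>j<t. w j * G j) \<in> C (n - 1))"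
    then obtain g where g: "\<forall>j<t. g j \<in> linked" "\<forall>p\<in>linked. \<exists>w\<in>cvecs R t. p - (\<Sum>j<t. w j * g j) \<in> C (n - 1)"
      by blast
    show "mpolys.generated_by (2 * n) t (res.cocycles 0 (C (n - 1))) (res.coboundaries 0 (C (n - 1)))"
      unfolding mpolys.generated_by_def
    proof (intro exI[of _ "\<lambda>j. scalar (g j)"] conjI allI impI ballI)
      show "scalar (g j) \<in> res.cocycles 0 (C (n - 1))" if "j < t" for j using g(1) that Z by blast
      fix z assume z: "z \<in> res.cocycles 0 (C (n - 1))"
      then have "z 0 \<in> linked" using Z[of "z 0"] Zform[OF z] by simp
      then obtain w where w: "w \<in> cvecs R t" "z 0 - (\<Sum>j<t. w j * g j) \<in> C (n - 1)" using g(2) by blast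
      have eq: "(\<lambda>i. z i - (\<Sum>j<t. w j * scalar (g j) i)) = scalar (z 0 - (\<Sum>j<t. w j * g j))"
        by (subst Zform[OF z]) (rule lin)
      show "\<exists>w\<in>cvecs R t. (\<lambda>i. z i - (\<Sum>j<t. w j * scalar (g j) i)) \<in> res.coboundaries 0 (C (n - 1))"
        by (rule bexI[OF _ w(1)]) (unfold eq, rule B[THEN iffD2, OF w(2)])
    qed
  qed
  then show ?thesis using res.generated_by_Ext[of t] unfolding C_def by simp
qed

lemma least_number_of_generators:
  "(LEAST t. \<exists>G. (\<forall>j<t. G j \<in> linked) \<and> (\<forall>p\<in>linked. \<exists>w\<in>cvecs R t. p - (\<Sum>j<t. w j * G j) \<in> C (n - 1))) = 2"
proof (rule Least_equality)
  let ?G = "\<lambda>j::nat. if j = 0 then mon (expo (x_index 1)) else mon (evens half)"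
  have "\<exists>w\<in>cvecs R 2. p - (\<Sum>j<2. w j * ?G j) \<in> C (n - 1)" if p: "p \<in> linked" for p
  proof -
    obtain \<alpha> \<beta> where ab: "\<alpha> \<in> R" "\<beta> \<in> R" "p - (\<alpha> * mon (expo (x_index 1)) + \<beta> * mon (evens half)) \<in> C (n - 1)"
      using p by (auto simp: linked_def)
    let ?w = "\<lambda>j::nat. if j = 0 then \<alpha> else if j = 1 then \<beta> else 0"
    have "?w \<in> cvecs R 2" using ab by (auto simp: cvecs_def)
    moreover have "(\<Sum>j<2. ?w j * ?G j) = \<alpha> * mon (expo (x_index 1)) + \<beta> * mon (evens half)"
      by (simp add: numeral_2_eq_2)
    ultimately show ?thesis using ab(3) by (intro bexI[of _ ?w]) auto
  qed
  then show "\<exists>G. (\<forall>j<2. G j \<in> linked) \<and> (\<forall>p\<in>linked. \<exists>w\<in>cvecs R 2. p - (\<Sum>j<2. w j * G j) \<in> C (n - 1))"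
    using x1_linked h_linked by (intro exI[of _ ?G]) auto
next
  fix t assume "\<exists>G. (\<forall>j<t. G j \<in> linked) \<and> (\<forall>p\<in>linked. \<exists>w\<in>cvecs R t. p - (\<Sum>j<t. w j * G j) \<in> C (n - 1))"
  then obtain G where G: "\<And>j. j < t \<Longrightarrow> G j \<in> linked"
    "\<And>p. p \<in> linked \<Longrightarrow> \<exists>w\<in>cvecs R t. p - (\<Sum>j<t. w j * G j) \<in> C (n - 1)" by blast
  show "2 \<le> t"
  proof (rule ccontr)
    assume t: "\<not> 2 \<le> t"
    \<comment> \<open>The empty family generates the same as the family with the single element \<open>0\<close>.\<close>
    define z where "z = (if t = 0 then 0 else G 0)"
    have z: "z \<in> linked" using G(1)[of 0] C_subset_linked C_closed(2) by (auto simp: z_def)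
    have sum: "(\<Sum>j<t. w j * G j) = w 0 * z" if "w \<in> cvecs R t" for w
    proof (cases "t = 0")
      case False
      then have "t = 1" using t by simp
      then show ?thesis by (simp add: z_def)
    qed (simp add: z_def)
    have mult: "\<exists>w\<in>R. p - w * z \<in> C (n - 1)" if p: "p \<in> linked" for p
    proof -
      obtain w where w: "w \<in> cvecs R t" "p - (\<Sum>j<t. w j * G j) \<in> C (n - 1)" using G(2)[OF p] by blast
      have "w 0 \<in> R" using cvecs_mem[OF w(1)] by simp
      then show ?thesis using w(2) unfolding sum[OF w(1)] by blast
    qed
    obtain w where w: "w \<in> R" "mon (expo (x_index 1)) - w * z \<in> C (n - 1)" using mult[OF x1_linked] by blast
    obtain w' where w': "w' \<in> R" "mon (evens half) - w' * z \<in> C (n - 1)" using mult[OF h_linked] by blast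
    show False by (rule linked_not_principal[OF z w(1) w'(1) w(2) w'(2)])
  qed
qed

theorem cm_type:
  "has_cm_type (\<lambda>c :: 'k. [:const c:]) (rees_algebra (mpolys n) (cycle_path_ideal n (n - 2))) gens 2"
proof -
  define A0 :: "nat \<Rightarrow> nat \<Rightarrow> 'k mpoly" where "A0 i j = rel j" for i j
  obtain b a A where ba: "b 0 = 1" "a 0 = (\<lambda>_. 0)" "b (Suc 0) = n" "A 0 = A0"
    and A: "\<forall>k. \<forall>i<b k. \<forall>j<b (Suc k). A k i j \<in> R \<and> homogeneous (a (Suc k) j - a k i) (A k i j)"
    and exact: "\<forall>k. {w \<in> cvecs R (b (Suc k)). mat_apply (b k) (b (Suc k)) (A k) w = (\<lambda>i. 0)} =
      mat_apply (b (Suc k)) (b (Suc (Suc k))) (A (Suc k)) ` cvecs R (b (Suc (Suc k)))"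
    using graded_resolution_exists[of 1 n A0 "2 * n" "\<lambda>_. 2" "\<lambda>_. 0"] rel_in_R homogeneous_rel
    by (auto simp: A0_def)
  have res: "free_resolution R presentation_ideal b A"
  proof
    show "presentation_ideal = (\<lambda>w. \<Sum>j<b (Suc 0). A 0 0 j * w j) ` cvecs R (b (Suc 0))"
      unfolding presentation_ideal_span ba A0_def ..
  qed (use ba A exact in auto)
  interpret res: free_resolution R presentation_ideal b A by (rule res)
  define D where "D k = mat (b k) (b (Suc k)) (\<lambda>(i, j). A k i j)" for k
  have Dv: "D k *\<^sub>v vec (b (Suc k)) f = vec (b k) (mat_apply (b k) (b (Suc k)) (A k) f)" for k f
    unfolding D_def by (rule mat_mult_vec)
  have Dt: "transpose_mat (D k) *\<^sub>v vec (b k) f = vec (b (Suc k)) (res.dual k f)" for k f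
    unfolding D_def transpose_mat_of mat_mult_vec res.dual_def ..
  have resolution: "graded_free_resolution (2 * n) presentation_ideal b a D"
    unfolding graded_free_resolution_def
  proof (intro conjI allI impI)
    show "b 0 = 1" "a 0 0 = 0" by (simp_all add: ba)
    show "D i \<in> poly_mats (2 * n) (b i) (b (Suc i))" for i using A by (auto simp: D_def poly_mats_def)
    show "homogeneous (a (Suc i) k - a i j) (D i $$ (j, k))" if "j < b i" "k < b (Suc i)" for i j k
      using A that by (simp add: D_def)
    have "{(D 0 *\<^sub>v v) $ 0 | v. v \<in> poly_vecs (2 * n) (b 1)} = (\<lambda>f. (D 0 *\<^sub>v vec (b (Suc 0)) f) $ 0) ` cvecs R (b (Suc 0))"
      unfolding poly_vecs_eq by auto
    also have "\<dots> = (\<lambda>w. \<Sum>j<b (Suc 0). A 0 0 j * w j) ` cvecs R (b (Suc 0))"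
      unfolding Dv by (simp add: ba mat_apply_def)
    finally show "{(D 0 *\<^sub>v v) $ 0 | v. v \<in> poly_vecs (2 * n) (b 1)} = presentation_ideal"
      unfolding res.augmentation .
    fix i
    have "{v \<in> poly_vecs (2 * n) (b (Suc i)). D i *\<^sub>v v = 0\<^sub>v (b i)} =
      vec (b (Suc i)) ` {w \<in> cvecs R (b (Suc i)). mat_apply (b i) (b (Suc i)) (A i) w = (\<lambda>i. 0)}"
    proof -
      have "D i *\<^sub>v vec (b (Suc i)) f = 0\<^sub>v (b i) \<longleftrightarrow> mat_apply (b i) (b (Suc i)) (A i) f = (\<lambda>i. 0)" for f
        unfolding Dv by (rule vec_mapply_eq_0)
      then show ?thesis unfolding poly_vecs_eq by blast
    qed
    also have "\<dots> = {D (Suc i) *\<^sub>v w | w. w \<in> poly_vecs (2 * n) (b (Suc (Suc i)))}"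
      unfolding exact[rule_format] poly_vecs_eq by (simp add: Setcompr_eq_image image_image Dv)
    finally show "{v \<in> poly_vecs (2 * n) (b (Suc i)). D i *\<^sub>v v = 0\<^sub>v (b i)} =
      {D (Suc i) *\<^sub>v w | w. w \<in> poly_vecs (2 * n) (b (Suc (Suc i)))}" .
  qed
  have cocycles: "ext_cocycles (2 * n) b D (n - 1) = vec (b (n - 1)) ` res.cocycles (n - 1) {0}"
  proof -
    have "transpose_mat (D k) *\<^sub>v vec (b k) f = 0\<^sub>v (b (Suc k)) \<longleftrightarrow> (\<forall>j. res.dual k f j \<in> {0})" for k f
      unfolding Dt unfolding res.dual_def vec_mapply_eq_0 by (auto simp: fun_eq_iff)
    then show ?thesis
      unfolding ext_cocycles_def res.cocycles_def poly_vecs_eq by blast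
  qed
  have coboundaries: "ext_coboundaries (2 * n) b D (n - 1) = vec (b (n - 1)) ` res.coboundaries (n - 1) {0}"
  proof -
    obtain c where c: "n - 1 = Suc c" using n_gt_1 by (cases "n - 1") auto
    show ?thesis
      unfolding res.coboundaries_zero c ext_coboundaries_def poly_vecs_eq
      by (simp add: Setcompr_eq_image image_image Dt)
  qed
  have sub: "res.cocycles (n - 1) {0} \<subseteq> cvecs R (b (n - 1))" "res.coboundaries (n - 1) {0} \<subseteq> cvecs R (b (n - 1))"
    by (auto simp: res.cocycles_def res.coboundaries_def)
  have "min_generators (2 * n) (b (n - 1)) (ext_cocycles (2 * n) b D (n - 1)) (ext_coboundaries (2 * n) b D (n - 1)) = 2"
    unfolding min_generators_def cocycles coboundaries matrix_generators_iff[OF sub]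
      generated_by_linked_iff[OF res ba(3) fun_cong[OF fun_cong[OF ba(4)], of 0, unfolded A0_def]]
    by (rule least_number_of_generators)
  moreover have "2 * n - (n + 1) = n - 1" by simp
  moreover have "n + 1 \<le> 2 * n" using n_gt_1 by simp
  ultimately show ?thesis
    unfolding has_cm_type_def Let_def length_gens relation_ideal_eq rees_algebra_eq_image
    using resolution krull_dim_image
    by (intro conjI exI[of _ "n + 1"] exI[of _ b] exI[of _ a] exI[of _ D]) auto
qed

end

theorem theorem4p7:
  fixes n :: nat
  assumes "n > 1" and "odd n"
  shows "has_cm_type (\<lambda>c :: 'k::field. [:const c:])
           (rees_algebra (mpolys n) (cycle_path_ideal n (n - 2)))
           (rees_generators n (n - 2)) 2"
proof -
  interpret odd_cycle n "TYPE('k)" by unfold_locales (rule assms)+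
  show ?thesis by (rule cm_type)
qed

end
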